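(* Let $r \in \{1,2,\ldots,\infty\}$ and let $M \subset \mathbb{R}^N$ be a compact, embedded $C^r$ submanifold of $\mathbb{R}^N$. Let $T : M \to M$ be a $C^r$ diffeomorphism. Let $X \subset M$ be a compact set and let $\mu$ be a Borel probability measure on $X$. Fix $k \in \mathbb{N}$ and assume $\mu\left(\bigcup_{j=1}^{k-1}\mathrm{Per}_j(T)\right) = 0$. Let $h_1,\ldots,h_m : \mathbb{R}^N \to \mathbb{R}$ be a basis of the linear space of $N$-variate real polynomials of degree at most $2k-1$. Fix a $C^r$ observable $h : M \to \mathbb{R}$. For $\alpha \in \mathbb{R}^m$, let $\phi_{h_\alpha,k}$ be the $k$-delay coordinate map corresponding to the observable $h_\alpha = h + \sum_{j=1}^m \alpha_j h_j$ (restricted to $M$). Then the following hold for Lebesgue almost every $\alpha \in \mathbb{R}^m$: (1) if $\mathcal{H}^k(X) = 0$ and $k \geq \dim M$, then for $\mu$-a.e. $x$ there exists $C = C(x,\alpha) \in [0,\infty)$ such that $$\|x-y\| \leq C\,\|\phi_{h_\alpha,k}(x) - \phi_{h_\alpha,k}(y)\| \quad \text{for every } y \in X;$$ (2) if $k > \dim M$, then for $\mu$-a.e. $x$ there exist open neighbourhoods $U$ of $x$ in $M$ and $V$ of $\phi_{h_\alpha,k}(x)$ in $\mathbb{R}^k$ such that $\phi_{h_\alpha,k}$ is a $C^r$ diffeomorphism between $U$ and $V \cap \phi_{h_\alpha,k}(M)$.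
   Context: $\mathbb{N} = \{1,2,\ldots\}$. $\mathrm{Per}_p(T) = \{x \in M : T^p x = x\}$. For $g : M \to \mathbb{R}$, the $k$-delay coordinate map is $\phi_{g,k} : M \to \mathbb{R}^k$, $\phi_{g,k}(x) = (g(x), g(Tx),\ldots,g(T^{k-1}x))$. $\mathcal{H}^k$ is the $k$-dimensional Hausdorff measure and $\|\cdot\|$ is the Euclidean norm. Part of statement (2) is that $V \cap \phi_{h_\alpha,k}(M)$ is an embedded $C^r$ submanifold of $\mathbb{R}^k$. *)

theory Defs
  imports "HOL-Probability.Probability"
begin

text \<open>Only used for open \<open>S\<close>: there it says that \<open>f\<close> is of class \<open>C\<^sup>n\<close> (all iterated directional
  derivatives up to order \<open>n\<close> exist and are continuous).\<close>

fun n_times_cont_diff_on :: "nat \<Rightarrow> ('a::real_normed_vector \<Rightarrow> 'b::real_normed_vector) \<Rightarrow> 'a set \<Rightarrow> bool"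
where
  "n_times_cont_diff_on 0 f S \<longleftrightarrow> continuous_on S f"
| "n_times_cont_diff_on (Suc n) f S \<longleftrightarrow>
     (\<forall>x\<in>S. f differentiable (at x)) \<and>
     (\<forall>v. n_times_cont_diff_on n (\<lambda>x. frechet_derivative f (at x) v) S)"

text \<open>Class \<open>C\<^sup>r\<close>, \<open>r \<in> {0, 1, \<dots>, \<infinity>}\<close>, on an arbitrary subset of a Euclidean space: locally the
  restriction of a \<open>C\<^sup>r\<close> map defined on an open subset of the ambient space. For open \<open>S\<close>, and for
  embedded \<open>C\<^sup>r\<close> submanifolds \<open>S\<close>, this is the usual notion.\<close>

definition C_on :: "enat \<Rightarrow> ('a::euclidean_space \<Rightarrow> 'b::euclidean_space) \<Rightarrow> 'a set \<Rightarrow> bool" where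
  "C_on r f S \<longleftrightarrow>
     (\<forall>x\<in>S. \<exists>W F. open W \<and> x \<in> W \<and>
        (\<forall>n. enat n \<le> r \<longrightarrow> n_times_cont_diff_on n F W) \<and> (\<forall>y\<in>W \<inter> S. F y = f y))"

definition C_diffeo_on ::
  "enat \<Rightarrow> ('a::euclidean_space \<Rightarrow> 'b::euclidean_space) \<Rightarrow> 'a set \<Rightarrow> 'b set \<Rightarrow> bool" where
  "C_diffeo_on r f S S' \<longleftrightarrow>
     bij_betw f S S' \<and> C_on r f S \<and> C_on r (the_inv_into S f) S'"

text \<open>\<open>M\<close> is an embedded \<open>C\<^sup>r\<close> submanifold (without boundary) of dimension \<open>d\<close>: around each of its
  points a \<open>C\<^sup>r\<close> diffeomorphism between open subsets of the ambient space straightens \<open>M\<close>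
  to a \<open>d\<close>-dimensional linear subspace.\<close>

definition embedded_submanifold :: "enat \<Rightarrow> nat \<Rightarrow> 'a::euclidean_space set \<Rightarrow> bool" where
  "embedded_submanifold r d M \<longleftrightarrow>
     (\<forall>x\<in>M. \<exists>(W::'a set) (W'::'a set) \<psi> L.
        open W \<and> x \<in> W \<and> open W' \<and> C_diffeo_on r \<psi> W W' \<and>
        subspace L \<and> dim L = d \<and> \<psi> ` (W \<inter> M) = W' \<inter> L)"

definition Per :: "'a set \<Rightarrow> ('a \<Rightarrow> 'a) \<Rightarrow> nat \<Rightarrow> 'a set" where
  "Per M T p = {x \<in> M. (T ^^ p) x = x}"

text \<open>The \<open>k\<close>-delay coordinate map into \<open>real ^ 'k\<close>, where \<open>k = CARD('k)\<close>. As the index type carries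
  no order, \<open>idx\<close> is a numbering of it by \<open>0, \<dots>, k - 1\<close>: coordinate \<open>i\<close> is the observation at
  time \<open>idx i\<close>.\<close>

definition delay_map :: "('k::finite \<Rightarrow> nat) \<Rightarrow> ('a \<Rightarrow> 'a) \<Rightarrow> ('a \<Rightarrow> real) \<Rightarrow> 'a \<Rightarrow> real ^ 'k" where
  "delay_map idx T g x = (\<chi> i. g ((T ^^ idx i) x))"

definition perturbed_observable ::
  "('a \<Rightarrow> real) \<Rightarrow> ('m::finite \<Rightarrow> 'a \<Rightarrow> real) \<Rightarrow> real ^ 'm \<Rightarrow> 'a \<Rightarrow> real" where
  "perturbed_observable h hs \<alpha> x = h x + (\<Sum>j\<in>UNIV. \<alpha> $ j * hs j x)"

text \<open>\<open>s\<close>-dimensional Hausdorff (outer) measure, without normalising constant. The side condition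
  \<open>bounded\<close> is needed because \<^const>\<open>diameter\<close> is only meaningful on bounded sets; empty
  covering sets contribute \<open>0\<close> also for \<open>s = 0\<close>.\<close>

definition hausdorff_content :: "real \<Rightarrow> nat \<Rightarrow> 'a::metric_space set \<Rightarrow> ennreal" where
  "hausdorff_content \<delta> s A =
     (INF U \<in> {U :: nat \<Rightarrow> 'a set. (\<forall>i. bounded (U i) \<and> diameter (U i) \<le> \<delta>) \<and> A \<subseteq> (\<Union>i. U i)}.
        \<Sum>i. if U i = {} then 0 else ennreal (diameter (U i) ^ s))"

definition hausdorff_measure :: "nat \<Rightarrow> 'a::metric_space set \<Rightarrow> ennreal" where
  "hausdorff_measure s A = (SUP \<delta> \<in> {0<..}. hausdorff_content \<delta> s A)"

text \<open>Real polynomials in the coordinates of \<open>real ^ 'n\<close>, of total degree at most \<open>D\<close>, as functions;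
  \<open>a\<close> ranges over the (finitely many) exponent vectors of degree at most \<open>D\<close>.\<close>

definition polys_degree_le :: "nat \<Rightarrow> (real ^ 'n \<Rightarrow> real) set" where
  "polys_degree_le D =
     {p. \<exists>c :: ('n \<Rightarrow> nat) \<Rightarrow> real.
        p = (\<lambda>x. \<Sum>a | (\<Sum>i\<in>UNIV. a i) \<le> D. c a * (\<Prod>i\<in>UNIV. (x $ i) ^ a i))}"

lemma finite_exponents_degree_le: "finite {a :: 'n::finite \<Rightarrow> nat. (\<Sum>i\<in>UNIV. a i) \<le> D}"
proof (rule finite_subset)
  show "{a :: 'n \<Rightarrow> nat. (\<Sum>i\<in>UNIV. a i) \<le> D} \<subseteq> (\<Pi>\<^sub>E i\<in>UNIV. {..D})"
  proof
    fix a :: "'n \<Rightarrow> nat"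
    assume "a \<in> {a. (\<Sum>i\<in>UNIV. a i) \<le> D}"
    moreover have "a i \<le> (\<Sum>i\<in>UNIV. a i)" for i
      by (rule member_le_sum) simp_all
    ultimately have "a i \<le> D" for i
      using le_trans by blast
    then show "a \<in> (\<Pi>\<^sub>E i\<in>UNIV. {..D})"
      by (simp add: PiE_iff)
  qed
  show "finite ((\<Pi>\<^sub>E i\<in>UNIV. {..D}) :: ('n \<Rightarrow> nat) set)"
    by (rule finite_PiE) simp_all
qed

text \<open>The family \<open>b\<close> is a basis of the linear space \<open>P\<close> of real functions: its members lie in \<open>P\<close>,
  it is linearly independent, and it spans \<open>P\<close>.\<close>

definition is_function_basis :: "('m::finite \<Rightarrow> 'a \<Rightarrow> real) \<Rightarrow> ('a \<Rightarrow> real) set \<Rightarrow> bool" where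
  "is_function_basis b P \<longleftrightarrow>
     range b \<subseteq> P \<and>
     (\<forall>c :: 'm \<Rightarrow> real. (\<forall>x. (\<Sum>j\<in>UNIV. c j * b j x) = 0) \<longrightarrow> (\<forall>j. c j = 0)) \<and>
     (\<forall>p\<in>P. \<exists>c :: 'm \<Rightarrow> real. p = (\<lambda>x. \<Sum>j\<in>UNIV. c j * b j x))"

end

theory Submission
  imports Defs
begin

text \<open>Fix a point \<open>x\<close> whose first \<open>k\<close> iterates are distinct. By Tonelli it suffices to show that for almost
  every \<open>\<alpha>\<close> the map \<open>\<phi>\<^sub>\<alpha>\<close> has a Lipschitz inverse at \<open>x\<close>, since the set of good pairs \<open>(x, \<alpha>)\<close> is a
  countable union of closed sets. By compactness this follows once \<open>\<phi>\<^sub>\<alpha>\<close> is an immersion at \<open>x\<close> and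
  \<open>\<phi>\<^sub>\<alpha> x \<noteq> \<phi>\<^sub>\<alpha> y\<close> for all \<open>y \<noteq> x\<close>. Both are instances of the same transversality statement: a family of
  affine maps \<open>\<alpha> \<mapsto> w y + D y \<alpha>\<close> into \<open>\<real>\<^sup>k\<close>, Lipschitz in \<open>y\<close> and with \<open>D y\<close> onto, has a zero at some \<open>y\<close>
  only for a null set of \<open>\<alpha>\<close>, if \<open>y\<close> ranges over a set whose Lipschitz images in \<open>\<real>\<^sup>k\<close> are null. For
  injectivity \<open>D y\<close> is onto by interpolation at the at most \<open>2k\<close> points of the two orbit segments; for the
  immersion property \<open>y\<close> is a unit tangent vector (the unit sphere of the tangent space has dimension
  \<open>dim M - 1 < k\<close>), and \<open>D y\<close> is onto by Hermite interpolation, again in degree \<open>2k - 1\<close>. In the second claim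
  one takes all of \<open>M\<close> for the range of \<open>y\<close>; the Lipschitz inverse at \<open>x\<close> makes \<open>\<phi>\<^sub>\<alpha>\<close> an immersion at \<open>x\<close>
  that separates \<open>x\<close> from the rest of \<open>M\<close>, and the inverse function theorem does the rest.\<close>

subsection \<open>Calculus of \<open>C\<^sup>r\<close> maps\<close>

text \<open>The degree \<open>2k - 1\<close> is spent exactly in both interpolations. Separating one
  of the \<open>2k\<close> points of two orbit segments from the rest costs one affine factor for
  each of the other \<open>2k - 1\<close> points. Prescribing a derivative at one of
  \<open>k\<close> points costs one affine factor and the squared distance to each of the other
  \<open>k - 1\<close>, in all \<open>1 + 2(k - 1)\<close>. The first count breaks down when the two
  segments meet, so points \<open>y\<close> whose segment meets that of \<open>x\<close> are treated
  apart. Tangent spaces are never constructed. \<open>T\<close> and \<open>h\<close> are smooth only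
  along \<open>M\<close>, so derivatives are taken of local extensions in a chart and evaluated on
  the model subspace \<open>L\<close> alone. That the derivatives of the iterates are injective on
  \<open>L\<close> follows from a locally Lipschitz left inverse, by passing to the limit in
  difference quotients. For the same reason immersivity at \<open>x\<close> is stated as a Lipschitz
  estimate near \<open>x\<close>: it can be globalised by compactness in the first claim and turned
  back into an injective derivative in the second.\<close>

lemma n_times_cont_diff_on_cong:
  assumes "open S" "\<And>x. x \<in> S \<Longrightarrow> f x = g x" "n_times_cont_diff_on n f S"
  shows "n_times_cont_diff_on n g S"
  using assms(2,3)
proof (induction n arbitrary: f g)
  case 0
  then show ?case by (simp cong: continuous_on_cong)
next
  case (Suc n)
  have d: "(g has_derivative frechet_derivative f (at x)) (at x)" if "x \<in> S" for x
  proof (rule has_derivative_transform_within_open[OF _ assms(1) that])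
    show "(f has_derivative frechet_derivative f (at x)) (at x)"
      using Suc.prems(2) that by (simp add: frechet_derivative_works[symmetric])
  qed (rule Suc.prems(1))
  then have eq: "frechet_derivative g (at x) = frechet_derivative f (at x)" if "x \<in> S" for x
    using that by (metis frechet_derivative_at)
  show ?case
    unfolding n_times_cont_diff_on.simps
  proof (intro conjI ballI allI)
    show "g differentiable at x" if "x \<in> S" for x
      using d[OF that] differentiable_def by blast
    show "n_times_cont_diff_on n (\<lambda>x. frechet_derivative g (at x) v) S" for v
      by (rule Suc.IH[of "\<lambda>x. frechet_derivative f (at x) v"]) (use Suc.prems(2) in \<open>auto simp: eq\<close>)
  qed
qed

text \<open>By uniqueness of derivatives any explicit formula \<open>f'\<close> may stand in for
  \<open>frechet_derivative f\<close>. The closure properties below are inductions on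
  \<open>n\<close> in which this rule reduces the step to the class of \<open>f'\<close>.\<close>

lemma n_times_cont_diff_on_SucI:
  assumes "open S" "\<And>x. x \<in> S \<Longrightarrow> (f has_derivative f' x) (at x)"
    and "\<And>v. n_times_cont_diff_on n (\<lambda>x. f' x v) S"
  shows "n_times_cont_diff_on (Suc n) f S"
proof -
  have "frechet_derivative f (at x) = f' x" if "x \<in> S" for x
    using assms(2)[OF that] by (simp add: frechet_derivative_at[symmetric])
  then show ?thesis
    using assms(2) unfolding n_times_cont_diff_on.simps
    by (intro conjI ballI allI n_times_cont_diff_on_cong[OF assms(1) _ assms(3)])
      (auto simp: differentiable_def)
qed

lemma n_times_cont_diff_on_Suc_has_derivative:
  assumes "n_times_cont_diff_on (Suc n) f S" "x \<in> S"
  shows "(f has_derivative frechet_derivative f (at x)) (at x)"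
  using assms by (simp add: frechet_derivative_works[symmetric])

lemma n_times_cont_diff_on_imp_continuous:
  "n_times_cont_diff_on n f S \<Longrightarrow> continuous_on S f"
  by (cases n)
    (auto simp: continuous_on_eq_continuous_within intro!: differentiable_imp_continuous_within
      intro: differentiable_at_withinI)

lemma n_times_cont_diff_on_Suc_imp:
  "n_times_cont_diff_on (Suc n) f S \<Longrightarrow> n_times_cont_diff_on n f S"
proof (induction n arbitrary: f)
  case 0
  then show ?case using n_times_cont_diff_on_imp_continuous by fastforce
next
  case (Suc n)
  then show ?case by simp
qed

lemma n_times_cont_diff_on_subset:
  "n_times_cont_diff_on n f S \<Longrightarrow> S' \<subseteq> S \<Longrightarrow> n_times_cont_diff_on n f S'"
  by (induction n arbitrary: f) (auto intro: continuous_on_subset)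

lemma n_times_cont_diff_on_const: "open S \<Longrightarrow> n_times_cont_diff_on n (\<lambda>x. c) S"
  by (induction n arbitrary: c) auto

lemma n_times_cont_diff_on_linear:
  fixes f :: "'a::real_normed_vector \<Rightarrow> 'b::real_normed_vector"
  assumes "open S" "bounded_linear f"
  shows "n_times_cont_diff_on n f S"
proof (cases n)
  case 0
  then show ?thesis using assms by (simp add: linear_continuous_on)
next
  case (Suc m)
  show ?thesis unfolding Suc
    by (rule n_times_cont_diff_on_SucI[OF assms(1) bounded_linear_imp_has_derivative[OF assms(2)]])
      (rule n_times_cont_diff_on_const[OF assms(1)])
qed

lemma n_times_cont_diff_on_add:
  assumes "open S" "n_times_cont_diff_on n f S" "n_times_cont_diff_on n g S"
  shows "n_times_cont_diff_on n (\<lambda>x. f x + g x) S"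
  using assms(2,3)
proof (induction n arbitrary: f g)
  case 0
  then show ?case by (simp add: continuous_on_add)
next
  case (Suc n)
  show ?case
    by (rule n_times_cont_diff_on_SucI[OF assms(1) has_derivative_add[OF
          n_times_cont_diff_on_Suc_has_derivative[OF Suc.prems(1)]
          n_times_cont_diff_on_Suc_has_derivative[OF Suc.prems(2)]] Suc.IH])
      (use Suc.prems in auto)
qed

lemma n_times_cont_diff_on_sum:
  assumes "open S" "\<And>i. i \<in> I \<Longrightarrow> n_times_cont_diff_on n (f i) S"
  shows "n_times_cont_diff_on n (\<lambda>x. \<Sum>i\<in>I. f i x) S"
  using assms(2)
  by (induction I rule: infinite_finite_induct)
    (auto intro: n_times_cont_diff_on_add[OF assms(1)] n_times_cont_diff_on_const[OF assms(1)])

lemma n_times_cont_diff_on_scaleR: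
  fixes a :: "'a::real_normed_vector \<Rightarrow> real" and f :: "'a \<Rightarrow> 'b::real_normed_vector"
  assumes "open S" "n_times_cont_diff_on n a S" "n_times_cont_diff_on n f S"
  shows "n_times_cont_diff_on n (\<lambda>x. a x *\<^sub>R f x) S"
  using assms(2,3)
proof (induction n arbitrary: a f)
  case 0
  then show ?case by (simp add: continuous_on_scaleR)
next
  case (Suc n)
  show ?case
  proof (rule n_times_cont_diff_on_SucI[OF assms(1)])
    show "((\<lambda>x. a x *\<^sub>R f x) has_derivative
        (\<lambda>v. a x *\<^sub>R frechet_derivative f (at x) v + frechet_derivative a (at x) v *\<^sub>R f x)) (at x)"
      if "x \<in> S" for x
      using Suc.prems that by (intro has_derivative_scaleR n_times_cont_diff_on_Suc_has_derivative)
    show "n_times_cont_diff_on n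
        (\<lambda>x. a x *\<^sub>R frechet_derivative f (at x) v + frechet_derivative a (at x) v *\<^sub>R f x) S" for v
      using Suc.prems n_times_cont_diff_on_Suc_imp[OF Suc.prems(1)] n_times_cont_diff_on_Suc_imp[OF Suc.prems(2)]
      by (intro n_times_cont_diff_on_add[OF assms(1)] Suc.IH) simp_all
  qed
qed

lemma n_times_cont_diff_on_mult:
  fixes a f :: "'a::real_normed_vector \<Rightarrow> real"
  shows "open S \<Longrightarrow> n_times_cont_diff_on n a S \<Longrightarrow> n_times_cont_diff_on n f S
    \<Longrightarrow> n_times_cont_diff_on n (\<lambda>x. a x * f x) S"
  using n_times_cont_diff_on_scaleR[of S n a f] by simp

lemma n_times_cont_diff_on_prod:
  fixes f :: "'i \<Rightarrow> 'a::real_normed_vector \<Rightarrow> real"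
  assumes "open S" "\<And>i. i \<in> I \<Longrightarrow> n_times_cont_diff_on n (f i) S"
  shows "n_times_cont_diff_on n (\<lambda>x. \<Prod>i\<in>I. f i x) S"
  using assms(2)
  by (induction I rule: infinite_finite_induct)
    (auto intro: n_times_cont_diff_on_mult[OF assms(1)] n_times_cont_diff_on_const[OF assms(1)])

text \<open>The derivative of \<open>1/a\<close> is a product of \<open>1/a\<close>,
  \<open>a'\<close> and \<open>1/a\<close>, and the induction hypothesis already gives class C^n to
  \<open>1/a\<close>.\<close>

lemma n_times_cont_diff_on_inverse:
  fixes a :: "'a::real_normed_vector \<Rightarrow> real"
  assumes "open S" "\<And>x. x \<in> S \<Longrightarrow> a x \<noteq> 0" "n_times_cont_diff_on n a S"
  shows "n_times_cont_diff_on n (\<lambda>x. inverse (a x)) S"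
  using assms(3)
proof (induction n)
  case 0
  then show ?case using assms(2) by (auto intro: continuous_on_inverse)
next
  case (Suc n)
  have I: "n_times_cont_diff_on n (\<lambda>x. inverse (a x)) S"
    using Suc n_times_cont_diff_on_Suc_imp by blast
  have "n_times_cont_diff_on n
      (\<lambda>x. (-1) * ((inverse (a x) * frechet_derivative a (at x) v) * inverse (a x))) S" for v
    by (intro n_times_cont_diff_on_mult assms(1) I n_times_cont_diff_on_const)
      (use Suc.prems in simp)
  then show ?case
    using Deriv.has_derivative_inverse[OF assms(2) n_times_cont_diff_on_Suc_has_derivative[OF Suc.prems]]
    by (intro n_times_cont_diff_on_SucI[OF assms(1)]) auto
qed

lemma n_times_cont_diff_on_bounded_linear_compose:
  assumes "open S" "bounded_linear l" "n_times_cont_diff_on n f S"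
  shows "n_times_cont_diff_on n (\<lambda>x. l (f x)) S"
  using assms(3)
proof (induction n arbitrary: f)
  case 0
  then show ?case
    by (auto intro: bounded_linear.continuous_on[OF assms(2)])
next
  case (Suc n)
  show ?case
    by (rule n_times_cont_diff_on_SucI[OF assms(1) bounded_linear.has_derivative[OF assms(2)
          n_times_cont_diff_on_Suc_has_derivative[OF Suc.prems]] Suc.IH])
      (use Suc.prems in auto)
qed

lemma linear_Basis_expansion:
  fixes f :: "'a::euclidean_space \<Rightarrow> 'b::real_vector"
  assumes "linear f"
  shows "f w = (\<Sum>b\<in>Basis. (w \<bullet> b) *\<^sub>R f b)"
proof -
  have "f (\<Sum>b\<in>Basis. (w \<bullet> b) *\<^sub>R b) = (\<Sum>b\<in>Basis. (w \<bullet> b) *\<^sub>R f b)"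
    using assms by (simp add: linear_sum linear_scale)
  then show ?thesis by (simp add: euclidean_representation)
qed

text \<open>Expanding the inner derivative in the basis splits the chain rule into products of
  \<open>?f' x v \<bullet> b\<close> and \<open>?g' (f x) b\<close>. The second factor is again a
  composition with \<open>f\<close>, one order lower, hence the induction over arbitrary
  \<open>g\<close>.\<close>

lemma n_times_cont_diff_on_compose:
  fixes f :: "'a::euclidean_space \<Rightarrow> 'b::euclidean_space"
    and g :: "'b \<Rightarrow> 'c::euclidean_space"
  assumes "open S" "open S'" "f ` S \<subseteq> S'" "n_times_cont_diff_on n f S" "n_times_cont_diff_on n g S'"
  shows "n_times_cont_diff_on n (\<lambda>x. g (f x)) S"
  using assms(4,5)
proof (induction n arbitrary: g)
  case 0
  then show ?case using assms(3) by (auto intro: continuous_on_compose2)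
next
  case (Suc n)
  let ?f' = "\<lambda>x. frechet_derivative f (at x)" and ?g' = "\<lambda>x. frechet_derivative g (at x)"
  have df: "(f has_derivative ?f' x) (at x)" if "x \<in> S" for x
    using n_times_cont_diff_on_Suc_has_derivative Suc.prems that by blast
  have dg: "(g has_derivative ?g' (f x)) (at (f x))" if "x \<in> S" for x
    using n_times_cont_diff_on_Suc_has_derivative Suc.prems that assms(3) by blast
  show ?case
  proof (rule n_times_cont_diff_on_SucI[OF assms(1)])
    fix x assume x: "x \<in> S"
    have "?g' (f x) w = (\<Sum>b\<in>Basis. (w \<bullet> b) *\<^sub>R ?g' (f x) b)" for w
      by (rule linear_Basis_expansion[OF has_derivative_linear[OF dg[OF x]]])
    then show "((\<lambda>x. g (f x)) has_derivative
        (\<lambda>v. \<Sum>b\<in>Basis. (?f' x v \<bullet> b) *\<^sub>R ?g' (f x) b)) (at x)"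
      by (intro has_derivative_eq_rhs[OF has_derivative_compose[OF df[OF x] dg[OF x]]] ext)
  next
    fix v
    have 0: "n_times_cont_diff_on n (\<lambda>x. ?f' x v) S"
      using Suc.prems(1) by simp
    have 1: "n_times_cont_diff_on n (\<lambda>x. ?f' x v \<bullet> b) S" for b
      by (rule n_times_cont_diff_on_bounded_linear_compose[OF assms(1) bounded_linear_inner_left 0])
    have 2: "n_times_cont_diff_on n (\<lambda>x. ?g' (f x) b) S" for b
      by (rule Suc.IH[of "\<lambda>y. ?g' y b"])
        (use Suc.prems(2) n_times_cont_diff_on_Suc_imp[OF Suc.prems(1)] in simp_all)
    show "n_times_cont_diff_on n (\<lambda>x. \<Sum>b\<in>Basis. (?f' x v \<bullet> b) *\<^sub>R ?g' (f x) b) S"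
      by (rule n_times_cont_diff_on_sum[OF assms(1) n_times_cont_diff_on_scaleR[OF assms(1) 1 2]])
  qed
qed

lemma n_times_cont_diff_on_local:
  assumes "\<And>x. x \<in> S \<Longrightarrow> \<exists>W. open W \<and> x \<in> W \<and> n_times_cont_diff_on n f (W \<inter> S)" "open S"
  shows "n_times_cont_diff_on n f S"
  using assms(1)
proof (induction n arbitrary: f)
  case 0
  have "continuous (at x within S) f" if x: "x \<in> S" for x
  proof -
    obtain W where "open W" "x \<in> W" "continuous_on (W \<inter> S) f" using 0[OF x] by auto
    then have "isCont f x"
      using x assms(2) by (auto simp: continuous_on_eq_continuous_at open_Int)
    then show ?thesis by (rule continuous_at_imp_continuous_at_within)
  qed
  then show ?case by (simp add: continuous_on_eq_continuous_within)
next
  case (Suc n)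
  have "f differentiable at x" if "x \<in> S" for x
    using Suc.prems[OF that] that by auto
  moreover have "n_times_cont_diff_on n (\<lambda>x. frechet_derivative f (at x) v) S" for v
    by (rule Suc.IH) (use Suc.prems in fastforce)
  ultimately show ?case by simp
qed

section \<open>Class C^r on arbitrary sets, by local extensions\<close>

text \<open>Near each point of an open set the extension \<open>F\<close> coincides with
  \<open>f\<close>, so class C^n can be checked locally. In the definition one \<open>F\<close> has
  to serve all orders \<open>n \<le> r\<close>; on open sets \<open>f\<close> itself does.\<close>

lemma C_on_open_iff:
  assumes "open S"
  shows "C_on r f S \<longleftrightarrow> (\<forall>n. enat n \<le> r \<longrightarrow> n_times_cont_diff_on n f S)"
proof
  assume L: "C_on r f S"
  show "\<forall>n. enat n \<le> r \<longrightarrow> n_times_cont_diff_on n f S"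
  proof (intro allI impI n_times_cont_diff_on_local[OF _ assms])
    fix n x assume "enat n \<le> r" "x \<in> S"
    then obtain W F where W: "open W" "x \<in> W" "n_times_cont_diff_on n F W" "\<forall>y\<in>W \<inter> S. F y = f y"
      using L unfolding C_on_def by meson
    have "n_times_cont_diff_on n f (W \<inter> S)"
      by (rule n_times_cont_diff_on_cong[OF _ _ n_times_cont_diff_on_subset[OF W(3)]])
        (use W assms in auto)
    then show "\<exists>W. open W \<and> x \<in> W \<and> n_times_cont_diff_on n f (W \<inter> S)"
      using W by blast
  qed
qed (use assms in \<open>auto simp: C_on_def\<close>)

lemma C_on_iff_extension:
  "C_on r f S \<longleftrightarrow> (\<forall>x\<in>S. \<exists>W F. open W \<and> x \<in> W \<and> C_on r F W \<and> (\<forall>y\<in>W \<inter> S. F y = f y))"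
  unfolding C_on_def[of r f S] by (simp add: C_on_open_iff cong: conj_cong)

lemma C_on_extension:
  assumes "C_on r f S" "x \<in> S"
  shows "\<exists>W F. open W \<and> x \<in> W \<and> C_on r F W \<and> (\<forall>y\<in>W \<inter> S. F y = f y)"
  using assms(1) unfolding C_on_iff_extension[of r f S] by (rule bspec) (rule assms(2))

lemma C_onI:
  assumes "\<And>x. x \<in> S \<Longrightarrow> \<exists>W F. open W \<and> x \<in> W \<and> C_on r F W \<and> (\<forall>y\<in>W \<inter> S. F y = f y)"
  shows "C_on r f S"
  unfolding C_on_iff_extension[of r f S] using assms by (rule ballI)

lemma C_on_cong_subset:
  assumes "C_on r f S" "S' \<subseteq> S" "\<And>x. x \<in> S' \<Longrightarrow> f x = g x"
  shows "C_on r g S'"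
proof (rule C_onI)
  fix x assume x: "x \<in> S'"
  with assms(2) have "x \<in> S" by blast
  then obtain W F where "open W" "x \<in> W" "C_on r F W" "\<forall>y\<in>W \<inter> S. F y = f y"
    using C_on_extension[OF assms(1)] by blast
  then show "\<exists>W F. open W \<and> x \<in> W \<and> C_on r F W \<and> (\<forall>y\<in>W \<inter> S'. F y = g y)"
    using assms(2,3) by (intro exI[of _ W] exI[of _ F]) auto
qed

lemma C_on_subset: "C_on r f S \<Longrightarrow> S' \<subseteq> S \<Longrightarrow> C_on r f S'"
  by (rule C_on_cong_subset) auto

lemma C_on_imp_continuous_on:
  assumes "C_on r f S" shows "continuous_on S f"
  unfolding continuous_on_eq_continuous_within
proof
  fix x assume x: "x \<in> S"
  obtain W F where W: "open W" "x \<in> W" "C_on r F W" "\<forall>y\<in>W \<inter> S. F y = f y"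
    using C_on_extension[OF assms x] by blast
  have "n_times_cont_diff_on 0 F W"
    using W(3) by (simp add: C_on_open_iff[OF W(1)] zero_enat_def[symmetric] del: n_times_cont_diff_on.simps)
  then have "continuous_on W F" by simp
  then have "continuous_on (S \<inter> W) f"
    using W(4) by (intro continuous_on_eq[of "S \<inter> W" F f]) (auto intro: continuous_on_subset)
  then have "continuous (at x within (S \<inter> W)) f"
    using x W by (simp add: continuous_on_eq_continuous_within)
  moreover have "at x within S = at x within (S \<inter> W)"
    by (rule at_within_nhd[OF W(2) W(1)]) auto
  ultimately show "continuous (at x within S) f" by simp
qed

lemma C_on_compose:
  fixes f :: "'a::euclidean_space \<Rightarrow> 'b::euclidean_space" and g :: "'b \<Rightarrow> 'c::euclidean_space"
  assumes "C_on r f S" "C_on r g S'" "f ` S \<subseteq> S'"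
  shows "C_on r (\<lambda>x. g (f x)) S"
  unfolding C_on_iff_extension[of r _ S]
proof
  fix x assume x: "x \<in> S"
  obtain W F where W: "open W" "x \<in> W" "C_on r F W" "\<forall>y\<in>W \<inter> S. F y = f y"
    using C_on_extension[OF assms(1) x] by blast
  have fx: "f x \<in> S'" using x assms(3) by blast
  obtain W' G where W': "open W'" "f x \<in> W'" "C_on r G W'" "\<forall>y\<in>W' \<inter> S'. G y = g y"
    using C_on_extension[OF assms(2) fx] by (elim exE conjE) (rule that)
  have o: "open (W \<inter> F -` W')"
    by (rule continuous_open_preimage[OF C_on_imp_continuous_on[OF W(3)] W(1) W'(1)])
  have "C_on r (\<lambda>x. G (F x)) (W \<inter> F -` W')"
    unfolding C_on_open_iff[OF o]
  proof (intro allI impI, rule n_times_cont_diff_on_compose[OF o W'(1), where f = F and g = G])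
    fix n assume n: "enat n \<le> r"
    show "n_times_cont_diff_on n F (W \<inter> F -` W')"
      by (rule n_times_cont_diff_on_subset[of n F W]) (use W(3) n in \<open>simp_all add: C_on_open_iff[OF W(1)]\<close>)
    show "n_times_cont_diff_on n G W'"
      using W'(3) n by (simp add: C_on_open_iff[OF W'(1)])
  qed auto
  moreover have "x \<in> W \<inter> F -` W'"
    using W W' x by auto
  moreover have "G (F y) = g (f y)" if "y \<in> (W \<inter> F -` W') \<inter> S" for y
    using that W(4) W'(4) assms(3) by auto
  ultimately show "\<exists>W F. open W \<and> x \<in> W \<and> C_on r F W \<and> (\<forall>y\<in>W \<inter> S. F y = g (f y))"
    using o by blast
qed

lemma C_on_bounded_linear: "bounded_linear f \<Longrightarrow> C_on r f S"
  by (rule C_on_subset[of r f UNIV])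
    (auto simp: C_on_open_iff intro: n_times_cont_diff_on_linear)

lemma C_on_id: "C_on r (\<lambda>x. x) S"
  by (simp add: C_on_bounded_linear bounded_linear_ident)

lemma C_on_const: "C_on r (\<lambda>x. c) S"
  by (rule C_on_subset[of r _ UNIV]) (auto simp: C_on_open_iff n_times_cont_diff_on_const)

lemma C_on_add:
  assumes "C_on r f S" "C_on r g S"
  shows "C_on r (\<lambda>x. f x + g x) S"
  unfolding C_on_iff_extension[of r _ S]
proof
  fix x assume x: "x \<in> S"
  obtain W F where W: "open W" "x \<in> W" "C_on r F W" "\<forall>y\<in>W \<inter> S. F y = f y"
    using C_on_extension[OF assms(1) x] by blast
  obtain W' G where W': "open W'" "x \<in> W'" "C_on r G W'" "\<forall>y\<in>W' \<inter> S. G y = g y"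
    using C_on_extension[OF assms(2) x] by blast
  have o: "open (W \<inter> W')" using W(1) W'(1) by (rule open_Int)
  have "C_on r F (W \<inter> W')" "C_on r G (W \<inter> W')"
    using W(3) W'(3) by (auto elim: C_on_subset)
  then have "C_on r (\<lambda>x. F x + G x) (W \<inter> W')"
    unfolding C_on_open_iff[OF o] by (simp add: n_times_cont_diff_on_add[OF o])
  then show "\<exists>W F. open W \<and> x \<in> W \<and> C_on r F W \<and> (\<forall>y\<in>W \<inter> S. F y = f y + g y)"
    using W W' by (intro exI[of _ "W \<inter> W'"] exI[of _ "\<lambda>x. F x + G x"]) auto
qed

lemma C_on_sum:
  "(\<And>i. i \<in> I \<Longrightarrow> C_on r (f i) S) \<Longrightarrow> C_on r (\<lambda>x. \<Sum>i\<in>I. f i x) S"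
  by (induction I rule: infinite_finite_induct) (auto intro: C_on_add C_on_const)

lemma vec_expansion: "(\<Sum>i\<in>UNIV. (x $ i) *\<^sub>R axis i 1) = (x :: real ^ 'k)"
  by (simp add: basis_expansion flip: scalar_mult_eq_scaleR)

text \<open>Each coordinate comes with its own neighbourhood and extension; writing \<open>f\<close>
  as a finite sum lets \<open>C_on_sum\<close> intersect them.\<close>

lemma C_on_vec:
  fixes f :: "'a::euclidean_space \<Rightarrow> real ^ 'k"
  assumes "\<And>i. C_on r (\<lambda>x. f x $ i) S"
  shows "C_on r f S"
proof -
  have "C_on r (\<lambda>x. \<Sum>i\<in>UNIV. (f x $ i) *\<^sub>R (axis i 1 :: real ^ 'k)) S"
    by (intro C_on_sum C_on_compose[OF assms C_on_bounded_linear[OF bounded_linear_scaleR_left] subset_UNIV])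
  then show ?thesis
    by (simp add: vec_expansion)
qed

lemma C_on_has_derivative:
  assumes "C_on r f W" "open W" "1 \<le> r" "x \<in> W"
  shows "(f has_derivative frechet_derivative f (at x)) (at x)"
  using assms
  by (intro n_times_cont_diff_on_Suc_has_derivative[of 0 f W])
    (simp_all add: C_on_open_iff one_enat_def del: n_times_cont_diff_on.simps)

lemma C_on_continuous_derivative:
  assumes "C_on r f W" "open W" "1 \<le> r"
  shows "continuous_on W (\<lambda>x. frechet_derivative f (at x) v)"
proof -
  have "n_times_cont_diff_on (Suc 0) f W"
    using assms by (simp add: C_on_open_iff one_enat_def del: n_times_cont_diff_on.simps)
  then show ?thesis by simp
qed

text \<open>On a compact ball the derivative of the extension \<open>F\<close> is bounded in every
  basis direction, and the sum of these bounds dominates its operator norm. The mean value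
  inequality is applied to \<open>F\<close> on the ball, which is convex although \<open>S\<close>
  need not be.\<close>

lemma C_on_imp_locally_Lipschitz:
  fixes f :: "'a::euclidean_space \<Rightarrow> 'b::euclidean_space"
  assumes "C_on r f S" "1 \<le> r" "x \<in> S"
  shows "\<exists>W L. open W \<and> x \<in> W \<and> L \<ge> 0 \<and>
    (\<forall>y\<in>W \<inter> S. \<forall>z\<in>W \<inter> S. norm (f y - f z) \<le> L * norm (y - z))"
proof -
  obtain W F where W: "open W" "x \<in> W" "C_on r F W" "\<forall>y\<in>W \<inter> S. F y = f y"
    using C_on_extension[OF assms(1,3)] by blast
  obtain e where e: "e > 0" "cball x e \<subseteq> W"
    using W(1,2) open_contains_cball by blast
  let ?F' = "\<lambda>y. frechet_derivative F (at y)"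
  have "bounded ((\<lambda>y. ?F' y b) ` cball x e)" for b
    using C_on_continuous_derivative[OF W(3,1) assms(2)] e(2)
    by (intro compact_imp_bounded compact_continuous_image) (auto intro: continuous_on_subset)
  then have "\<exists>B. \<forall>y\<in>cball x e. norm (?F' y b) \<le> B" for b
    unfolding bounded_iff by auto
  then obtain B where B: "\<And>b y. y \<in> cball x e \<Longrightarrow> norm (?F' y b) \<le> B b"
    by metis
  have *: "norm (F y - F z) \<le> (\<Sum>b\<in>Basis. B b) * norm (y - z)"
    if yz: "y \<in> cball x e" "z \<in> cball x e" for y z
  proof (rule differentiable_bound[of "cball x e" F ?F', OF convex_cball _ _ yz])
    fix u assume u: "u \<in> cball x e"
    have d: "(F has_derivative ?F' u) (at u)"
      using C_on_has_derivative[OF W(3,1) assms(2)] u e by blast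
    then show "(F has_derivative ?F' u) (at u within cball x e)"
      by (rule has_derivative_at_withinI)
    show "onorm (?F' u) \<le> (\<Sum>b\<in>Basis. B b)"
    proof (rule onorm_le)
      fix v :: 'a
      have "?F' u v = (\<Sum>b\<in>Basis. (v \<bullet> b) *\<^sub>R ?F' u b)"
        by (rule linear_Basis_expansion[OF has_derivative_linear[OF d]])
      also have "norm \<dots> \<le> (\<Sum>b\<in>Basis. B b * norm v)"
      proof (rule sum_norm_le)
        fix b :: 'a assume b: "b \<in> Basis"
        have "norm ((v \<bullet> b) *\<^sub>R ?F' u b) \<le> norm v * B b"
          unfolding norm_scaleR
          by (intro mult_mono Basis_le_norm[OF b] B[OF u]) auto
        then show "norm ((v \<bullet> b) *\<^sub>R ?F' u b) \<le> B b * norm v" by (simp add: mult.commute)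
      qed
      finally show "norm (?F' u v) \<le> (\<Sum>b\<in>Basis. B b) * norm v"
        by (simp add: sum_distrib_right)
    qed
  qed
  have nn: "0 \<le> (\<Sum>b\<in>Basis. B b)"
    using B[of x] e(1) by (intro sum_nonneg) (meson centre_in_cball less_imp_le norm_ge_zero order_trans)
  show ?thesis
  proof (intro exI conjI ballI)
    show "open (ball x e)" by (rule open_ball)
    show "x \<in> ball x e" using e by simp
    show "0 \<le> (\<Sum>b\<in>Basis. B b)" by (rule nn)
    show "norm (f y - f z) \<le> (\<Sum>b\<in>Basis. B b) * norm (y - z)"
      if "y \<in> ball x e \<inter> S" "z \<in> ball x e \<inter> S" for y z
    proof -
      have yz: "y \<in> cball x e" "z \<in> cball x e" using that by auto
      then have "F y = f y" "F z = f z" using W(4) subsetD[OF e(2)] that by blast+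
      then show ?thesis using *[OF yz] by simp
    qed
  qed
qed

section \<open>Inverse functions of class C^r\<close>

text \<open>By Cramer's rule the entries of the inverse of \<open>f'(g y)\<close> are quotients of
  determinants, hence rational in the entries of \<open>f'(g y)\<close>. These are of class C^n once
  \<open>g\<close> is, so every derivative of \<open>f\<close> lifts the class of \<open>g\<close>
  by one. \<open>?B v y j\<close> is the Jacobian matrix with column \<open>j\<close> replaced by
  \<open>v\<close>.\<close>

lemma n_times_cont_diff_on_inverse_function:
  fixes f :: "real ^ 'k \<Rightarrow> real ^ 'k"
  assumes "open S" "open V" "n_times_cont_diff_on n f S" "continuous_on V g" "g ` V \<subseteq> S"
    and dg: "\<And>y. y \<in> V \<Longrightarrow> (g has_derivative inv (frechet_derivative f (at (g y)))) (at y)"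
    and bij: "\<And>y. y \<in> V \<Longrightarrow> bij (frechet_derivative f (at (g y)))"
  shows "n_times_cont_diff_on n g V"
  using assms(3)
proof (induction n)
  case 0
  then show ?case using assms(4) by simp
next
  case (Suc n)
  note IH = Suc.IH[OF n_times_cont_diff_on_Suc_imp[OF Suc.prems]]
  let ?A = "\<lambda>y. matrix (frechet_derivative f (at (g y)))"
  have lin: "linear (frechet_derivative f (at (g y)))" if "y \<in> V" for y
    using that assms(5) Suc.prems linear_frechet_derivative by auto
  have det: "det (?A y) \<noteq> 0" if "y \<in> V" for y
    using det_nz_iff_inj[OF lin[OF that]] bij[OF that] bij_is_inj by auto
  let ?B = "\<lambda>v y j. (\<chi> a b. if b = j then v $ a else ?A y $ a $ b) :: real ^ 'k ^ 'k"
  let ?C = "\<lambda>v y j. det (?B v y j) * inverse (det (?A y))"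
  have eq: "inv (frechet_derivative f (at (g y))) v = (\<Sum>j\<in>UNIV. ?C v y j *\<^sub>R axis j 1)"
    if y: "y \<in> V" for y v
  proof -
    let ?w = "inv (frechet_derivative f (at (g y))) v"
    have "?A y *v ?w = v"
      using matrix_works[OF linear_matrix_vector_mul_eq[THEN iffD2, OF lin[OF y]]] bij[OF y] by (simp add: bij_is_surj surj_f_inv_f)
    then have "?w = (\<chi> j. det (?B v y j) / det (?A y))"
      using cramer[OF det[OF y]] by blast
    then have "?w $ j = ?C v y j" for j
      by (simp add: divide_inverse)
    moreover have "?w = (\<Sum>j\<in>UNIV. ?w $ j *\<^sub>R axis j 1)"
      by (simp add: vec_expansion)
    ultimately show ?thesis by simp
  qed
  have A: "n_times_cont_diff_on n (\<lambda>y. ?A y $ a $ b) V" for a b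
  proof -
    have "n_times_cont_diff_on n (\<lambda>s. frechet_derivative f (at s) (axis b 1) $ a) S"
      using Suc.prems
      by (intro n_times_cont_diff_on_bounded_linear_compose[OF assms(1) bounded_linear_vec_nth]) simp
    from n_times_cont_diff_on_compose[OF assms(2,1,5) IH this]
    show ?thesis by (simp add: matrix_def)
  qed
  have B: "n_times_cont_diff_on n (\<lambda>y. ?B v y j $ a $ b) V" for v j a b
    by (cases "b = j") (simp_all add: A n_times_cont_diff_on_const assms(2))
  have D: "n_times_cont_diff_on n (\<lambda>y. det (D y)) V"
    if "\<And>a b. n_times_cont_diff_on n (\<lambda>y. D y $ a $ b) V" for D :: "real ^ 'k \<Rightarrow> real ^ 'k ^ 'k"
    unfolding det_def
    by (intro n_times_cont_diff_on_sum n_times_cont_diff_on_mult n_times_cont_diff_on_prod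
        n_times_cont_diff_on_const that assms(2))
  have "n_times_cont_diff_on n (\<lambda>y. \<Sum>j\<in>UNIV. ?C v y j *\<^sub>R axis j 1) V" for v
    by (intro n_times_cont_diff_on_sum n_times_cont_diff_on_scaleR n_times_cont_diff_on_mult
        n_times_cont_diff_on_const n_times_cont_diff_on_inverse assms(2) D A B det)
  then have "n_times_cont_diff_on n (\<lambda>y. inv (frechet_derivative f (at (g y))) v) V" for v
    by (rule n_times_cont_diff_on_cong[OF assms(2), rotated]) (simp add: eq)
  then show ?case
    by (intro n_times_cont_diff_on_SucI[OF assms(2) dg])
qed

text \<open>The inverse function theorem is applied once, in class C^1. Its neighbourhood
  \<open>V\<close> then serves every order \<open>n \<le> r\<close> simultaneously, which matters
  for \<open>r = \<infinity>\<close>.\<close>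

lemma C_on_inverse_function:
  fixes f :: "real ^ 'k \<Rightarrow> real ^ 'k"
  assumes "open S" "x0 \<in> S" "1 \<le> r" "C_on r f S" "inj (frechet_derivative f (at x0))"
  obtains S' V g where "open S'" "S' \<subseteq> S" "x0 \<in> S'" "open V" "f x0 \<in> V"
    "homeomorphism S' V f g" "C_on r g V"
proof -
  let ?f' = "\<lambda>x. Blinfun (frechet_derivative f (at x))"
  have der: "(f has_derivative frechet_derivative f (at x)) (at x)" if "x \<in> S" for x
    using C_on_has_derivative assms that by blast
  have f': "blinfun_apply (?f' x) = frechet_derivative f (at x)" if "x \<in> S" for x
    using der[OF that] by (simp add: bounded_linear_Blinfun_apply has_derivative_bounded_linear)
  have cont: "continuous_on S ?f'"
  proof (rule continuous_on_blinfun_componentwise)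
    fix i show "continuous_on S (\<lambda>x. blinfun_apply (?f' x) i)"
      using C_on_continuous_derivative[OF assms(4,1,3), of i]
      by (simp add: f' cong: continuous_on_cong)
  qed
  obtain B where B: "linear B" "B \<circ> frechet_derivative f (at x0) = id"
    using linear_injective_left_inverse[OF has_derivative_linear[OF der[OF assms(2)]] assms(5)] by blast
  have "Blinfun B o\<^sub>L ?f' x0 = id_blinfun"
    using B by (intro blinfun_eqI)
      (simp add: f' assms(2) bounded_linear_Blinfun_apply linear_conv_bounded_linear pointfree_idE)
  from inverse_function_theorem[OF assms(1) _ cont assms(2) this] der f'
  obtain S' V g g' where *: "open S'" "S' \<subseteq> S" "x0 \<in> S'" "open V" "f x0 \<in> V" "homeomorphism S' V f g"
    "\<And>y. y \<in> V \<Longrightarrow> (g has_derivative g' y) (at y)"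
    "\<And>y. y \<in> V \<Longrightarrow> g' y = inv (blinfun_apply (?f' (g y)))"
    "\<And>y. y \<in> V \<Longrightarrow> bij (blinfun_apply (?f' (g y)))"
    by (metis (no_types, lifting))
  have gS: "g ` V \<subseteq> S'" and gc: "continuous_on V g"
    using *(6) by (auto simp: homeomorphism_def)
  have gy: "blinfun_apply (?f' (g y)) = frechet_derivative f (at (g y))" if "y \<in> V" for y
    using that gS *(2) by (intro f') auto
  have "n_times_cont_diff_on n g V" if "enat n \<le> r" for n
  proof (rule n_times_cont_diff_on_inverse_function[OF assms(1) *(4) _ gc])
    show "n_times_cont_diff_on n f S" using assms(4) that by (simp add: C_on_open_iff[OF assms(1)])
    show "g ` V \<subseteq> S" using gS *(2) by (rule subset_trans)
    show "(g has_derivative inv (frechet_derivative f (at (g y)))) (at y)" if "y \<in> V" for y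
      using *(7)[OF that] unfolding *(8)[OF that] gy[OF that] .
    show "bij (frechet_derivative f (at (g y)))" if "y \<in> V" for y
      using *(9)[OF that] unfolding gy[OF that] .
  qed
  then have "C_on r g V" unfolding C_on_open_iff[OF *(4)] by blast
  then show thesis by (rule that[OF *(1-6)])
qed

subsection \<open>Polynomials of bounded degree\<close>

definition monomial_fun :: "('n \<Rightarrow> nat) \<Rightarrow> real ^ 'n \<Rightarrow> real" where
  "monomial_fun a x = (\<Prod>i\<in>UNIV. (x $ i) ^ a i)"

lemma polys_degree_le_eq:
  "polys_degree_le D = {p :: real ^ 'n \<Rightarrow> real.
     \<exists>c. p = (\<lambda>x. \<Sum>a | (\<Sum>i\<in>UNIV. a i) \<le> D. c a * monomial_fun a x)}"
  by (simp add: polys_degree_le_def monomial_fun_def)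

lemma monomial_fun_mem:
  assumes "(\<Sum>i\<in>UNIV. a i) \<le> D"
  shows "monomial_fun a \<in> polys_degree_le D"
proof -
  have "monomial_fun a = (\<lambda>x. \<Sum>b | (\<Sum>i\<in>UNIV. b i) \<le> D. (if b = a then 1 else 0) * monomial_fun b x)"
    
  proof
    fix x
    have "(\<Sum>b | (\<Sum>i\<in>UNIV. b i) \<le> D. (if b = a then 1 else 0) * monomial_fun b x)
      = (\<Sum>b | (\<Sum>i\<in>UNIV. b i) \<le> D. if b = a then monomial_fun b x else 0)"
      by (intro sum.cong) auto
    then show "monomial_fun a x
      = (\<Sum>b | (\<Sum>i\<in>UNIV. b i) \<le> D. (if b = a then 1 else 0) * monomial_fun b x)"
      using assms sum.delta[OF finite_exponents_degree_le[of D], of a "\<lambda>b. monomial_fun b x"] by simp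
  qed
  then show ?thesis unfolding polys_degree_le_eq by (intro CollectI exI)
qed

lemma polys_degree_le_add:
  assumes "p \<in> polys_degree_le D" "q \<in> polys_degree_le D"
  shows "(\<lambda>x. p x + q x) \<in> polys_degree_le D"
proof -
  obtain c e where "p = (\<lambda>x. \<Sum>a | (\<Sum>i\<in>UNIV. a i) \<le> D. c a * monomial_fun a x)"
    "q = (\<lambda>x. \<Sum>a | (\<Sum>i\<in>UNIV. a i) \<le> D. e a * monomial_fun a x)"
    using assms unfolding polys_degree_le_eq by blast
  then have "(\<lambda>x. p x + q x) = (\<lambda>x. \<Sum>a | (\<Sum>i\<in>UNIV. a i) \<le> D. (c a + e a) * monomial_fun a x)"
    by (simp add: sum.distrib distrib_right)
  then show ?thesis unfolding polys_degree_le_eq by (intro CollectI exI)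
qed

lemma polys_degree_le_scale:
  assumes "p \<in> polys_degree_le D"
  shows "(\<lambda>x. s * p x) \<in> polys_degree_le D"
proof -
  obtain c where "p = (\<lambda>x. \<Sum>a | (\<Sum>i\<in>UNIV. a i) \<le> D. c a * monomial_fun a x)"
    using assms unfolding polys_degree_le_eq by blast
  then have "(\<lambda>x. s * p x) = (\<lambda>x. \<Sum>a | (\<Sum>i\<in>UNIV. a i) \<le> D. (s * c a) * monomial_fun a x)"
    by (simp add: sum_distrib_left mult.assoc)
  then show ?thesis unfolding polys_degree_le_eq by (intro CollectI exI)
qed

lemma polys_degree_le_const: "(\<lambda>x :: real ^ 'n. c) \<in> polys_degree_le D"
proof -
  have "monomial_fun (\<lambda>i. 0) = (\<lambda>x :: real ^ 'n. 1)" by (simp add: monomial_fun_def fun_eq_iff)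
  then have "(\<lambda>x :: real ^ 'n. 1) \<in> polys_degree_le D"
    using monomial_fun_mem[of "\<lambda>i :: 'n. 0" D] by simp
  from polys_degree_le_scale[OF this, of c] show ?thesis by simp
qed

lemma polys_degree_le_sum:
  "(\<And>i. i \<in> I \<Longrightarrow> f i \<in> polys_degree_le D) \<Longrightarrow> (\<lambda>x. \<Sum>i\<in>I. f i x) \<in> polys_degree_le D"
  by (induction I rule: infinite_finite_induct)
    (simp_all add: polys_degree_le_const polys_degree_le_add)

lemma polys_degree_le_mult:
  assumes "p \<in> polys_degree_le D" "q \<in> polys_degree_le E"
  shows "(\<lambda>x. p x * q x) \<in> polys_degree_le (D + E)"
proof -
  obtain c e where pq: "p = (\<lambda>x. \<Sum>a | (\<Sum>i\<in>UNIV. a i) \<le> D. c a * monomial_fun a x)"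
    "q = (\<lambda>x. \<Sum>a | (\<Sum>i\<in>UNIV. a i) \<le> E. e a * monomial_fun a x)"
    using assms unfolding polys_degree_le_eq by blast
  have mm: "monomial_fun a x * monomial_fun b x = monomial_fun (\<lambda>i. a i + b i) x"
    for a b :: "'a \<Rightarrow> nat" and x
    by (simp add: monomial_fun_def power_add prod.distrib)
  have "(\<lambda>x. p x * q x) = (\<lambda>x. \<Sum>a | (\<Sum>i\<in>UNIV. a i) \<le> D. \<Sum>b | (\<Sum>i\<in>UNIV. b i) \<le> E.
      (c a * e b) * monomial_fun (\<lambda>i. a i + b i) x)"
    unfolding pq sum_product by (simp add: mm[symmetric] mult.assoc mult.left_commute)
  also have "\<dots> \<in> polys_degree_le (D + E)"
    by (intro polys_degree_le_sum polys_degree_le_scale)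
      (rule monomial_fun_mem, auto simp: sum.distrib intro: add_mono)
  finally show ?thesis .
qed

lemma polys_degree_le_mono:
  assumes "D \<le> E" "p \<in> polys_degree_le D" shows "p \<in> polys_degree_le E"
  \<comment> \<open>The constant \<open>1\<close> counts as a polynomial of degree at most
    \<open>E - D\<close>; multiply by it.\<close>
  using polys_degree_le_mult[OF assms(2) polys_degree_le_const[of 1 "E - D"]] assms(1) by simp

lemma polys_degree_le_prod:
  "(\<And>i. i \<in> I \<Longrightarrow> f i \<in> polys_degree_le E) \<Longrightarrow> (\<lambda>x. \<Prod>i\<in>I. f i x) \<in> polys_degree_le (E * card I)"
proof (induction I rule: infinite_finite_induct)
  case (insert i I)
  then have "(\<lambda>x. f i x * (\<Prod>i\<in>I. f i x)) \<in> polys_degree_le (E + E * card I)"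
    by (intro polys_degree_le_mult) auto
  then show ?case using insert by simp
qed (simp_all add: polys_degree_le_const)

lemma polys_degree_le_coord: "(\<lambda>x :: real ^ 'n. x $ i) \<in> polys_degree_le 1"
proof -
  have "(\<lambda>x :: real ^ 'n. x $ i) = monomial_fun (\<lambda>j. if j = i then 1 else 0)"
    by (rule ext) (simp add: monomial_fun_def if_distrib[of "\<lambda>n. _ ^ n"] prod.delta cong: if_cong)
  then show ?thesis using monomial_fun_mem[of "\<lambda>j. if j = i then 1 else 0" 1] by simp
qed

lemma polys_degree_le_affine: "(\<lambda>x. u \<bullet> (x - q)) \<in> polys_degree_le 1"
proof -
  have "(\<lambda>x. (\<Sum>i\<in>UNIV. u $ i * x $ i) + (- (u \<bullet> q))) \<in> polys_degree_le 1"
    by (intro polys_degree_le_add polys_degree_le_const polys_degree_le_sum polys_degree_le_scale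
        polys_degree_le_coord)
  then show ?thesis by (simp add: inner_vec_def right_diff_distrib sum_subtractf)
qed

lemma polys_degree_le_norm_power2: "(\<lambda>x. (norm (x - q))\<^sup>2) \<in> polys_degree_le 2"
proof -
  have "(\<lambda>x. x $ i - q $ i) \<in> polys_degree_le 1" for i
    using polys_degree_le_add[OF polys_degree_le_coord polys_degree_le_const, of i "- q $ i"] by simp
  then have "(\<lambda>x. \<Sum>i\<in>UNIV. (x $ i - q $ i) * (x $ i - q $ i)) \<in> polys_degree_le (1 + 1)"
    by (intro polys_degree_le_sum polys_degree_le_mult)
  then show ?thesis by (simp add: power2_norm_eq_inner inner_vec_def flip: numeral_2_eq_2)
qed

lemma polys_degree_le_C_on:
  assumes "p \<in> polys_degree_le D"
  shows "C_on r p S"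
proof -
  obtain c where p: "p = (\<lambda>x. \<Sum>a | (\<Sum>i\<in>UNIV. a i) \<le> D. c a * (\<Prod>i\<in>UNIV. (x $ i) ^ a i))"
    using assms unfolding polys_degree_le_def by blast
  have "n_times_cont_diff_on n (\<lambda>x :: real ^ 'a. \<Prod>j<m. x $ i) UNIV" for n i and m :: nat
    by (intro n_times_cont_diff_on_prod open_UNIV n_times_cont_diff_on_linear bounded_linear_vec_nth)
  then have "n_times_cont_diff_on n (\<lambda>x :: real ^ 'a. (x $ i) ^ m) UNIV" for n i and m :: nat
    by (simp only: prod_constant card_lessThan)
  then have "n_times_cont_diff_on n p UNIV" for n
    unfolding p by (intro n_times_cont_diff_on_sum n_times_cont_diff_on_mult
        n_times_cont_diff_on_prod open_UNIV n_times_cont_diff_on_const)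
  then have "C_on r p UNIV" unfolding C_on_open_iff[OF open_UNIV] by blast
  then show ?thesis by (rule C_on_subset) simp
qed

text \<open>Lagrange interpolation in several variables: the node \<open>q\<close> is killed by one
  affine factor, the component of \<open>x - q\<close> along \<open>q0 - q\<close>, which does not
  vanish at \<open>q0\<close>.\<close>

lemma polys_degree_le_separate:
  fixes q0 :: "real ^ 'n"
  assumes "finite Q" "card Q \<le> D" "q0 \<notin> Q"
  obtains p where "p \<in> polys_degree_le D" "p q0 = 1" "\<And>q. q \<in> Q \<Longrightarrow> p q = 0"
proof
  let ?p = "\<lambda>x. \<Prod>q\<in>Q. (1 / ((q0 - q) \<bullet> (q0 - q))) * ((q0 - q) \<bullet> (x - q))"
  have "?p \<in> polys_degree_le (1 * card Q)"
    by (intro polys_degree_le_prod polys_degree_le_scale polys_degree_le_affine)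
  then show "?p \<in> polys_degree_le D" using assms(2) by (intro polys_degree_le_mono[of "card Q" D]) auto
  show "?p q0 = 1" using assms(3) by (intro prod.neutral) auto
  show "?p q = 0" if "q \<in> Q" for q
    using that assms(1) by (intro prod_zero bexI[of _ q]) auto
qed

text \<open>At the nodes other than \<open>x l\<close> the polynomial has to be critical in all
  directions, so each gets the squared distance, which vanishes to second order. At
  \<open>x l\<close> the affine factor \<open>?A\<close> vanishes and the product is normalised to
  \<open>1\<close>, so only the derivative of \<open>?A\<close> survives.\<close>

lemma polys_degree_le_hermite:
  fixes x :: "'k::finite \<Rightarrow> real ^ 'n"
  assumes "inj x" "v \<noteq> 0"
  obtains p where "p \<in> polys_degree_le (2 * CARD('k) - 1)"
    "\<And>i. (p has_derivative (\<lambda>u. if i = l then (v \<bullet> u) / (v \<bullet> v) else 0)) (at (x i))"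
proof
  let ?f = "\<lambda>i z. (1 / (norm (x l - x i))\<^sup>2) * (norm (z - x i))\<^sup>2"
  let ?A = "\<lambda>z. (1 / (v \<bullet> v)) * (v \<bullet> (z - x l))"
  let ?p = "\<lambda>z. ?A z * (\<Prod>i\<in>UNIV - {l}. ?f i z)"
  have "?p \<in> polys_degree_le (1 + 2 * card (UNIV - {l}))"
    by (intro polys_degree_le_mult polys_degree_le_prod polys_degree_le_scale polys_degree_le_affine
        polys_degree_le_norm_power2)
  moreover have "1 + 2 * card (UNIV - {l}) = 2 * CARD('k) - 1"
    using zero_less_card_finite[where 'a = 'k] by (simp add: card_Diff_singleton del: zero_less_card_finite)
  ultimately show "?p \<in> polys_degree_le (2 * CARD('k) - 1)" by simp
  show "(?p has_derivative (\<lambda>u. if i = l then (v \<bullet> u) / (v \<bullet> v) else 0)) (at (x i))" for i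
  proof -
    have dsq: "((\<lambda>z. s * (norm (z - q))\<^sup>2) has_derivative (\<lambda>u. s * (2 * ((z - q) \<bullet> u)))) (at z)"
      for s and q z :: "real ^ 'n"
      unfolding power2_norm_eq_inner by (auto intro!: derivative_eq_intros simp: inner_commute)
    have df: "(?f j has_derivative (\<lambda>u. (1 / (norm (x l - x j))\<^sup>2) * (2 * ((z - x j) \<bullet> u)))) (at z)" for j z
      using dsq by blast
    have dprod: "\<exists>g'. ((\<lambda>z. \<Prod>j\<in>J. ?f j z) has_derivative g') (at z)" for J z
      by (rule exI) (rule has_derivative_prod[OF df])
    have dA: "(?A has_derivative (\<lambda>u. (v \<bullet> u) / (v \<bullet> v))) (at z)" for z
    proof -
      have "((\<lambda>z. s * (v \<bullet> (z - x l))) has_derivative (\<lambda>u. s * (v \<bullet> u))) (at z)" for s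
        by (auto intro!: derivative_eq_intros)
      from this[of "1 / (v \<bullet> v)"] show ?thesis by simp
    qed
    show ?thesis
    proof (cases "i = l")
      case True
      obtain g' where g': "((\<lambda>z. \<Prod>j\<in>UNIV - {l}. ?f j z) has_derivative g') (at (x l))"
        using dprod by blast
      have "(\<Prod>j\<in>UNIV - {l}. ?f j (x l)) = 1"
        using assms(1) by (intro prod.neutral) (auto simp: inj_def)
      then show ?thesis
        using has_derivative_mult[OF dA[of "x l"] g'] True by simp
    next
      case False
      let ?B = "\<lambda>z. ?A z * (\<Prod>j\<in>UNIV - {l} - {i}. ?f j z)"
      obtain g' where g': "((\<lambda>z. \<Prod>j\<in>UNIV - {l} - {i}. ?f j z) has_derivative g') (at (x i))"
        using dprod by blast
      obtain B' where B': "(?B has_derivative B') (at (x i))"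
        using has_derivative_mult[OF dA[of "x i"] g'] by blast
      \<comment> \<open>Isolate the factor of the node \<open>i\<close>: its value and its
        derivative are both zero at \<open>x i\<close>, so the product rule gives derivative
        zero.\<close>
      have eq: "?p = (\<lambda>z. ?f i z * ?B z)"
      proof
        fix z
        have "(\<Prod>j\<in>UNIV - {l}. ?f j z) = ?f i z * (\<Prod>j\<in>UNIV - {l} - {i}. ?f j z)"
          by (rule prod.remove) (use False in auto)
        then show "?p z = ?f i z * ?B z" by (simp only: mult_ac)
      qed
      have fi: "(?f i has_derivative (\<lambda>u. 0)) (at (x i))"
        using df[of i "x i"] by simp
      show ?thesis
        unfolding eq using has_derivative_mult[OF fi B'] False by simp
    qed
  qed
qed

subsection \<open>Null sets of parameters\<close>

text \<open>Tonelli after translating along \<open>P t\<close>: no coordinates adapted to the range of \<open>P\<close> are needed.\<close>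

lemma negligible_if_negligible_slices:
  fixes N :: "'a::euclidean_space set" and P :: "'b::euclidean_space \<Rightarrow> 'a"
  assumes "closed N" "continuous_on UNIV P" "\<And>b. negligible {t. b + P t \<in> N}"
  shows "negligible N"
proof -
  have [measurable]: "P \<in> borel_measurable borel" "N \<in> sets borel"
    using assms by (auto intro: borel_measurable_continuous_onI)
  have "AE b in (lborel :: 'a measure). AE t in (lborel :: 'b measure). b + P t \<notin> N"
  proof (rule AE_I2)
    fix b
    have "{t. b + P t \<in> N} \<in> null_sets lebesgue"
      using assms(3) by (simp add: negligible_iff_null_sets)
    moreover have "{t. b + P t \<in> N} \<in> sets lborel" by measurable
    ultimately have "{t. b + P t \<in> N} \<in> null_sets lborel"
      by (metis null_sets_completion_iff)
    then show "AE t in lborel. b + P t \<notin> N"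
      by (auto intro: AE_I')
  qed
  then have "AE t in (lborel :: 'b measure). AE b in (lborel :: 'a measure). b + P t \<notin> N"
  proof (subst (asm) lborel_pair.AE_commute)
    have "Measurable.pred ((lborel :: 'a measure) \<Otimes>\<^sub>M (lborel :: 'b measure)) (\<lambda>x. fst x + P (snd x) \<notin> N)"
      by measurable
    then show "{x \<in> space ((lborel :: 'a measure) \<Otimes>\<^sub>M (lborel :: 'b measure)). fst x + P (snd x) \<notin> N}
        \<in> sets (lborel \<Otimes>\<^sub>M lborel)"
      by (simp add: pred_def)
  qed
  \<comment> \<open>A single good \<open>t\<close> is enough: it says that the translate of
    \<open>N\<close> by \<open>- P t\<close> is null.\<close>
  then have "\<exists>t. AE b in (lborel :: 'a measure). b + P t \<notin> N"
    by (rule eventually_happens'[rotated]) (simp add: ae_filter_eq_bot_iff)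
  then obtain t where "AE b in (lborel :: 'a measure). b + P t \<notin> N" by blast
  then have "AE b in (lebesgue :: 'a measure). b \<notin> (\<lambda>x. x - P t) ` N"
    by (intro AE_completion) (auto simp: image_iff algebra_simps)
  then have "(\<lambda>x. x - P t) ` N \<in> null_sets lebesgue"
    by (subst (asm) AE_iff_null_sets[symmetric]) (use assms(1) in \<open>auto simp: closed_translation_subtract\<close>)
  then have "negligible ((\<lambda>x. P t + x) ` (\<lambda>x. x - P t) ` N)"
    by (intro negligible_translation) (simp add: negligible_iff_null_sets)
  then show ?thesis by (simp add: image_image)
qed

text \<open>The only smallness of \<open>Y\<close> that is needed: it holds both if \<open>Y\<close> has Hausdorff measure zero in
  dimension \<open>k\<close> and if \<open>Y\<close> is a submanifold of dimension less than \<open>k\<close>.\<close>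

definition lipschitz_negligible :: "'k::finite itself \<Rightarrow> 'a::real_normed_vector set \<Rightarrow> bool" where
  "lipschitz_negligible _ Y \<longleftrightarrow> (\<forall>A f L. A \<subseteq> Y \<and>
     (\<forall>y\<in>A. \<forall>z\<in>A. norm (f y - f z) \<le> L * norm (y - z)) \<longrightarrow> negligible (f ` A :: (real ^ 'k) set))"

lemma lipschitz_negligibleD:
  fixes f :: "'a::real_normed_vector \<Rightarrow> real ^ 'k"
  assumes "lipschitz_negligible TYPE('k) Y" "A \<subseteq> Y"
    "\<And>y z. y \<in> A \<Longrightarrow> z \<in> A \<Longrightarrow> norm (f y - f z) \<le> L * norm (y - z)"
  shows "negligible (f ` A)"
  using assms unfolding lipschitz_negligible_def by blast

lemma lipschitz_negligible_subset:
  "lipschitz_negligible TYPE('k::finite) Y \<Longrightarrow> Z \<subseteq> Y \<Longrightarrow> lipschitz_negligible TYPE('k) Z"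
  unfolding lipschitz_negligible_def by (meson order_trans)

text \<open>On a slice, pick for each bad \<open>t\<close> a zero \<open>Y t\<close>. The expansion
  \<open>low\<close> in \<open>t\<close> against the Lipschitz bound \<open>lip\<close> in
  \<open>y\<close> makes \<open>t\<close> a Lipschitz function of \<open>Y t\<close>, so the slice
  is a Lipschitz image of a subset of \<open>K\<close> in \<open>\<real>^k\<close>, hence null. The
  radius \<open>R\<close> gives a uniform \<open>lip\<close> and makes the bad set a projection of a
  compact set, hence closed.\<close>

lemma negligible_zero_parameters_compact:
  fixes G :: "'a::real_normed_vector \<Rightarrow> real ^ 'm \<Rightarrow> real ^ 'k" and P :: "real ^ 'k \<Rightarrow> real ^ 'm"
  assumes "compact K" "continuous_on (K \<times> cball 0 R) (\<lambda>(y, a). G y a)" "continuous_on UNIV P"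
    and lip: "\<And>y z a. y \<in> K \<Longrightarrow> z \<in> K \<Longrightarrow> norm a \<le> R \<Longrightarrow> norm (G y a - G z a) \<le> L * norm (y - z)"
    and low: "\<And>y a s t. y \<in> K \<Longrightarrow> c * norm (s - t) \<le> norm (G y (a + P s) - G y (a + P t))" and "c > 0"
    and LN: "lipschitz_negligible TYPE('k) K"
  shows "negligible {a. norm a \<le> R \<and> (\<exists>y\<in>K. G y a = 0)}"
    (is "negligible ?N")
proof (rule negligible_if_negligible_slices[OF _ assms(3)])
  have eq: "?N = snd ` {p \<in> K \<times> cball 0 R. (\<lambda>(y, a). G y a) p = 0}"
    by (force simp: image_iff)
  have "compact {p \<in> K \<times> cball 0 R. (\<lambda>(y, a). G y a) p = 0}"
    by (rule closedin_compact[OF compact_Times[OF assms(1) compact_cball]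
          continuous_closedin_preimage_constant[OF assms(2)]])
  then have "compact ?N"
    unfolding eq by (rule compact_continuous_image[OF continuous_on_snd[OF continuous_on_id]])
  then show "closed ?N" by (rule compact_imp_closed)
next
  fix b
  define T where "T = {t. b + P t \<in> ?N}"
  define Y where "Y t = (SOME y. y \<in> K \<and> G y (b + P t) = 0)" for t
  have Y: "Y t \<in> K" "G (Y t) (b + P t) = 0" "norm (b + P t) \<le> R" if "t \<in> T" for t
  proof -
    have "Y t \<in> K \<and> G (Y t) (b + P t) = 0"
      using that someI_ex[of "\<lambda>y. y \<in> K \<and> G y (b + P t) = 0"] unfolding T_def Y_def by blast
    then show "Y t \<in> K" "G (Y t) (b + P t) = 0" "norm (b + P t) \<le> R"
      using that by (auto simp: T_def)
  qed
  have le: "norm (s - t) \<le> (L / c) * norm (Y s - Y t)" if "s \<in> T" "t \<in> T" for s t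
  proof -
    have "c * norm (s - t) \<le> norm (G (Y s) (b + P s) - G (Y s) (b + P t))"
      by (rule low) (use Y that in auto)
    \<comment> \<open>\<open>G (Y s) (b + P s)\<close> and \<open>G (Y t) (b + P t)\<close> are both
      zero, so one replaces the other; now only \<open>y\<close> varies.\<close>
    also have "\<dots> = norm (G (Y s) (b + P t) - G (Y t) (b + P t))"
      using Y that by simp
    also have "\<dots> \<le> L * norm (Y s - Y t)"
      by (rule lip) (use Y that in auto)
    finally show ?thesis using \<open>c > 0\<close> by (simp add: field_simps)
  qed
  have inj: "inj_on Y T"
    using le by (fastforce intro: inj_onI)
  have "negligible (the_inv_into T Y ` Y ` T)"
    by (rule lipschitz_negligibleD[OF LN, of _ _ "L / c"])
      (use Y le in \<open>auto simp: the_inv_into_f_f[OF inj]\<close>)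
  then show "negligible {t. b + P t \<in> ?N}"
    unfolding T_def[symmetric] by (simp add: image_image the_inv_into_f_f[OF inj])
qed

text \<open>By Lindelof, countably many of the neighbourhoods already cover
  \<open>Y\<close>.\<close>

lemma negligible_locally_countable:
  fixes Y :: "'a::euclidean_space set" and Q :: "'a \<Rightarrow> 'b::euclidean_space set"
  assumes "\<And>y. y \<in> Y \<Longrightarrow> \<exists>W. open W \<and> y \<in> W \<and> negligible (\<Union>z\<in>W \<inter> Y. Q z)"
  shows "negligible (\<Union>y\<in>Y. Q y)"
proof -
  obtain W where W: "\<And>y. y \<in> Y \<Longrightarrow> open (W y) \<and> y \<in> W y \<and> negligible (\<Union>z\<in>W y \<inter> Y. Q z)"
    using assms by metis
  obtain F where F: "F \<subseteq> W ` Y" "countable F" "\<Union>F = \<Union>(W ` Y)"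
    using Lindelof[of "W ` Y"] W by (metis (no_types, lifting) imageE)
  have "negligible (\<Union>V\<in>F. \<Union>z\<in>V \<inter> Y. Q z)"
    using F(1,2) W by (intro negligible_countable_Union) auto
  moreover have "(\<Union>y\<in>Y. Q y) \<subseteq> (\<Union>V\<in>F. \<Union>z\<in>V \<inter> Y. Q z)"
    using F(3) W by blast
  ultimately show ?thesis by (rule negligible_subset)
qed

lemma lipschitz_negligible_locally:
  fixes Y :: "'a::euclidean_space set"
  assumes "\<And>y. y \<in> Y \<Longrightarrow> \<exists>W. open W \<and> y \<in> W \<and> lipschitz_negligible TYPE('k::finite) (W \<inter> Y)"
  shows "lipschitz_negligible TYPE('k) Y"
  unfolding lipschitz_negligible_def
proof (intro allI impI)
  fix A L and f :: "'a \<Rightarrow> real ^ 'k"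
  assume A: "A \<subseteq> Y \<and> (\<forall>y\<in>A. \<forall>z\<in>A. norm (f y - f z) \<le> L * norm (y - z))"
  have "negligible (\<Union>y\<in>A. {f y})"
  proof (rule negligible_locally_countable)
    fix y assume "y \<in> A"
    then obtain W where W: "open W" "y \<in> W" "lipschitz_negligible TYPE('k) (W \<inter> Y)"
      using assms A by blast
    have "negligible (f ` (W \<inter> A))"
      by (rule lipschitz_negligibleD[OF W(3), of _ _ L]) (use A in auto)
    then show "\<exists>W. open W \<and> y \<in> W \<and> negligible (\<Union>z\<in>W \<inter> A. {f z})"
      using W by (metis UNION_singleton_eq_range)
  qed
  then show "negligible (f ` A)" by (simp add: UNION_singleton_eq_range)
qed

text \<open>A further Lipschitz map \<open>f\<close> composes with \<open>g\<close> to a Lipschitz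
  map between subsets of \<open>\<real>^k\<close>, and such maps preserve null sets.\<close>

lemma lipschitz_negligible_Lipschitz_image:
  fixes g :: "real ^ 'k \<Rightarrow> 'a::real_normed_vector"
  assumes "negligible Z" "\<And>s t. s \<in> Z \<Longrightarrow> t \<in> Z \<Longrightarrow> norm (g s - g t) \<le> B * norm (s - t)" "Y \<subseteq> g ` Z"
  shows "lipschitz_negligible TYPE('k) Y"
  unfolding lipschitz_negligible_def
proof (intro allI impI)
  fix A L and f :: "'a \<Rightarrow> real ^ 'k"
  assume A: "A \<subseteq> Y \<and> (\<forall>y\<in>A. \<forall>z\<in>A. norm (f y - f z) \<le> L * norm (y - z))"
  have "negligible ((\<lambda>t. f (g t)) ` (Z \<inter> g -` A))"
  proof (rule negligible_locally_Lipschitz_image)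
    fix x assume x: "x \<in> Z \<inter> g -` A"
    have "norm (f (g y) - f (g x)) \<le> (\<bar>L\<bar> * B) * norm (y - x)" if "y \<in> (Z \<inter> g -` A) \<inter> UNIV" for y
    proof -
      have "norm (f (g y) - f (g x)) \<le> L * norm (g y - g x)" using A x that by auto
      also have "\<dots> \<le> \<bar>L\<bar> * norm (g y - g x)" by (simp add: mult_right_mono)
      also have "\<dots> \<le> \<bar>L\<bar> * (B * norm (y - x))"
        using assms(2) x that by (intro mult_left_mono) auto
      finally show ?thesis by (simp add: mult.assoc)
    qed
    then show "\<exists>T B. open T \<and> x \<in> T \<and>
        (\<forall>y\<in>(Z \<inter> g -` A) \<inter> T. norm (f (g y) - f (g x)) \<le> B * norm (y - x))"
      by blast
  qed (use assms(1) in \<open>auto intro: negligible_subset\<close>)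
  moreover have "f ` A \<subseteq> (\<lambda>t. f (g t)) ` (Z \<inter> g -` A)"
    using A assms(3) by (auto 4 4)
  ultimately show "negligible (f ` A)" by (rule negligible_subset)
qed

text \<open>The image of \<open>U i\<close> lies in a cube of side
  \<open>2 * \<bar>L\<bar> * diameter (U i)\<close>, whose volume is a constant times
  \<open>diameter (U i) ^ k\<close>. The content at scale \<open>1\<close> bounds the Hausdorff
  measure from below, so it is zero and supplies covers with arbitrarily small sum.\<close>

lemma lipschitz_negligible_if_hausdorff_measure_0:
  fixes X :: "'a::euclidean_space set"
  assumes "hausdorff_measure CARD('k::finite) X = 0"
  shows "lipschitz_negligible TYPE('k) X"
  unfolding lipschitz_negligible_def
proof (intro allI impI)
  fix A L and f :: "'a \<Rightarrow> real ^ 'k"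
  assume A: "A \<subseteq> X \<and> (\<forall>y\<in>A. \<forall>z\<in>A. norm (f y - f z) \<le> L * norm (y - z))"
  let ?k = "CARD('k)"
  \<comment> \<open>Dominates the factor \<open>2 * \<bar>L\<bar>\<close> of the side length and is
    positive even for \<open>L = 0\<close>, so that \<open>e\<close> can be divided by
    \<open>B ^ k\<close>.\<close>
  define B where "B = 2 * (\<bar>L\<bar> + 1)"
  have B: "B > 0" by (simp add: B_def add_nonneg_pos)
  have "hausdorff_content 1 ?k X \<le> hausdorff_measure ?k X"
    unfolding hausdorff_measure_def by (rule SUP_upper) simp
  then have c0: "hausdorff_content 1 ?k X = 0" using assms by simp
  show "negligible (f ` A)"
    unfolding negligible_outer_le
  proof (intro allI impI)
    fix e :: real assume e: "e > 0"
    define e' where "e' = e / B ^ ?k"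
    have "e' > 0" using e B by (simp add: e'_def)
    then have "hausdorff_content 1 ?k X < ennreal e'" using c0 by simp
    then obtain U :: "nat \<Rightarrow> 'a set" where U: "\<And>i. bounded (U i)" "X \<subseteq> (\<Union>i. U i)"
      "(\<Sum>i. if U i = {} then 0 else ennreal (diameter (U i) ^ ?k)) < ennreal e'"
      unfolding hausdorff_content_def by (auto simp: INF_less_iff)
    have d0: "diameter (U i) \<ge> 0" for i using U(1) by (rule diameter_ge_0)
    \<comment> \<open>As \<open>CARD('k) > 0\<close>, the empty set contributes \<open>0\<close> by
      its diameter as well, so the case distinction disappears.\<close>
    have eq: "(if U i = {} then 0 else ennreal (diameter (U i) ^ ?k)) = ennreal (diameter (U i) ^ ?k)" for i
      by (simp add: zero_power)
    have s: "(\<Sum>i. ennreal (diameter (U i) ^ ?k)) < ennreal e'"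
      using U(3) unfolding eq .
    \<comment> \<open>A centre in \<open>U i \<inter> A\<close>; if this set is empty,
      \<open>z i\<close> is arbitrary and the cube merely has to satisfy the volume bound.\<close>
    define z where "z i = (SOME y. y \<in> U i \<inter> A)" for i
    define r where "r i = \<bar>L\<bar> * diameter (U i)" for i
    define V where "V i = cbox (f (z i) - (\<chi> j. r i)) (f (z i) + (\<chi> j. r i))" for i
    have V: "f y \<in> V i" if y: "y \<in> A" "y \<in> U i" for y i
    proof -
      have z: "z i \<in> U i \<inter> A"
        unfolding z_def by (rule someI[of _ y]) (use y in simp)
      have "norm (f y - f (z i)) \<le> L * norm (y - z i)" using A y z by blast
      also have "\<dots> \<le> \<bar>L\<bar> * norm (y - z i)" by (simp add: mult_right_mono)
      also have "\<dots> \<le> r i"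
        using diameter_bounded_bound[OF U(1), of y i "z i"] y z
        by (auto simp: r_def dist_norm intro: mult_left_mono)
      finally have n: "norm (f y - f (z i)) \<le> r i" .
      have "\<bar>f y $ j - f (z i) $ j\<bar> \<le> r i" for j
        using component_le_norm_cart[of "f y - f (z i)" j] n by simp
      then show ?thesis
        unfolding V_def mem_box_cart by (auto simp: abs_le_iff algebra_simps)
    qed
    have r0: "r i \<ge> 0" for i using d0 by (simp add: r_def)
    have mV: "measure lebesgue (V i) = (2 * r i) ^ ?k" for i
    proof -
      have "V i \<noteq> {}" unfolding V_def using r0[of i] by (simp add: interval_eq_empty_cart not_less)
      then have "measure lborel (V i) = (2 * r i) ^ ?k"
        unfolding V_def by (subst content_cbox_cart) auto
      then show ?thesis by (simp add: V_def)
    qed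
    have mV_le: "measure lebesgue (V i) \<le> B ^ ?k * diameter (U i) ^ ?k" for i
      unfolding mV power_mult_distrib[symmetric]
      by (intro power_mono) (use d0[of i] in \<open>auto simp: r_def B_def algebra_simps\<close>)
    have sm: "summable (\<lambda>i. diameter (U i) ^ ?k)"
      using s d0 by (intro summable_suminf_not_top) (auto intro: less_imp_neq order.strict_trans)
    have sum_lt: "(\<Sum>i. diameter (U i) ^ ?k) < e'"
      using s d0 sm \<open>e' > 0\<close> by (simp add: suminf_ennreal2 ennreal_less_iff suminf_nonneg)
    have lm: "V i \<in> lmeasurable" for i unfolding V_def by simp
    have bd: "measure lebesgue (\<Union>i\<le>n. V i) \<le> e" for n
    proof -
      have "measure lebesgue (\<Union>i\<le>n. V i) \<le> (\<Sum>i\<le>n. measure lebesgue (V i))"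
        using lm by (intro measure_UNION_le) (auto simp: fmeasurableD)
      also have "\<dots> \<le> (\<Sum>i\<le>n. B ^ ?k * diameter (U i) ^ ?k)"
        by (intro sum_mono mV_le)
      also have "\<dots> = B ^ ?k * (\<Sum>i\<le>n. diameter (U i) ^ ?k)" by (simp add: sum_distrib_left)
      also have "\<dots> \<le> B ^ ?k * (\<Sum>i. diameter (U i) ^ ?k)"
        using sm d0 B by (intro mult_left_mono sum_le_suminf) auto
      also have "\<dots> \<le> B ^ ?k * e'" using sum_lt B by (intro mult_left_mono) auto
      also have "\<dots> = e" using B by (simp add: e'_def)
      finally show ?thesis .
    qed
    have "(\<Union>i. V i) \<in> lmeasurable" "measure lebesgue (\<Union>i. V i) \<le> e"
      by (rule fmeasurable_countable_Union[OF lm bd] measure_countable_Union_le[OF lm bd])+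
    moreover have "f ` A \<subseteq> (\<Union>i. V i)"
    proof
      fix u assume "u \<in> f ` A"
      then obtain y where y: "y \<in> A" "u = f y" by blast
      then obtain i where "y \<in> U i" using A U(2) by blast
      then show "u \<in> (\<Union>i. V i)" using V[OF y(1)] y(2) by blast
    qed
    ultimately show "\<exists>T. f ` A \<subseteq> T \<and> T \<in> lmeasurable \<and> measure lebesgue T \<le> e"
      by blast
  qed
qed

text \<open>\<open>G y a = w y + D y a\<close> with \<open>D y\<^sub>0\<close> right invertible: solving \<open>G y (b + P t) = 0\<close> for \<open>t\<close>, with \<open>P\<close> a
  right inverse of \<open>D y\<^sub>0\<close>, makes the solution a Lipschitz function of \<open>y\<close>.\<close>

lemma negligible_zero_parameters_locally:
  fixes w :: "'a::euclidean_space \<Rightarrow> 'k::finite \<Rightarrow> real" and D :: "'a \<Rightarrow> 'k \<Rightarrow> 'm::finite \<Rightarrow> real"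
    and p :: "'k \<Rightarrow> 'm \<Rightarrow> real"
  assumes "y0 \<in> Y" "e > 0" "compact (cball y0 e \<inter> Y)" "lipschitz_negligible TYPE('k) Y" "B \<ge> 0"
    and w: "\<And>i y z. y \<in> cball y0 e \<inter> Y \<Longrightarrow> z \<in> cball y0 e \<inter> Y \<Longrightarrow> \<bar>w y i - w z i\<bar> \<le> B * norm (y - z)"
    and D: "\<And>i j y z. y \<in> cball y0 e \<inter> Y \<Longrightarrow> z \<in> cball y0 e \<inter> Y \<Longrightarrow> \<bar>D y i j - D z i j\<bar> \<le> B * norm (y - z)"
    and p: "\<And>i l. (\<Sum>j\<in>UNIV. p l j * D y0 i j) = (if i = l then 1 else 0)"
  shows "\<exists>W. open W \<and> y0 \<in> W \<and> negligible
    (\<Union>y\<in>W \<inter> Y. {a :: real ^ 'm. norm a \<le> R \<and> (\<forall>i. w y i + (\<Sum>j\<in>UNIV. a $ j * D y i j) = 0)})"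
proof -
  define k where "k = real CARD('k)"
  have k: "k > 0" by (simp add: k_def)
  define S where "S = (\<Sum>l\<in>UNIV. \<Sum>j\<in>UNIV. \<bar>p l j\<bar>)"
  have S: "S \<ge> 0" "(\<Sum>j\<in>UNIV. \<bar>p l j\<bar>) \<le> S" for l
    unfolding S_def by (auto intro!: sum_nonneg member_le_sum)
  \<comment> \<open>For \<open>norm (y - y0) \<le> d\<close> the entries of \<open>D y\<close>
    composed with \<open>P\<close>, minus the identity, are at most \<open>S * B * d\<close>.
    Summing over rows and columns costs \<open>k^2\<close>, and \<open>d\<close> makes the total at
    most \<open>1/2\<close>; the \<open>+ 1\<close> avoids division by zero.\<close>
  define d where "d = min e (1 / (2 * k^2 * (S * B + 1)))"
  have SB: "S * B + 1 > 0" using S(1) \<open>B \<ge> 0\<close> by (simp add: add_nonneg_pos)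
  have d: "d > 0" "d \<le> e" "k^2 * (S * B * d) \<le> 1/2"
  proof -
    show "d > 0" "d \<le> e" using \<open>e > 0\<close> k SB by (auto simp: d_def)
    have "k^2 * (S * B * d) \<le> k^2 * ((S * B + 1) * d)"
      using \<open>d > 0\<close> by (intro mult_left_mono mult_right_mono) auto
    also have "\<dots> \<le> k^2 * ((S * B + 1) * (1 / (2 * k^2 * (S * B + 1))))"
      unfolding d_def using SB by (intro mult_left_mono) auto
    also have "\<dots> = 1/2" using k SB by simp
    finally show "k^2 * (S * B * d) \<le> 1/2" .
  qed
  define K where "K = cball y0 d \<inter> Y"
  have Ke: "K \<subseteq> cball y0 e \<inter> Y" using d(2) by (auto simp: K_def)
  have "K = cball y0 d \<inter> (cball y0 e \<inter> Y)" using d(2) by (auto simp: K_def)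
  then have cK: "compact K" using assms(3) compact_Int closed_Int_compact by (metis closed_cball)
  define G where "G y a = (\<chi> i. w y i + (\<Sum>j\<in>UNIV. a $ j * D y i j))" for y and a :: "real ^ 'm"
  \<comment> \<open>By the hypothesis \<open>p\<close>, this is a right inverse of
    \<open>D y0\<close>.\<close>
  define P where "P t = (\<chi> j. \<Sum>l\<in>UNIV. t $ l * p l j)" for t :: "real ^ 'k"
  have G_zero: "G y a = 0 \<longleftrightarrow> (\<forall>i. w y i + (\<Sum>j\<in>UNIV. a $ j * D y i j) = 0)" for y a
    by (simp add: G_def vec_eq_iff)
  have contw: "continuous_on K (\<lambda>y. w y i)" for i
    using w[OF subsetD[OF Ke] subsetD[OF Ke]] \<open>B \<ge> 0\<close>
    by (intro lipschitz_on_continuous_on[OF lipschitz_onI[of K _ B]]) (simp_all add: dist_norm)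
  have contD: "continuous_on K (\<lambda>y. D y i j)" for i j
    using D[OF subsetD[OF Ke] subsetD[OF Ke]] \<open>B \<ge> 0\<close>
    by (intro lipschitz_on_continuous_on[OF lipschitz_onI[of K _ B]]) (simp_all add: dist_norm)
  have contP: "continuous_on UNIV P"
    unfolding P_def by (intro continuous_intros)
  have contG: "continuous_on (K \<times> cball 0 R) (\<lambda>(y, a). G y a)"
    unfolding G_def split_def
    by (intro continuous_intros continuous_on_compose2[OF contw continuous_on_fst[OF continuous_on_id]]
        continuous_on_compose2[OF contD continuous_on_fst[OF continuous_on_id]]) auto
  have lip: "norm (G y a - G z a) \<le> (k * (B + real CARD('m) * (R * B))) * norm (y - z)"
    if yz: "y \<in> K" "z \<in> K" and a: "norm a \<le> R" for y z a
  proof -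
    have yz': "y \<in> cball y0 e \<inter> Y" "z \<in> cball y0 e \<inter> Y" using yz Ke by auto
    have *: "\<bar>(G y a - G z a) $ i\<bar> \<le> (B + real CARD('m) * (R * B)) * norm (y - z)" for i
    proof -
      have "(G y a - G z a) $ i = (w y i - w z i) + (\<Sum>j\<in>UNIV. a $ j * (D y i j - D z i j))"
        by (simp add: G_def sum_subtractf right_diff_distrib)
      also have "\<bar>\<dots>\<bar> \<le> \<bar>w y i - w z i\<bar> + (\<Sum>j\<in>UNIV. \<bar>a $ j * (D y i j - D z i j)\<bar>)"
        by (rule order_trans[OF abs_triangle_ineq add_left_mono[OF sum_abs]])
      also have "\<dots> \<le> B * norm (y - z) + (\<Sum>j\<in>(UNIV :: 'm set). R * (B * norm (y - z)))"
      proof (intro add_mono sum_mono w[OF yz'])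
        fix j
        have "\<bar>a $ j\<bar> \<le> R" using component_le_norm_cart[of a j] a by simp
        then show "\<bar>a $ j * (D y i j - D z i j)\<bar> \<le> R * (B * norm (y - z))"
          unfolding abs_mult by (intro mult_mono D[OF yz']) auto
      qed
      finally show ?thesis by (simp add: algebra_simps)
    qed
    have "norm (G y a - G z a) \<le> (\<Sum>i\<in>UNIV. \<bar>(G y a - G z a) $ i\<bar>)" by (rule norm_le_l1_cart)
    also have "\<dots> \<le> (\<Sum>i\<in>(UNIV :: 'k set). (B + real CARD('m) * (R * B)) * norm (y - z))"
      by (intro sum_mono *)
    finally show ?thesis by (simp add: k_def mult.assoc)
  qed
  have low: "1/2 * norm (s - t) \<le> norm (G y (a + P s) - G y (a + P t))"
    if y: "y \<in> K" for y a s t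
  proof -
    let ?u = "s - t" and ?v = "G y (a + P s) - G y (a + P t)"
    have y': "y \<in> cball y0 e \<inter> Y" "y0 \<in> cball y0 e \<inter> Y" "norm (y - y0) \<le> d"
      using y Ke \<open>y0 \<in> Y\<close> \<open>e > 0\<close> by (auto simp: K_def dist_norm norm_minus_commute)
    have *: "\<bar>(?v - ?u) $ i\<bar> \<le> k * (norm ?u * (S * B * d))" for i
    proof -
      have "?v $ i = (\<Sum>j\<in>UNIV. \<Sum>l\<in>UNIV. ?u $ l * p l j * D y i j)"
        by (simp add: G_def P_def sum_subtractf[symmetric] left_diff_distrib[symmetric]
            sum_distrib_right distrib_right sum.distrib)
      also have "\<dots> = (\<Sum>l\<in>UNIV. ?u $ l * (\<Sum>j\<in>UNIV. p l j * D y i j))"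
        by (subst sum.swap) (simp add: sum_distrib_left mult.assoc)
      finally have "?v $ i = (\<Sum>l\<in>UNIV. ?u $ l * (\<Sum>j\<in>UNIV. p l j * D y i j))" .
      moreover have "(\<Sum>l\<in>UNIV. ?u $ l * (\<Sum>j\<in>UNIV. p l j * D y0 i j)) = (\<Sum>l\<in>UNIV. if i = l then ?u $ l else 0)"
        by (intro sum.cong) (auto simp: p)
      ultimately have "(?v - ?u) $ i = (\<Sum>l\<in>UNIV. ?u $ l * (\<Sum>j\<in>UNIV. p l j * D y i j))
          - (\<Sum>l\<in>UNIV. ?u $ l * (\<Sum>j\<in>UNIV. p l j * D y0 i j))"
        by simp
      also have "\<dots> = (\<Sum>l\<in>UNIV. ?u $ l * (\<Sum>j\<in>UNIV. p l j * (D y i j - D y0 i j)))"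
        by (simp add: right_diff_distrib sum_subtractf)
      also have "\<bar>\<dots>\<bar> \<le> (\<Sum>l\<in>(UNIV :: 'k set). norm ?u * (S * B * d))"
      proof (rule order_trans[OF sum_abs], rule sum_mono)
        fix l
        have "\<bar>\<Sum>j\<in>UNIV. p l j * (D y i j - D y0 i j)\<bar> \<le> (\<Sum>j\<in>UNIV. \<bar>p l j\<bar> * (B * d))"
        proof (rule order_trans[OF sum_abs], rule sum_mono)
          fix j
          have "\<bar>D y i j - D y0 i j\<bar> \<le> B * d"
            using D[OF y'(1,2), of i j] mult_left_mono[OF y'(3) \<open>B \<ge> 0\<close>] by simp
          then show "\<bar>p l j * (D y i j - D y0 i j)\<bar> \<le> \<bar>p l j\<bar> * (B * d)"
            unfolding abs_mult by (intro mult_left_mono) auto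
        qed
        also have "\<dots> \<le> S * (B * d)"
          unfolding sum_distrib_right[symmetric] using S(2) \<open>B \<ge> 0\<close> d(1) by (intro mult_right_mono) auto
        finally show "\<bar>?u $ l * (\<Sum>j\<in>UNIV. p l j * (D y i j - D y0 i j))\<bar> \<le> norm ?u * (S * B * d)"
          unfolding abs_mult by (intro mult_mono component_le_norm_cart) (auto simp: mult.assoc)
      qed
      finally show ?thesis by (simp add: k_def)
    qed
    \<comment> \<open>Here \<open>?v\<close> is \<open>D y\<close> applied to \<open>P ?u\<close>.
      It differs from \<open>?u\<close> by at most half of \<open>norm ?u\<close>, so its norm is at
      least the other half.\<close>
    have "norm (?v - ?u) \<le> (\<Sum>i\<in>UNIV. \<bar>(?v - ?u) $ i\<bar>)" by (rule norm_le_l1_cart)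
    also have "\<dots> \<le> (\<Sum>i\<in>(UNIV :: 'k set). k * (norm ?u * (S * B * d)))"
      by (rule sum_mono) (rule *)
    also have "\<dots> = norm ?u * (k^2 * (S * B * d))" by (simp add: k_def power2_eq_square)
    also have "\<dots> \<le> norm ?u * (1/2)" using d(3) by (rule mult_left_mono) simp
    finally show ?thesis using norm_triangle_ineq2[of ?u ?v] by (simp add: norm_minus_commute)
  qed
  have LN: "lipschitz_negligible TYPE('k) K"
    using assms(4) by (rule lipschitz_negligible_subset) (simp add: K_def)
  have "negligible {a. norm a \<le> R \<and> (\<exists>y\<in>K. G y a = 0)}"
    by (rule negligible_zero_parameters_compact[OF cK contG contP lip low _ LN]) auto
  then have "negligible (\<Union>y\<in>ball y0 d \<inter> Y.
      {a :: real ^ 'm. norm a \<le> R \<and> (\<forall>i. w y i + (\<Sum>j\<in>UNIV. a $ j * D y i j) = 0)})"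
    by (rule negligible_subset) (auto simp: K_def G_zero)
  then show ?thesis
    using d(1) by (intro exI[of _ "ball y0 d"]) simp
qed

text \<open>Countably many radii \<open>R\<close> and Lindelof over \<open>Y\<close> reduce this to
  the local lemma. Only small balls in \<open>Y\<close> are asked to be compact, so \<open>Y\<close>
  may be a compact set with finitely many points removed. Surjectivity of \<open>D y0\<close> is
  stated as solvability for each unit vector, the form in which interpolation provides it.\<close>

lemma negligible_zero_parameters:
  fixes w :: "'a::euclidean_space \<Rightarrow> 'k::finite \<Rightarrow> real" and D :: "'a \<Rightarrow> 'k \<Rightarrow> 'm::finite \<Rightarrow> real"
  assumes LN: "lipschitz_negligible TYPE('k) Y"
    and loc: "\<And>y0. y0 \<in> Y \<Longrightarrow> \<exists>e>0. \<exists>B\<ge>0. compact (cball y0 e \<inter> Y) \<and>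
      (\<forall>y\<in>cball y0 e \<inter> Y. \<forall>z\<in>cball y0 e \<inter> Y. (\<forall>i. \<bar>w y i - w z i\<bar> \<le> B * norm (y - z)) \<and>
         (\<forall>i j. \<bar>D y i j - D z i j\<bar> \<le> B * norm (y - z)))"
    and coeffs: "\<And>y0 l. y0 \<in> Y \<Longrightarrow> \<exists>c. \<forall>i. (\<Sum>j\<in>UNIV. c j * D y0 i j) = (if i = l then 1 else 0)"
  shows "negligible {a :: real ^ 'm. \<exists>y\<in>Y. \<forall>i. w y i + (\<Sum>j\<in>UNIV. a $ j * D y i j) = 0}"
proof -
  let ?Q = "\<lambda>R y. {a :: real ^ 'm. norm a \<le> R \<and> (\<forall>i. w y i + (\<Sum>j\<in>UNIV. a $ j * D y i j) = 0)}"
  have "negligible (\<Union>y\<in>Y. ?Q R y)" for R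
  proof (rule negligible_locally_countable)
    fix y0 assume y0: "y0 \<in> Y"
    obtain e B where e: "e > 0" "B \<ge> 0" "compact (cball y0 e \<inter> Y)"
      and lip: "\<forall>y\<in>cball y0 e \<inter> Y. \<forall>z\<in>cball y0 e \<inter> Y. (\<forall>i. \<bar>w y i - w z i\<bar> \<le> B * norm (y - z)) \<and>
         (\<forall>i j. \<bar>D y i j - D z i j\<bar> \<le> B * norm (y - z))"
      using loc[OF y0] by blast
    have "\<forall>l. \<exists>c. \<forall>i. (\<Sum>j\<in>UNIV. c j * D y0 i j) = (if i = l then 1 else 0)"
      using coeffs[OF y0] by (rule allI)
    from choice[OF this]
    obtain p where p: "\<forall>l i. (\<Sum>j\<in>UNIV. p l j * D y0 i j) = (if i = l then 1 else 0)" by blast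
    show "\<exists>W. open W \<and> y0 \<in> W \<and> negligible (\<Union>y\<in>W \<inter> Y. ?Q R y)"
    proof (rule negligible_zero_parameters_locally[where w = w and D = D and p = p, OF y0 e(1,3) LN e(2)])
      show "(\<Sum>j\<in>UNIV. p l j * D y0 i j) = (if i = l then 1 else 0)" for i l using p by blast
    qed (use lip in auto)
  qed
  then have "negligible (\<Union>R::nat. \<Union>y\<in>Y. ?Q (real R) y)"
    by (intro negligible_countable_Union) auto
  then show ?thesis
  proof (rule negligible_subset, intro subsetI)
    fix a assume "a \<in> {a :: real ^ 'm. \<exists>y\<in>Y. \<forall>i. w y i + (\<Sum>j\<in>UNIV. a $ j * D y i j) = 0}"
    moreover obtain R where "norm a \<le> real (R::nat)" using real_arch_simple by blast
    ultimately show "a \<in> (\<Union>R::nat. \<Union>y\<in>Y. ?Q (real R) y)" by blast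
  qed
qed

subsection \<open>Submanifolds\<close>

text \<open>Insert \<open>y = z + t *\<^sub>R u\<close> with \<open>u\<close> in \<open>L\<close>,
  divide by \<open>t\<close> and let the remainder vanish. This turns a Lipschitz left inverse along
  \<open>L\<close> into injectivity of the derivative on \<open>L\<close>.\<close>

lemma has_derivative_lower_bound:
  fixes f :: "'a::real_normed_vector \<Rightarrow> 'b::real_normed_vector"
  assumes f: "(f has_derivative f') (at z)" and L: "subspace L" "z \<in> L" and O: "open V" "z \<in> V"
    and le: "\<And>y. y \<in> V \<Longrightarrow> y \<in> L \<Longrightarrow> norm (y - z) \<le> c * norm (f y - f z)"
    and c: "c \<ge> 0" and u: "u \<in> L"
  shows "norm u \<le> c * norm (f' u)"
proof (cases "u = 0")
  case False
  show ?thesis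
  proof (rule field_le_epsilon)
    fix e :: real assume e: "e > 0"
    \<comment> \<open>Chosen so that the remainder contributes
      \<open>c * e' * norm u \<le> e\<close>; \<open>c + 1\<close> covers
      \<open>c = 0\<close>.\<close>
    define e' where "e' = e / ((c + 1) * norm u)"
    have pos: "(c + 1) * norm u > 0" using c False by simp
    then have e': "e' > 0" using e by (simp add: e'_def)
    have "c * (e' * norm u) \<le> (c + 1) * (e' * norm u)" using e' by (intro mult_right_mono) auto
    also have "\<dots> = e' * ((c + 1) * norm u)" by (simp add: mult_ac)
    also have "\<dots> = e" unfolding e'_def using pos by (metis nonzero_eq_divide_eq less_irrefl)
    finally have e'e: "c * (e' * norm u) \<le> e" .
    obtain b where b: "b > 0" "\<And>y. norm (y - z) < b \<Longrightarrow> norm (f y - f z - f' (y - z)) \<le> e' * norm (y - z)"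
      using f e' unfolding has_derivative_at_alt by blast
    obtain a where a: "a > 0" "ball z a \<subseteq> V" using O open_contains_ball by blast
    define t where "t = min a b / (2 * norm u)"
    have t: "t > 0" "t * norm u < a" "t * norm u < b"
      using a(1) b(1) False by (auto simp: t_def)
    define y where "y = z + t *\<^sub>R u"
    have yz: "y - z = t *\<^sub>R u" "norm (y - z) = t * norm u" using t(1) by (auto simp: y_def)
    have y: "y \<in> V" "y \<in> L"
    proof -
      have "y \<in> ball z a" using t(2) yz(2) by (simp add: dist_norm norm_minus_commute)
      then show "y \<in> V" using a(2) by blast
      show "y \<in> L" unfolding y_def using L u by (intro subspace_add subspace_scale)
    qed
    have f't: "f' (y - z) = t *\<^sub>R f' u" unfolding yz using has_derivative_linear[OF f] by (simp add: linear_scale)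
    have "t * norm u \<le> c * norm (f y - f z)" using le[OF y] yz(2) by simp
    also have "\<dots> \<le> c * (norm (f' (y - z)) + e' * norm (y - z))"
      using b(2)[of y] yz(2) t(3) norm_triangle_sub[of "f y - f z" "f' (y - z)"]
      by (intro mult_left_mono[OF _ c]) simp
    also have "\<dots> = t * (c * norm (f' u) + c * (e' * norm u))"
      using t(1) by (simp add: f't yz(2) algebra_simps)
    finally have "norm u \<le> c * norm (f' u) + c * (e' * norm u)"
      using t(1) by simp
    then show "norm u \<le> c * norm (f' u) + e" using e'e by simp
  qed
qed (use c in simp)

definition submanifold_chart where
  "submanifold_chart r d M W W' \<psi> \<zeta> L \<longleftrightarrow> open W \<and> open W' \<and> C_on r \<psi> W \<and> C_on r \<zeta> W' \<and>
     subspace L \<and> dim L = d \<and> \<psi> ` W \<subseteq> W' \<and> \<zeta> ` W' \<subseteq> W \<and> (\<forall>y\<in>W. \<zeta> (\<psi> y) = y) \<and>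
     (\<forall>z\<in>W'. \<psi> (\<zeta> z) = z) \<and> (\<forall>y\<in>W. \<psi> y \<in> L \<longleftrightarrow> y \<in> M)"

lemma embedded_submanifold_chart:
  fixes M :: "'a::euclidean_space set"
  assumes "embedded_submanifold r d M" "x \<in> M"
  shows "\<exists>W W' \<psi> \<zeta> L. x \<in> W \<and> submanifold_chart r d M W W' \<psi> \<zeta> (L :: 'a set)"
proof -
  obtain W W' :: "'a set" and \<psi> L where *: "open W" "x \<in> W" "open W'" "C_diffeo_on r \<psi> W W'"
    "subspace L" "dim L = d" "\<psi> ` (W \<inter> M) = W' \<inter> L"
    using bspec[OF assms(1)[unfolded embedded_submanifold_def] assms(2)] by blast
  have bij: "bij_betw \<psi> W W'" and C: "C_on r \<psi> W" "C_on r (the_inv_into W \<psi>) W'"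
    using *(4) by (auto simp: C_diffeo_on_def)
  have inj: "inj_on \<psi> W" and im: "\<psi> ` W = W'"
    using bij by (auto simp: bij_betw_def)
  have i1: "the_inv_into W \<psi> ` W' \<subseteq> W"
    using the_inv_into_into[OF inj _ order_refl] im by blast
  have i2: "the_inv_into W \<psi> (\<psi> y) = y" if "y \<in> W" for y
    using the_inv_into_f_f[OF inj that] .
  have i3: "\<psi> (the_inv_into W \<psi> z) = z" if "z \<in> W'" for z
    using f_the_inv_into_f[OF inj] im that by blast
  have i4: "\<psi> y \<in> L \<longleftrightarrow> y \<in> M" if "y \<in> W" for y
  proof
    assume "\<psi> y \<in> L"
    then have "\<psi> y \<in> \<psi> ` (W \<inter> M)" using * im that by blast
    then show "y \<in> M" using inj that by (auto dest: inj_onD)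
  next
    assume "y \<in> M"
    then have "\<psi> y \<in> \<psi> ` (W \<inter> M)" using that by blast
    then show "\<psi> y \<in> L" unfolding *(7) by blast
  qed
  have "submanifold_chart r d M W W' \<psi> (the_inv_into W \<psi>) L"
    unfolding submanifold_chart_def using *(1,3,5,6) C i1 i2 i3 i4 im by simp
  then show ?thesis using *(2) by blast
qed

text \<open>The model space of a chart lies in \<open>\<real>^n\<close>, whereas null sets and the
  inverse function theorem are used in \<open>\<real>^k\<close>; this moves it there
  isometrically.\<close>

lemma subspace_linear_image:
  fixes L :: "(real ^ 'n) set"
  assumes "subspace L" "dim L \<le> CARD('k::finite)"
  shows "\<exists>(L' :: (real ^ 'k) set) J J'. subspace L' \<and> dim L' = dim L \<and> linear J \<and> linear J' \<and>
    J ` L' = L \<and> J' ` L = L' \<and> (\<forall>t\<in>L'. norm (J t) = norm t) \<and> (\<forall>t\<in>L'. J' (J t) = t) \<and>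
    (\<forall>z\<in>L. J (J' z) = z)"
proof -
  obtain L' :: "(real ^ 'k) set" where L': "subspace L'" "dim L' = dim L"
    using choose_subspace_of_subspace[of "dim L" "UNIV :: (real ^ 'k) set"] assms(2) by auto
  show ?thesis
    by (rule isometries_subspaces[OF L'(1) assms(1) L'(2)]) (use L' in blast)
qed

text \<open>The whole unit sphere of \<open>\<real>^k\<close> is null and its image under
  \<open>J\<close> contains the sphere of \<open>L\<close>. Thus \<open>dim L = k\<close> is
  allowed, which gives the first claim for \<open>k = dim M\<close>.\<close>

lemma lipschitz_negligible_subspace_sphere:
  fixes L :: "(real ^ 'n) set"
  assumes "subspace L" "dim L \<le> CARD('k::finite)"
  shows "lipschitz_negligible TYPE('k) (L \<inter> sphere 0 1)"
proof -
  obtain L' :: "(real ^ 'k) set" and J J' where *: "subspace L'" "linear J" "J ` L' = L" "\<forall>t\<in>L'. norm (J t) = norm t"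
    using subspace_linear_image[OF assms] by blast
  obtain B where B: "\<And>t. norm (J t) \<le> B * norm t"
    using *(2) linear_bounded by blast
  show ?thesis
  proof (rule lipschitz_negligible_Lipschitz_image[of "sphere 0 1" J B])
    show "negligible (sphere (0 :: real ^ 'k) 1)" by (rule negligible_sphere)
    show "norm (J s - J t) \<le> B * norm (s - t)" for s t
      using B[of "s - t"] *(2) by (simp add: linear_diff)
    show "L \<inter> sphere 0 1 \<subseteq> J ` sphere 0 1" using *(3,4) by force
  qed
qed

text \<open>Locally \<open>M\<close> is the image of part of \<open>L'\<close> under the Lipschitz
  map \<open>\<zeta> o J\<close>, and \<open>L'\<close> is null in \<open>\<real>^k\<close> because
  its dimension \<open>d\<close> is strictly less than \<open>k\<close>.\<close>

lemma lipschitz_negligible_submanifold: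
  fixes M :: "(real ^ 'n) set"
  assumes "embedded_submanifold r d M" "1 \<le> r" "d < CARD('k::finite)"
  shows "lipschitz_negligible TYPE('k) M"
proof (rule lipschitz_negligible_locally)
  fix x assume x: "x \<in> M"
  obtain W W' \<psi> \<zeta> and L :: "(real ^ 'n) set" where xW: "x \<in> W" and chart: "submanifold_chart r d M W W' \<psi> \<zeta> L"
    using embedded_submanifold_chart[OF assms(1) x] by blast
  from chart[unfolded submanifold_chart_def] xW have c: "open W" "x \<in> W" "open W'" "C_on r \<psi> W" "C_on r \<zeta> W'"
    "subspace L" "dim L = d" "\<psi> ` W \<subseteq> W'" "\<zeta> ` W' \<subseteq> W"
    "\<forall>y\<in>W. \<zeta> (\<psi> y) = y" "\<forall>z\<in>W'. \<psi> (\<zeta> z) = z"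
    "\<forall>y\<in>W. \<psi> y \<in> L \<longleftrightarrow> y \<in> M"
    by blast+
  have dL: "dim L \<le> CARD('k)" using c(7) assms(3) by simp
  obtain L' :: "(real ^ 'k) set" and J J' where *: "subspace L'" "dim L' = dim L" "linear J" "J ` L' = L"
    "\<forall>t\<in>L'. norm (J t) = norm t"
    using subspace_linear_image[OF c(6) dL] by blast
  have zW: "\<psi> x \<in> W'" using c(2,8) by blast
  obtain V B where V: "open V" "\<psi> x \<in> V" "B \<ge> 0"
    "\<forall>y\<in>V \<inter> W'. \<forall>z\<in>V \<inter> W'. norm (\<zeta> y - \<zeta> z) \<le> B * norm (y - z)"
    using C_on_imp_locally_Lipschitz[OF c(5) assms(2) zW] by blast
  have o: "open (W \<inter> \<psi> -` V)"
    by (rule continuous_open_preimage[OF C_on_imp_continuous_on[OF c(4)] c(1) V(1)])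
  have "lipschitz_negligible TYPE('k) (W \<inter> \<psi> -` V \<inter> M)"
  proof (rule lipschitz_negligible_Lipschitz_image[of "L' \<inter> J -` (V \<inter> W')" "\<lambda>t. \<zeta> (J t)" B])
    have "negligible L'"
      using negligible_lowdim[of L'] *(2) c(7) assms(3) by simp
    then show "negligible (L' \<inter> J -` (V \<inter> W'))" by (rule negligible_subset) simp
    show "norm (\<zeta> (J s) - \<zeta> (J t)) \<le> B * norm (s - t)"
      if "s \<in> L' \<inter> J -` (V \<inter> W')" "t \<in> L' \<inter> J -` (V \<inter> W')" for s t
    proof -
      have "norm (\<zeta> (J s) - \<zeta> (J t)) \<le> B * norm (J s - J t)" using V(4) that by auto
      also have "J s - J t = J (s - t)" using *(3) by (simp add: linear_diff)
      also have "norm \<dots> = norm (s - t)" using *(1,5) that by (auto intro: subspace_diff)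
      finally show ?thesis .
    qed
    show "W \<inter> \<psi> -` V \<inter> M \<subseteq> (\<lambda>t. \<zeta> (J t)) ` (L' \<inter> J -` (V \<inter> W'))"
    proof
      fix y assume y: "y \<in> W \<inter> \<psi> -` V \<inter> M"
      then have "\<psi> y \<in> L" "\<psi> y \<in> V \<inter> W'" using c(8,12) by auto
      then obtain t where "t \<in> L'" "J t = \<psi> y" using *(4) by (metis imageE)
      then show "y \<in> (\<lambda>t. \<zeta> (J t)) ` (L' \<inter> J -` (V \<inter> W'))"
        using \<open>\<psi> y \<in> V \<inter> W'\<close> y c(10) by (intro image_eqI[of _ _ t]) auto
    qed
  qed
  then show "\<exists>W. open W \<and> x \<in> W \<and> lipschitz_negligible TYPE('k) (W \<inter> M)"
    using o c(2) V(2) by (intro exI[of _ "W \<inter> \<psi> -` V"]) auto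
qed

subsection \<open>Delay coordinate maps\<close>

locale delay_system =
  fixes r :: enat and d :: nat and M :: "(real ^ 'n) set" and T :: "real ^ 'n \<Rightarrow> real ^ 'n"
    and idx :: "'k::finite \<Rightarrow> nat" and hs :: "'m::finite \<Rightarrow> real ^ 'n \<Rightarrow> real"
    and h :: "real ^ 'n \<Rightarrow> real"
  assumes r: "1 \<le> r" and compact_M: "compact M" and submanifold_M: "embedded_submanifold r d M"
    and diffeo_T: "C_diffeo_on r T M M" and bij_idx: "bij_betw idx UNIV {..<CARD('k)}"
    and basis: "is_function_basis hs (polys_degree_le (2 * CARD('k) - 1))"
    and C_h: "C_on r h M"
begin

definition it :: "'k \<Rightarrow> real ^ 'n \<Rightarrow> real ^ 'n" where "it i = T ^^ idx i"

definition \<phi> :: "real ^ 'm \<Rightarrow> real ^ 'n \<Rightarrow> real ^ 'k" where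
  "\<phi> a = delay_map idx T (perturbed_observable h hs a)"

lemma T_image: "T ` M = M" and T_inj: "inj_on T M"
  using diffeo_T by (auto simp: C_diffeo_on_def bij_betw_def)

lemma funpow_mem: "x \<in> M \<Longrightarrow> (T ^^ n) x \<in> M"
  using T_image by (induction n) auto

lemma it_mem: "x \<in> M \<Longrightarrow> it i x \<in> M"
  by (simp add: it_def funpow_mem)

lemma funpow_inj:
  assumes "x \<in> M" "y \<in> M" "(T ^^ n) x = (T ^^ n) y"
  shows "x = y"
  using assms(3)
proof (induction n)
  case (Suc n)
  then have "T ((T ^^ n) x) = T ((T ^^ n) y)" by simp
  then have "(T ^^ n) x = (T ^^ n) y"
    using T_inj funpow_mem assms(1,2) by (meson inj_onD)
  then show ?case by (rule Suc.IH)
qed simp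

lemma C_funpow: "C_on r (T ^^ n) M"
proof (induction n)
  case 0
  then show ?case by (simp add: C_on_id id_def)
next
  case (Suc n)
  have "C_on r T M" using diffeo_T by (simp add: C_diffeo_on_def)
  from C_on_compose[OF Suc this] funpow_mem show ?case by (auto simp: comp_def)
qed

lemma C_it: "C_on r (it i) M"
  by (simp add: it_def C_funpow)

text \<open>Supplies the Lipschitz left inverse which shows that iterates of \<open>T\<close> kill
  no tangent vector.\<close>

lemma funpow_left_inverse: "\<exists>S. C_on r S M \<and> (\<forall>x\<in>M. S ((T ^^ n) x) = x)"
proof (induction n)
  case 0
  then show ?case by (intro exI[of _ "\<lambda>x. x"]) (simp add: C_on_id)
next
  case (Suc n)
  then obtain S where S: "C_on r S M" "\<forall>x\<in>M. S ((T ^^ n) x) = x" by blast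
  have i: "C_on r (the_inv_into M T) M" using diffeo_T by (simp add: C_diffeo_on_def)
  have "the_inv_into M T ` M \<subseteq> M"
    using the_inv_into_into[OF T_inj _ order_refl] T_image by auto
  from C_on_compose[OF i S(1) this]
  have "C_on r (\<lambda>x. S (the_inv_into M T x)) M" .
  moreover have "S (the_inv_into M T ((T ^^ Suc n) x)) = x" if "x \<in> M" for x
    using the_inv_into_f_f[OF T_inj funpow_mem[OF that]] S(2) that by simp
  ultimately show ?case by blast
qed

lemma hs_polys: "hs j \<in> polys_degree_le (2 * CARD('k) - 1)"
  using basis unfolding is_function_basis_def by blast

lemma C_hs: "C_on s (hs j) S"
  by (rule polys_degree_le_C_on[OF hs_polys])

lemma poly_coeffs:
  assumes "p \<in> polys_degree_le (2 * CARD('k) - 1)"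
  shows "\<exists>c. p = (\<lambda>x. \<Sum>j\<in>UNIV. c j * hs j x)"
  using basis assms unfolding is_function_basis_def by blast

lemma \<phi>_nth: "\<phi> a x $ i = h (it i x) + (\<Sum>j\<in>UNIV. a $ j * hs j (it i x))"
  by (simp add: \<phi>_def delay_map_def perturbed_observable_def it_def)

lemma \<phi>_diff_nth:
  "(\<phi> a x - \<phi> a y) $ i = (h (it i x) - h (it i y)) + (\<Sum>j\<in>UNIV. a $ j * (hs j (it i x) - hs j (it i y)))"
  by (simp add: \<phi>_nth right_diff_distrib sum_subtractf)

lemma C_h_it: "C_on r (\<lambda>x. h (it i x)) M"
  by (rule C_on_compose[OF C_it C_h]) (auto simp: it_mem)

lemma C_hs_it: "C_on r (\<lambda>x. hs j (it i x)) M"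
  by (rule C_on_compose[OF C_it C_hs subset_UNIV])

lemma C_\<phi>: "C_on r (\<phi> a) M"
proof (rule C_on_vec)
  fix i
  have "C_on r (\<lambda>x. h (it i x) + (\<Sum>j\<in>UNIV. a $ j *\<^sub>R hs j (it i x))) M"
    by (intro C_on_add C_h_it C_on_sum
        C_on_compose[OF C_hs_it C_on_bounded_linear[OF bounded_linear_scaleR_right] subset_UNIV])
  then show "C_on r (\<lambda>x. \<phi> a x $ i) M" by (simp add: \<phi>_nth)
qed

lemma continuous_\<phi>: "continuous_on (M \<times> UNIV) (\<lambda>(x, a). \<phi> a x)"
proof -
  have "continuous_on (M \<times> UNIV) (\<lambda>p. h (it i (fst p)))" for i
    by (rule continuous_on_compose2[OF C_on_imp_continuous_on[OF C_h_it] continuous_on_fst[OF continuous_on_id]]) auto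
  moreover have "continuous_on (M \<times> UNIV) (\<lambda>p. hs j (it i (fst p)))" for i j
    by (rule continuous_on_compose2[OF C_on_imp_continuous_on[OF C_hs_it] continuous_on_fst[OF continuous_on_id]]) auto
  ultimately have "continuous_on (M \<times> UNIV) (\<lambda>p. \<chi> i. h (it i (fst p)) + (\<Sum>j\<in>UNIV. snd p $ j * hs j (it i (fst p))))"
    by (intro continuous_intros)
  moreover have "(\<lambda>(x, a). \<phi> a x) = (\<lambda>p. \<chi> i. h (it i (fst p)) + (\<Sum>j\<in>UNIV. snd p $ j * hs j (it i (fst p))))"
    by (auto simp: fun_eq_iff vec_eq_iff \<phi>_nth)
  ultimately show ?thesis by simp
qed

lemma coordinates_locally_Lipschitz:
  assumes "x \<in> M"
  shows "\<exists>W B. open W \<and> x \<in> W \<and> B \<ge> 0 \<and> (\<forall>y\<in>W \<inter> M. \<forall>z\<in>W \<inter> M.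
    (\<forall>i. \<bar>h (it i y) - h (it i z)\<bar> \<le> B * norm (y - z)) \<and>
    (\<forall>i j. \<bar>hs j (it i y) - hs j (it i z)\<bar> \<le> B * norm (y - z)))"
proof -
  \<comment> \<open>All observations are bundled into one vector, so that one neighbourhood and one
    constant serve them all; \<open>None\<close> stands for \<open>h\<close>, \<open>Some j\<close>
    for \<open>hs j\<close>.\<close>
  let ?F = "\<lambda>x. (\<chi> p. case p of (i, None) \<Rightarrow> h (it i x) | (i, Some j) \<Rightarrow> hs j (it i x)) :: real ^ ('k \<times> 'm option)"
  have "C_on r ?F M"
  proof (rule C_on_vec)
    fix p :: "'k \<times> 'm option"
    obtain i q where "p = (i, q)" by (cases p)
    then show "C_on r (\<lambda>x. ?F x $ p) M"
      by (cases q) (simp_all add: C_h_it C_hs_it)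
  qed
  from C_on_imp_locally_Lipschitz[OF this r assms]
  obtain W B where W: "open W" "x \<in> W" "B \<ge> 0"
    "\<forall>y\<in>W \<inter> M. \<forall>z\<in>W \<inter> M. norm (?F y - ?F z) \<le> B * norm (y - z)" by blast
  have "\<bar>h (it i y) - h (it i z)\<bar> \<le> B * norm (y - z)" "\<bar>hs j (it i y) - hs j (it i z)\<bar> \<le> B * norm (y - z)"
    if "y \<in> W \<inter> M" "z \<in> W \<inter> M" for y z i j
  proof -
    have n: "norm (?F y - ?F z) \<le> B * norm (y - z)" using W(4) that by blast
    show "\<bar>h (it i y) - h (it i z)\<bar> \<le> B * norm (y - z)"
      using order_trans[OF component_le_norm_cart[of "?F y - ?F z" "(i, None)"] n] by simp
    show "\<bar>hs j (it i y) - hs j (it i z)\<bar> \<le> B * norm (y - z)"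
      using order_trans[OF component_le_norm_cart[of "?F y - ?F z" "(i, Some j)"] n] by simp
  qed
  then show ?thesis
    using W(1-3) by (intro exI[of _ W] exI[of _ B] conjI ballI allI)
qed

section \<open>Injectivity at a fixed point\<close>

lemma interpolation_coeffs:
  assumes "finite Q" "card Q \<le> 2 * CARD('k) - 1" "q0 \<notin> Q"
  shows "\<exists>c. (\<Sum>j\<in>UNIV. c j * hs j q0) = 1 \<and> (\<forall>q\<in>Q. (\<Sum>j\<in>UNIV. c j * hs j q) = 0)"
proof -
  obtain p where p: "p \<in> polys_degree_le (2 * CARD('k) - 1)" "p q0 = 1" "\<And>q. q \<in> Q \<Longrightarrow> p q = 0"
    using polys_degree_le_separate[OF assms] by metis
  obtain c where "p = (\<lambda>x. \<Sum>j\<in>UNIV. c j * hs j x)" using poly_coeffs[OF p(1)] by blast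
  then show ?thesis using p(2,3) by auto
qed

text \<open>Equality of one coordinate is an affine equation in \<open>a\<close>, and its normal
  vector \<open>v\<close> is nonzero because the polynomials separate the distinct points
  \<open>it i x\<close> and \<open>it i y\<close>.\<close>

lemma negligible_equal_delay:
  assumes "x \<in> M" "y \<in> M" "x \<noteq> y"
  shows "negligible {a. \<phi> a x = \<phi> a y}"
proof -
  fix i :: 'k
  have ne: "it i x \<noteq> it i y" using funpow_inj assms unfolding it_def by blast
  have "card {it i y} \<le> 2 * CARD('k) - 1"
    using zero_less_card_finite[where 'a = 'k] by (simp del: zero_less_card_finite)
  then obtain c where c: "(\<Sum>j\<in>UNIV. c j * hs j (it i x)) = 1" "(\<Sum>j\<in>UNIV. c j * hs j (it i y)) = 0"
    using interpolation_coeffs[of "{it i y}" "it i x"] ne by auto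
  define v where "v = (\<chi> j. hs j (it i x) - hs j (it i y))"
  have "v \<noteq> 0"
  proof
    assume "v = 0"
    then have "hs j (it i x) = hs j (it i y)" for j by (simp add: v_def vec_eq_iff)
    then show False using c by simp
  qed
  then have "negligible {a. v \<bullet> a = h (it i y) - h (it i x)}" by (intro negligible_hyperplane) simp
  then show ?thesis
  proof (rule negligible_subset, safe)
    fix a assume "\<phi> a x = \<phi> a y"
    then have "(\<phi> a x - \<phi> a y) $ i = 0" by simp
    then show "v \<bullet> a = h (it i y) - h (it i x)"
      unfolding \<phi>_diff_nth by (simp add: v_def inner_vec_def mult.commute)
  qed
qed

lemma finite_same_orbit:
  assumes "x \<in> M"
  shows "finite {y \<in> M. \<exists>i l. it l y = it i x}"
proof -
  have "finite {y \<in> M. it l y = it i x}" for i l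
  proof (cases "\<exists>z\<in>M. it l z = it i x")
    case True
    then obtain z where "z \<in> M" "it l z = it i x" by blast
    then have "y = z" if "y \<in> M" "it l y = it i x" for y
      using that funpow_inj[of y z "idx l"] by (simp add: it_def)
    then have "{y \<in> M. it l y = it i x} \<subseteq> {z}" by blast
    then show ?thesis by (rule finite_subset) simp
  next
    case False
    then have "{y \<in> M. it l y = it i x} = {}" by blast
    then show ?thesis by (simp only: finite.emptyI)
  qed
  then have "finite (\<Union>i. \<Union>l. {y \<in> M. it l y = it i x})"
    by (intro finite_UN_I finite)
  then show ?thesis by (rule rev_finite_subset) blast
qed

text \<open>If \<open>y\<close> lies on the orbit of \<open>x\<close>, interpolation may fail: for \<open>y = T x\<close> and \<open>T\<^sup>k x = x\<close> the coordinates of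
  \<open>\<phi> a x - \<phi> a y\<close> always sum to zero. There are only finitely many such \<open>y\<close>, and each costs a hyperplane.\<close>

lemma negligible_noninjective:
  assumes x: "x \<in> M" "inj (\<lambda>i. it i x)" and Y: "compact Y" "Y \<subseteq> M" "lipschitz_negligible TYPE('k) Y"
  shows "negligible {a. \<exists>y\<in>Y - {x}. \<phi> a x = \<phi> a y}"
proof -
  define Ob where "Ob = {y \<in> M. \<exists>i l. it l y = it i x}"
  have Ob: "finite Ob" unfolding Ob_def by (rule finite_same_orbit[OF x(1)])
  have xOb: "x \<in> Ob" using x(1) by (auto simp: Ob_def)
  define Y' where "Y' = Y - Ob"
  have LN: "lipschitz_negligible TYPE('k) Y'"
    using Y(3) by (rule lipschitz_negligible_subset) (simp add: Y'_def)
  let ?w = "\<lambda>y i. h (it i x) - h (it i y)" and ?D = "\<lambda>y i j. hs j (it i x) - hs j (it i y)"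
  have A: "negligible {a :: real ^ 'm. \<exists>y\<in>Y'. \<forall>i. ?w y i + (\<Sum>j\<in>UNIV. a $ j * ?D y i j) = 0}" (is "negligible ?A")
  proof (rule negligible_zero_parameters[where w = ?w and D = ?D, OF LN])
    fix y0 assume y0: "y0 \<in> Y'"
    then have y0M: "y0 \<in> M" and y0O: "y0 \<notin> Ob" using Y(2) by (auto simp: Y'_def)
    obtain W B where W: "open W" "y0 \<in> W" "B \<ge> 0" "\<forall>y\<in>W \<inter> M. \<forall>z\<in>W \<inter> M.
      (\<forall>i. \<bar>h (it i y) - h (it i z)\<bar> \<le> B * norm (y - z)) \<and>
      (\<forall>i j. \<bar>hs j (it i y) - hs j (it i z)\<bar> \<le> B * norm (y - z))"
      using coordinates_locally_Lipschitz[OF y0M] by blast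
    \<comment> \<open>\<open>Ob\<close> is finite, hence closed. A small ball around
      \<open>y0\<close> avoids it, and there \<open>Y'\<close> coincides with the compact set
      \<open>Y\<close>.\<close>
    have "open (W - Ob)" using W(1) Ob by (simp add: open_Diff finite_imp_closed)
    then obtain e where e: "e > 0" "cball y0 e \<subseteq> W - Ob"
      using W(2) y0O open_contains_cball by (metis DiffI)
    have "cball y0 e \<inter> Y' = cball y0 e \<inter> Y" using e(2) by (auto simp: Y'_def)
    then have comp: "compact (cball y0 e \<inter> Y')" using Y(1) by (simp add: closed_Int_compact)
    have sub: "y \<in> W \<inter> M" if "y \<in> cball y0 e \<inter> Y'" for y
      using that e(2) Y(2) by (auto simp: Y'_def)
    have "(\<forall>i. \<bar>?w y i - ?w z i\<bar> \<le> B * norm (y - z)) \<and> (\<forall>i j. \<bar>?D y i j - ?D z i j\<bar> \<le> B * norm (y - z))"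
      if "y \<in> cball y0 e \<inter> Y'" "z \<in> cball y0 e \<inter> Y'" for y z
    proof -
      have "y \<in> W \<inter> M" "z \<in> W \<inter> M" using sub that by auto
      then have "\<bar>h (it i z) - h (it i y)\<bar> \<le> B * norm (z - y)" "\<bar>hs j (it i z) - hs j (it i y)\<bar> \<le> B * norm (z - y)" for i j
        using W(4) by blast+
      then show ?thesis by (simp add: norm_minus_commute)
    qed
    then show "\<exists>e>0. \<exists>B\<ge>0. compact (cball y0 e \<inter> Y') \<and>
        (\<forall>y\<in>cball y0 e \<inter> Y'. \<forall>z\<in>cball y0 e \<inter> Y'. (\<forall>i. \<bar>?w y i - ?w z i\<bar> \<le> B * norm (y - z)) \<and>
          (\<forall>i j. \<bar>?D y i j - ?D z i j\<bar> \<le> B * norm (y - z)))"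
      using e(1) W(3) comp by (intro exI[of _ e] exI[of _ B] conjI ballI) auto
  next
    fix y0 l assume "y0 \<in> Y'"
    then have y0M: "y0 \<in> M" and y0O: "y0 \<notin> Ob" using Y(2) by (auto simp: Y'_def)
    show "\<exists>c. \<forall>i. (\<Sum>j\<in>UNIV. c j * ?D y0 i j) = (if i = l then 1 else 0)"
    proof -
      \<comment> \<open>The polynomial has to be \<open>1\<close> at \<open>it l x\<close> and
        \<open>0\<close> at the other \<open>k - 1\<close> iterates of \<open>x\<close> and the
        \<open>k\<close> iterates of \<open>y0\<close>: at most \<open>2k - 1\<close> zeros. That
        \<open>it l x\<close> is not among them uses the distinct iterates of \<open>x\<close> and
        \<open>y0 \<notin> Ob\<close>.\<close>
      let ?Q = "(\<lambda>i. it i x) ` (UNIV - {l}) \<union> (\<lambda>i. it i y0) ` UNIV"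
      have "card ?Q \<le> card (UNIV - {l} :: 'k set) + card (UNIV :: 'k set)"
        by (intro order_trans[OF card_Un_le] add_mono card_image_le) auto
      also have "\<dots> = 2 * CARD('k) - 1"
        using zero_less_card_finite[where 'a = 'k] by (simp add: card_Diff_singleton del: zero_less_card_finite)
      finally have "card ?Q \<le> 2 * CARD('k) - 1" .
      moreover have "it l x \<notin> ?Q"
      proof
        assume "it l x \<in> ?Q"
        then consider i where "i \<noteq> l" "it l x = it i x" | i where "it i y0 = it l x" by auto
        then show False
          by cases (use x(2) y0O y0M in \<open>auto simp: Ob_def inj_def\<close>)
      qed
      ultimately obtain c where c: "(\<Sum>j\<in>UNIV. c j * hs j (it l x)) = 1" "\<forall>q\<in>?Q. (\<Sum>j\<in>UNIV. c j * hs j q) = 0"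
        using interpolation_coeffs[of ?Q "it l x"] by auto
      have "(\<Sum>j\<in>UNIV. c j * ?D y0 i j) = (if i = l then 1 else 0)" for i
      proof -
        have "(\<Sum>j\<in>UNIV. c j * ?D y0 i j) = (\<Sum>j\<in>UNIV. c j * hs j (it i x)) - (\<Sum>j\<in>UNIV. c j * hs j (it i y0))"
          by (simp add: right_diff_distrib sum_subtractf)
        also have "(\<Sum>j\<in>UNIV. c j * hs j (it i y0)) = 0" using c(2) by blast
        also have "(\<Sum>j\<in>UNIV. c j * hs j (it i x)) = (if i = l then 1 else 0)" using c by auto
        finally show ?thesis by simp
      qed
      then show ?thesis by blast
    qed
  qed
  have B: "negligible (\<Union>y\<in>Ob - {x}. {a. \<phi> a x = \<phi> a y})" (is "negligible ?B")
    using Ob x(1) by (intro negligible_countable_Union[OF countable_finite])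
      (auto simp: Ob_def intro!: negligible_equal_delay)
  show ?thesis
  proof (rule negligible_subset[OF negligible_Un[OF A B]], intro subsetI)
    fix a assume "a \<in> {a. \<exists>y\<in>Y - {x}. \<phi> a x = \<phi> a y}"
    then obtain y where y: "y \<in> Y" "y \<noteq> x" "\<phi> a x = \<phi> a y" by blast
    show "a \<in> ?A \<union> ?B"
    proof (cases "y \<in> Ob")
      case True
      then show ?thesis using y by blast
    next
      case False
      then have "y \<in> Y'" using y by (simp add: Y'_def)
      moreover have "?w y i + (\<Sum>j\<in>UNIV. a $ j * ?D y i j) = 0" for i
        unfolding \<phi>_diff_nth[symmetric] using y(3) by simp
      ultimately have "a \<in> ?A" by blast
      then show ?thesis by blast
    qed
  qed
qed

end

section \<open>Immersivity at a fixed point\<close>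

lemma has_derivative_vec:
  fixes f :: "'a::real_normed_vector \<Rightarrow> real ^ 'k"
  assumes "\<And>i. ((\<lambda>x. f x $ i) has_derivative (\<lambda>u. f' u $ i)) (at x)"
  shows "(f has_derivative f') (at x)"
  using assms unfolding has_derivative_componentwise_within[of f]
  by (auto simp: Basis_vec_def inner_axis)

context delay_system
begin

text \<open>The vectors \<open>v i\<close> at different nodes are unrelated; this causes no trouble
  since the Hermite polynomial has zero derivative in every direction at the nodes with
  \<open>i \<noteq> l\<close>.\<close>

lemma hermite_coeffs:
  assumes x: "inj (\<lambda>i. it i x)" and v: "v l \<noteq> 0"
  shows "\<exists>c. \<forall>i. (\<Sum>j\<in>UNIV. c j * frechet_derivative (hs j) (at (it i x)) (v i)) = (if i = l then 1 else 0)"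
proof -
  obtain p where p: "p \<in> polys_degree_le (2 * CARD('k) - 1)"
    "\<And>i. (p has_derivative (\<lambda>u. if i = l then (v l \<bullet> u) / (v l \<bullet> v l) else 0)) (at (it i x))"
    using polys_degree_le_hermite[OF x v] by metis
  obtain c where c: "p = (\<lambda>x. \<Sum>j\<in>UNIV. c j * hs j x)" using poly_coeffs[OF p(1)] by blast
  have "(\<Sum>j\<in>UNIV. c j * frechet_derivative (hs j) (at (it i x)) (v i)) = (if i = l then 1 else 0)" for i
  proof -
    have "(hs j has_derivative frechet_derivative (hs j) (at (it i x))) (at (it i x))" for j
      using C_on_has_derivative[OF C_hs open_UNIV order_refl UNIV_I] .
    then have "(p has_derivative (\<lambda>u. \<Sum>j\<in>UNIV. c j * frechet_derivative (hs j) (at (it i x)) u)) (at (it i x))"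
      unfolding c by (intro has_derivative_sum has_derivative_mult_right)
    from has_derivative_unique[OF this p(2)[of i]]
    have "(\<Sum>j\<in>UNIV. c j * frechet_derivative (hs j) (at (it i x)) (v i)) =
        (if i = l then (v l \<bullet> v i) / (v l \<bullet> v l) else 0)"
      by (rule fun_cong)
    then show ?thesis using v by auto
  qed
  then show ?thesis by blast
qed

text \<open>In a chart the delay map becomes a map \<open>\<Phi>\<close> whose derivative
  \<open>A a\<close> is affine in \<open>a\<close>. Outside the parameters for which
  \<open>A a\<close> kills a unit vector of \<open>L\<close>, it is bounded below on
  \<open>L\<close>, and this carries over to \<open>\<phi> a\<close> near \<open>x\<close>.\<close>

lemma negligible_nonimmersive:
  assumes x: "x \<in> M" "inj (\<lambda>i. it i x)" and d: "d \<le> CARD('k)"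
  shows "negligible {a. \<not> (\<exists>V c. open V \<and> x \<in> V \<and> (\<forall>y\<in>V \<inter> M. norm (x - y) \<le> c * norm (\<phi> a x - \<phi> a y)))}"
proof -
  obtain W W' \<psi> \<zeta> and L :: "(real ^ 'n) set" where xW: "x \<in> W" and chart: "submanifold_chart r d M W W' \<psi> \<zeta> L"
    using embedded_submanifold_chart[OF submanifold_M x(1)] by blast
  from chart[unfolded submanifold_chart_def] have c: "open W" "open W'" "C_on r \<psi> W" "C_on r \<zeta> W'"
    "subspace L" "dim L = d" "\<psi> ` W \<subseteq> W'" "\<zeta> ` W' \<subseteq> W"
    "\<forall>y\<in>W. \<zeta> (\<psi> y) = y" "\<forall>z\<in>W'. \<psi> (\<zeta> z) = z"
    "\<forall>y\<in>W. \<psi> y \<in> L \<longleftrightarrow> y \<in> M"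
    by blast+
  define z0 where "z0 = \<psi> x"
  have z0: "z0 \<in> W'" "z0 \<in> L" "\<zeta> z0 = x"
    using xW x(1) c(7,9,11) by (auto simp: z0_def)
  have \<zeta>M: "\<zeta> z \<in> M" if "z \<in> W' \<inter> L" for z
    using that c(8,10,11) by (metis IntE image_subset_iff)
  have \<zeta>P: "\<zeta> ` (W' \<inter> L) \<subseteq> M" using \<zeta>M by blast
  have C\<zeta>: "C_on r \<zeta> (W' \<inter> L)" using c(4) by (rule C_on_subset) simp
  have z0P: "z0 \<in> W' \<inter> L" using z0 by simp
  \<comment> \<open>The iterates and \<open>h\<close> are smooth only along \<open>M\<close>, so
    their compositions with \<open>\<zeta>\<close> are extended from \<open>W' \<inter> L\<close> to
    open sets. The polynomials \<open>hs j\<close> are defined everywhere and are simply composed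
    with the extension \<open>E i\<close>.\<close>
  have "\<forall>i. \<exists>O'. \<exists>F. open O' \<and> z0 \<in> O' \<and> C_on r F O' \<and> (\<forall>z\<in>O' \<inter> (W' \<inter> L). F z = it i (\<zeta> z))"
    using C_on_extension[OF C_on_compose[OF C\<zeta> C_it \<zeta>P] z0P] by blast
  from choice[OF this] obtain OE where "\<forall>i. \<exists>F. open (OE i) \<and> z0 \<in> OE i \<and> C_on r F (OE i) \<and>
    (\<forall>z\<in>OE i \<inter> (W' \<inter> L). F z = it i (\<zeta> z))" ..
  from choice[OF this] obtain E where E: "\<And>i. open (OE i)" "\<And>i. z0 \<in> OE i" "\<And>i. C_on r (E i) (OE i)"
    "\<And>i z. z \<in> OE i \<inter> (W' \<inter> L) \<Longrightarrow> E i z = it i (\<zeta> z)" by blast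
  have "\<forall>i. \<exists>O'. \<exists>F. open O' \<and> z0 \<in> O' \<and> C_on r F O' \<and> (\<forall>z\<in>O' \<inter> (W' \<inter> L). F z = h (it i (\<zeta> z)))"
    using C_on_extension[OF C_on_compose[OF C\<zeta> C_h_it \<zeta>P] z0P] by blast
  from choice[OF this] obtain OH where "\<forall>i. \<exists>F. open (OH i) \<and> z0 \<in> OH i \<and> C_on r F (OH i) \<and>
    (\<forall>z\<in>OH i \<inter> (W' \<inter> L). F z = h (it i (\<zeta> z)))" ..
  from choice[OF this] obtain H where H: "\<And>i. open (OH i)" "\<And>i. z0 \<in> OH i" "\<And>i. C_on r (H i) (OH i)"
    "\<And>i z. z \<in> OH i \<inter> (W' \<inter> L) \<Longrightarrow> H i z = h (it i (\<zeta> z))" by blast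
  define v where "v i = frechet_derivative (E i) (at z0)" for i
  define w where "w i = frechet_derivative (H i) (at z0)" for i
  define D where "D i j u = frechet_derivative (hs j) (at (it i x)) (v i u)" for i j u
  have Ez0: "E i z0 = it i x" for i using E(2,4) z0 by auto
  have derE: "(E i has_derivative v i) (at z0)" for i
    unfolding v_def by (rule C_on_has_derivative[OF E(3,1) r E(2)])
  have derH: "(H i has_derivative w i) (at z0)" for i
    unfolding w_def by (rule C_on_has_derivative[OF H(3,1) r H(2)])
  have derhs: "((\<lambda>z. hs j (E i z)) has_derivative D i j) (at z0)" for i j
    unfolding D_def
    by (rule has_derivative_compose[OF derE], unfold Ez0)
      (rule C_on_has_derivative[OF C_hs open_UNIV order_refl UNIV_I])
  \<comment> \<open>On \<open>L\<close> near \<open>z0\<close>, applying the left inverse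
    \<open>S\<close> of the iterate and then \<open>\<psi>\<close> recovers \<open>z\<close> from
    \<open>E i z\<close>; both maps are locally Lipschitz.\<close>
  have v_nz: "v i u \<noteq> 0" if u: "u \<in> L" "u \<noteq> 0" for i u
  proof -
    obtain S where S: "C_on r S M" "\<forall>y\<in>M. S ((T ^^ idx i) y) = y" using funpow_left_inverse by blast
    obtain W1 B1 where W1: "open W1" "it i x \<in> W1" "B1 \<ge> 0"
      "\<forall>y\<in>W1 \<inter> M. \<forall>z\<in>W1 \<inter> M. norm (S y - S z) \<le> B1 * norm (y - z)"
      using C_on_imp_locally_Lipschitz[OF S(1) r it_mem[OF x(1), of i]] by blast
    obtain W2 B2 where W2: "open W2" "x \<in> W2" "B2 \<ge> 0"
      "\<forall>y\<in>W2 \<inter> W. \<forall>z\<in>W2 \<inter> W. norm (\<psi> y - \<psi> z) \<le> B2 * norm (y - z)"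
      using C_on_imp_locally_Lipschitz[OF c(3) r xW] by blast
    define V where "V = (OE i \<inter> E i -` W1) \<inter> (W' \<inter> \<zeta> -` W2)"
    have oV: "open V"
      unfolding V_def
      by (intro open_Int continuous_open_preimage C_on_imp_continuous_on[OF E(3)]
          C_on_imp_continuous_on[OF c(4)] E(1) c(2) W1(1) W2(1))
    have z0V: "z0 \<in> V" using z0 E(2) W1(2) W2(2) Ez0 by (simp add: V_def)
    have "norm u \<le> (B2 * B1) * norm (v i u)"
    proof (rule has_derivative_lower_bound[OF derE c(5) z0(2) oV z0V _ _ u(1)])
      fix z assume z: "z \<in> V" "z \<in> L"
      then have zP: "z \<in> W' \<inter> L" "E i z = it i (\<zeta> z)" "\<zeta> z \<in> W2 \<inter> W" "it i (\<zeta> z) \<in> W1"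
        using E(4)[of z i] c(8) by (auto simp: V_def)
      have "norm (z - z0) = norm (\<psi> (\<zeta> z) - \<psi> x)" using c(10) zP(1) by (simp add: z0_def)
      also have "\<dots> \<le> B2 * norm (\<zeta> z - x)" using W2(2,4) zP(3) xW by blast
      also have "norm (\<zeta> z - x) = norm (S (it i (\<zeta> z)) - S (it i x))"
        using S(2) \<zeta>M[OF zP(1)] x(1) by (simp add: it_def)
      also have "B2 * \<dots> \<le> B2 * (B1 * norm (it i (\<zeta> z) - it i x))"
        using W1(2,4) W2(3) zP(4) it_mem \<zeta>M[OF zP(1)] x(1) by (intro mult_left_mono) auto
      finally show "norm (z - z0) \<le> (B2 * B1) * norm (E i z - E i z0)"
        by (simp add: zP(2) Ez0 mult.assoc)
    qed (use W1(3) W2(3) in simp)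
    then show ?thesis using u(2) by auto
  qed
  define A where "A a u = (\<chi> i. w i u + (\<Sum>j\<in>UNIV. a $ j * D i j u))" for a :: "real ^ 'm" and u
  have linw: "bounded_linear (w i)" for i by (rule has_derivative_bounded_linear[OF derH])
  have linD: "bounded_linear (D i j)" for i j by (rule has_derivative_bounded_linear[OF derhs])
  have null: "negligible {a :: real ^ 'm. \<exists>u\<in>L \<inter> sphere 0 1. \<forall>i. w i u + (\<Sum>j\<in>UNIV. a $ j * D i j u) = 0}"
  proof (rule negligible_zero_parameters[where w = "\<lambda>u i. w i u" and D = "\<lambda>u i j. D i j u"])
    show "lipschitz_negligible TYPE('k) (L \<inter> sphere 0 1)"
      by (rule lipschitz_negligible_subspace_sphere[OF c(5)]) (use c(6) d in simp)
  next
    fix u l assume u: "u \<in> L \<inter> sphere 0 1"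
    then show "\<exists>c. \<forall>i. (\<Sum>j\<in>UNIV. c j * D i j u) = (if i = l then 1 else 0)"
      unfolding D_def by (intro hermite_coeffs x(2) v_nz) auto
  next
    fix u0 assume u0: "u0 \<in> L \<inter> sphere 0 1"
    \<comment> \<open>\<open>w i\<close> and \<open>D i j\<close> are linear in \<open>u\<close>, so
      the sum of all operator norms is a common global Lipschitz constant.\<close>
    define B where "B = (\<Sum>i\<in>UNIV. onorm (w i)) + (\<Sum>i\<in>UNIV. \<Sum>j\<in>UNIV. onorm (D i j))"
    have nnw: "onorm (w i) \<ge> 0" for i by (rule onorm_pos_le[OF linw])
    have nnD: "onorm (D i j) \<ge> 0" for i j by (rule onorm_pos_le[OF linD])
    have B: "B \<ge> 0" unfolding B_def by (intro add_nonneg_nonneg sum_nonneg nnw nnD)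
    have "onorm (w i) \<le> (\<Sum>i\<in>UNIV. onorm (w i))" for i by (rule member_le_sum) (auto intro: nnw)
    then have wB: "onorm (w i) \<le> B" for i
      unfolding B_def by (rule order_trans) (simp add: sum_nonneg nnD)
    have "onorm (D i j) \<le> (\<Sum>j\<in>UNIV. onorm (D i j))" for i j by (rule member_le_sum) (auto intro: nnD)
    also have "(\<Sum>j\<in>UNIV. onorm (D i j)) \<le> (\<Sum>i\<in>UNIV. \<Sum>j\<in>UNIV. onorm (D i j))" for i
      by (rule member_le_sum) (auto intro: sum_nonneg nnD)
    finally have DB: "onorm (D i j) \<le> B" for i j
      unfolding B_def by (rule order_trans) (simp add: sum_nonneg nnw)
    have "\<bar>w i y - w i z\<bar> \<le> B * norm (y - z)" "\<bar>D i j y - D i j z\<bar> \<le> B * norm (y - z)" for i j y z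
      using order_trans[OF onorm[OF linw, of i "y - z"] mult_right_mono[OF wB norm_ge_zero]]
        order_trans[OF onorm[OF linD, of i j "y - z"] mult_right_mono[OF DB norm_ge_zero]]
      by (simp_all add: linear_diff[OF bounded_linear.linear] linw linD)
    moreover have "compact (cball u0 1 \<inter> (L \<inter> sphere 0 1))"
      using closed_subspace[OF c(5)] by (simp add: closed_Int_compact compact_Int_closed Int_assoc)
    ultimately show "\<exists>e>0. \<exists>B\<ge>0. compact (cball u0 e \<inter> (L \<inter> sphere 0 1)) \<and>
        (\<forall>y\<in>cball u0 e \<inter> (L \<inter> sphere 0 1). \<forall>z\<in>cball u0 e \<inter> (L \<inter> sphere 0 1).
          (\<forall>i. \<bar>w i y - w i z\<bar> \<le> B * norm (y - z)) \<and> (\<forall>i j. \<bar>D i j y - D i j z\<bar> \<le> B * norm (y - z)))"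
      using B by (intro exI[of _ "1::real"] exI[of _ B] conjI ballI allI) simp_all
  qed
  show ?thesis
  proof (rule negligible_subset[OF null], rule subsetI, rule ccontr)
    fix a assume a: "a \<in> {a. \<not> (\<exists>V c. open V \<and> x \<in> V \<and> (\<forall>y\<in>V \<inter> M. norm (x - y) \<le> c * norm (\<phi> a x - \<phi> a y)))}"
      and nz: "a \<notin> {a :: real ^ 'm. \<exists>u\<in>L \<inter> sphere 0 1. \<forall>i. w i u + (\<Sum>j\<in>UNIV. a $ j * D i j u) = 0}"
    define \<Phi> where "\<Phi> z = (\<chi> i. H i z + (\<Sum>j\<in>UNIV. a $ j * hs j (E i z)))" for z
    have der\<Phi>: "(\<Phi> has_derivative A a) (at z0)"
      by (rule has_derivative_vec) (simp add: \<Phi>_def A_def has_derivative_add[OF derH has_derivative_sum[OF has_derivative_mult_right[OF derhs]]])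
    have linA: "bounded_linear (A a)" by (rule has_derivative_bounded_linear[OF der\<Phi>])
    have "A a u \<noteq> 0" if u: "u \<in> L" "u \<noteq> 0" for u
    proof
      assume A0: "A a u = 0"
      let ?u = "(1 / norm u) *\<^sub>R u"
      have "A a ?u = 0" using A0 linear_scale[OF bounded_linear.linear[OF linA]] by simp
      then have "\<forall>i. w i ?u + (\<Sum>j\<in>UNIV. a $ j * D i j ?u) = 0"
        by (simp add: A_def vec_eq_iff)
      moreover have "?u \<in> L \<inter> sphere 0 1" using u c(5) by (simp add: subspace_scale)
      ultimately show False using nz by blast
    qed
    then obtain b where b: "b > 0" "\<forall>u\<in>L. b * norm u \<le> norm (A a u)"
      using injective_imp_isometric[OF closed_subspace[OF c(5)] c(5) linA] by (metis mult.commute)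
    \<comment> \<open>The remainder may consume half of the lower bound \<open>b\<close>; the other
      half bounds \<open>\<Phi> z - \<Phi> z0\<close> from below.\<close>
    obtain e where e: "e > 0" "\<And>z. norm (z - z0) < e \<Longrightarrow> norm (\<Phi> z - \<Phi> z0 - A a (z - z0)) \<le> b/2 * norm (z - z0)"
      using der\<Phi> b(1) unfolding has_derivative_at_alt by (meson half_gt_zero)
    obtain W3 B3 where W3: "open W3" "z0 \<in> W3" "B3 \<ge> 0"
      "\<forall>y\<in>W3 \<inter> W'. \<forall>z\<in>W3 \<inter> W'. norm (\<zeta> y - \<zeta> z) \<le> B3 * norm (y - z)"
      using C_on_imp_locally_Lipschitz[OF c(4) r z0(1)] by blast
    define N where "N = ball z0 e \<inter> W3 \<inter> (\<Inter>i. OE i \<inter> OH i)"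
    have N: "open N" "z0 \<in> N"
      unfolding N_def using e(1) W3(1,2) E(1,2) H(1,2) by (auto intro!: open_Int open_INT)
    define V where "V = W \<inter> \<psi> -` N"
    have V: "open V" "x \<in> V"
      using continuous_open_preimage[OF C_on_imp_continuous_on[OF c(3)] c(1) N(1)] N(2) xW
      by (auto simp: V_def z0_def)
    have \<Phi>_eq: "\<Phi> z = \<phi> a (\<zeta> z)" if "z \<in> N" "z \<in> W'" "z \<in> L" for z
    proof -
      have "z \<in> OE i \<inter> (W' \<inter> L)" "z \<in> OH i \<inter> (W' \<inter> L)" for i using that by (auto simp: N_def)
      then have "E i z = it i (\<zeta> z)" "H i z = h (it i (\<zeta> z))" for i using E(4) H(4) by blast+
      then show ?thesis by (simp add: vec_eq_iff[of _ "\<phi> a (\<zeta> z)"] \<Phi>_def \<phi>_nth)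
    qed
    have "norm (x - y) \<le> (2 * B3 / b) * norm (\<phi> a x - \<phi> a y)" if y: "y \<in> V \<inter> M" for y
    proof -
      define z where "z = \<psi> y"
      have z: "z \<in> N" "z \<in> W'" "z \<in> L" "\<zeta> z = y"
        using y c(7,9,11) by (auto simp: V_def z_def)
      have "norm (z - z0) < e" using z(1) by (simp add: N_def dist_norm norm_minus_commute)
      from e(2)[OF this] have "norm (A a (z - z0)) - b/2 * norm (z - z0) \<le> norm (\<Phi> z - \<Phi> z0)"
        using norm_triangle_ineq3[of "\<Phi> z - \<Phi> z0" "A a (z - z0)"] by simp
      moreover have "b * norm (z - z0) \<le> norm (A a (z - z0))"
        using b(2) z(3) z0(2) c(5) by (simp add: subspace_diff)
      ultimately have "b * norm (z - z0) \<le> 2 * norm (\<Phi> z - \<Phi> z0)" by simp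
      also have "\<Phi> z - \<Phi> z0 = \<phi> a y - \<phi> a x"
        using \<Phi>_eq[OF z(1-3)] \<Phi>_eq[OF N(2) z0(1,2)] z(4) z0(3) by simp
      finally have 1: "norm (z - z0) \<le> 2 / b * norm (\<phi> a x - \<phi> a y)"
        using b(1) by (simp add: field_simps norm_minus_commute)
      have "norm (\<zeta> z0 - \<zeta> z) \<le> B3 * norm (z0 - z)" using W3(2,4) z(1,2) z0(1) by (simp add: N_def)
      also have "\<dots> \<le> B3 * (2 / b * norm (\<phi> a x - \<phi> a y))"
        using 1 W3(3) by (intro mult_left_mono) (simp_all add: norm_minus_commute)
      finally show ?thesis using z(4) z0(3) by (simp add: mult_ac)
    qed
    then show False using a V by blast
  qed
qed

end

section \<open>Lipschitz inverses: from a fixed point to almost every point\<close>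

context delay_system
begin

text \<open>Near \<open>x\<close> the immersion estimate applies. Away from \<open>x\<close>,
  compactness of \<open>Y - V\<close> and injectivity keep the image distance above some
  \<open>m > 0\<close>, while \<open>norm (x - y)\<close> is at most a bound \<open>b\<close> on
  \<open>M\<close>; so \<open>\<bar>c\<bar> + b / m\<close> serves everywhere.\<close>

lemma negligible_not_Lipschitz_at:
  assumes x: "x \<in> M" "inj (\<lambda>i. it i x)" and d: "d \<le> CARD('k)"
    and Y: "compact Y" "Y \<subseteq> M" "lipschitz_negligible TYPE('k) Y"
  shows "negligible {a. \<not> (\<exists>C\<ge>0. \<forall>y\<in>Y. norm (x - y) \<le> C * norm (\<phi> a x - \<phi> a y))}"
proof (rule negligible_subset[OF negligible_Un[OF negligible_nonimmersive[OF x d] negligible_noninjective[OF x Y]]],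
    rule subsetI, rule ccontr)
  fix a
  assume a: "a \<in> {a. \<not> (\<exists>C\<ge>0. \<forall>y\<in>Y. norm (x - y) \<le> C * norm (\<phi> a x - \<phi> a y))}"
    and not: "a \<notin> {a. \<not> (\<exists>V c. open V \<and> x \<in> V \<and> (\<forall>y\<in>V \<inter> M. norm (x - y) \<le> c * norm (\<phi> a x - \<phi> a y)))}
      \<union> {a. \<exists>y\<in>Y - {x}. \<phi> a x = \<phi> a y}"
  then obtain V c where V: "open V" "x \<in> V" "\<forall>y\<in>V \<inter> M. norm (x - y) \<le> c * norm (\<phi> a x - \<phi> a y)"
    and inj: "\<forall>y\<in>Y - {x}. \<phi> a x \<noteq> \<phi> a y" by blast
  have comp: "compact (Y - V)" using Y(1) V(1) by (rule compact_diff)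
  have "\<exists>m>0. \<forall>y\<in>Y - V. m \<le> norm (\<phi> a x - \<phi> a y)"
  proof (cases "Y - V = {}")
    case False
    have "continuous_on (Y - V) (\<phi> a)"
      using C_on_imp_continuous_on[OF C_\<phi>] by (rule continuous_on_subset) (use Y(2) in blast)
    then have "continuous_on (Y - V) (\<lambda>y. norm (\<phi> a x - \<phi> a y))"
      by (intro continuous_intros)
    from continuous_attains_inf[OF comp False this]
    obtain y0 where y0: "y0 \<in> Y - V" "\<forall>y\<in>Y - V. norm (\<phi> a x - \<phi> a y0) \<le> norm (\<phi> a x - \<phi> a y)" by blast
    then have "norm (\<phi> a x - \<phi> a y0) > 0" using inj V(2) by auto
    then show ?thesis using y0(2) by blast
  qed (auto intro: exI[of _ 1])
  then obtain m where m: "m > 0" "\<forall>y\<in>Y - V. m \<le> norm (\<phi> a x - \<phi> a y)" by blast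
  obtain b where b: "\<forall>y\<in>M. norm (x - y) \<le> b"
    using compact_imp_bounded[OF compact_M] unfolding bounded_any_center[of M x] dist_norm
    by (auto simp: norm_minus_commute)
  have b0: "b \<ge> 0" using b x(1) norm_ge_zero order_trans by blast
  have "norm (x - y) \<le> (\<bar>c\<bar> + b / m) * norm (\<phi> a x - \<phi> a y)" if y: "y \<in> Y" for y
  proof (cases "y \<in> V")
    case True
    then have "norm (x - y) \<le> c * norm (\<phi> a x - \<phi> a y)" using V(3) y Y(2) by blast
    also have "\<dots> \<le> (\<bar>c\<bar> + b / m) * norm (\<phi> a x - \<phi> a y)"
      using b0 m(1) by (intro mult_right_mono) (auto intro: order_trans[OF abs_ge_self])
    finally show ?thesis .
  next
    case False
    have "norm (x - y) \<le> b" using b y Y(2) by blast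
    also have "b = b / m * m" using m(1) by simp
    also have "\<dots> \<le> b / m * norm (\<phi> a x - \<phi> a y)"
      using m False y b0 by (intro mult_left_mono) auto
    also have "\<dots> \<le> (\<bar>c\<bar> + b / m) * norm (\<phi> a x - \<phi> a y)"
      by (intro mult_right_mono) auto
    finally show ?thesis .
  qed
  moreover have "\<bar>c\<bar> + b / m \<ge> 0" using b0 m(1) by simp
  ultimately show False using a by blast
qed

text \<open>If two of the first \<open>k\<close> iterates of \<open>x\<close> coincide, injectivity
  of \<open>T\<close> cancels the earlier one and leaves a period between \<open>1\<close> and
  \<open>k - 1\<close>.\<close>

lemma AE_distinct_orbit:
  fixes \<mu> :: "(real ^ 'n) measure"
  assumes X: "compact X" "X \<subseteq> M" and \<mu>: "sets \<mu> = sets (restrict_space borel X)"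
    and Per: "emeasure \<mu> (X \<inter> (\<Union>j\<in>{1..CARD('k) - 1}. Per M T j)) = 0"
  shows "AE x in \<mu>. inj (\<lambda>i. it i x)"
proof -
  \<comment> \<open>\<open>emeasure\<close> is \<open>0\<close> by default on nonmeasurable sets, so
    the hypothesis yields a null set only after measurability, here closedness, is shown.\<close>
  have "closed (Per M T j)" for j
  proof -
    have "continuous_on M (\<lambda>x. (T ^^ j) x - x)"
      by (intro continuous_intros C_on_imp_continuous_on[OF C_funpow])
    from continuous_closed_preimage_constant[OF this compact_imp_closed[OF compact_M], of 0]
    show ?thesis by (simp add: Per_def)
  qed
  then have "closed (X \<inter> (\<Union>j\<in>{1..CARD('k) - 1}. Per M T j))"
    using compact_imp_closed[OF X(1)] by (intro closed_Int closed_UN) auto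
  then have "X \<inter> (\<Union>j\<in>{1..CARD('k) - 1}. Per M T j) \<in> sets (restrict_space borel X)"
    using X(1) by (subst sets_restrict_space_iff) (auto intro: borel_closed compact_imp_closed)
  then have null: "X \<inter> (\<Union>j\<in>{1..CARD('k) - 1}. Per M T j) \<in> null_sets \<mu>"
    using Per \<mu> by (intro null_setsI) auto
  have space: "space \<mu> = X" using sets_eq_imp_space_eq[OF \<mu>] by (simp add: space_restrict_space)
  have idx: "idx i < CARD('k)" "idx i = idx l \<Longrightarrow> i = l" for i l
    using bij_idx by (auto simp: bij_betw_def inj_def)
  have *: "x \<in> (\<Union>j\<in>{1..CARD('k) - 1}. Per M T j)" if x: "x \<in> M" "it i x = it l x" "idx i < idx l" for x i l
  proof -
    define j where "j = idx l - idx i"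
    have "idx l = idx i + j" using x(3) by (simp add: j_def)
    then have "(T ^^ idx i) x = (T ^^ idx i) ((T ^^ j) x)"
      using x(2) by (simp add: it_def funpow_add)
    then have "x = (T ^^ j) x"
      by (rule funpow_inj[OF x(1) funpow_mem[OF x(1)]])
    moreover have "j \<in> {1..CARD('k) - 1}" using x(3) idx(1)[of l] by (auto simp: j_def)
    ultimately show ?thesis using x(1) by (intro UN_I[of j]) (simp_all add: Per_def)
  qed
  show ?thesis
  proof (rule AE_I'[OF null], safe)
    fix x assume x: "x \<in> space \<mu>" "\<not> inj (\<lambda>i. it i x)"
    then show xX: "x \<in> X" by (simp add: space)
    obtain i l where il: "it i x = it l x" "i \<noteq> l" using x(2) by (auto simp: inj_def)
    then have "idx i < idx l \<or> idx l < idx i" using idx(2) nat_neq_iff by blast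
    then show "x \<in> (\<Union>j\<in>{1..CARD('k) - 1}. Per M T j)"
      using * il(1) xX X(2) by (metis subsetD)
  qed
qed

text \<open>For almost every \<open>x\<close> almost every \<open>a\<close> is good; exchanging the
  quantifiers needs a measurable set of good pairs.\<close>

lemma AE_Lipschitz_inverse:
  fixes \<mu> :: "(real ^ 'n) measure"
  assumes X: "compact X" "X \<subseteq> M" and "prob_space \<mu>" and \<mu>: "sets \<mu> = sets (restrict_space borel X)"
    and Per: "emeasure \<mu> (X \<inter> (\<Union>j\<in>{1..CARD('k) - 1}. Per M T j)) = 0"
    and d: "d \<le> CARD('k)" and Y: "compact Y" "Y \<subseteq> M" "lipschitz_negligible TYPE('k) Y"
  shows "AE a in lebesgue. AE x in \<mu>. \<exists>C\<ge>0. \<forall>y\<in>Y. norm (x - y) \<le> C * norm (\<phi> a x - \<phi> a y)"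
proof -
  interpret \<mu>: prob_space \<mu> by fact
  interpret P: pair_sigma_finite \<mu> "lborel :: (real ^ 'm) measure" ..
  let ?P = "\<lambda>x a. \<exists>C\<ge>0. \<forall>y\<in>Y. norm (x - y) \<le> C * norm (\<phi> a x - \<phi> a y)"
  have space: "space \<mu> = X" using sets_eq_imp_space_eq[OF \<mu>] by (simp add: space_restrict_space)
  \<comment> \<open>The constant \<open>C\<close> may be rounded up to a natural number. For fixed
    \<open>n\<close> the condition is closed for each \<open>y\<close>, so the intersection over the
    uncountable set \<open>Y\<close> remains closed.\<close>
  define K where "K n = {p \<in> X \<times> UNIV. \<forall>y\<in>Y. norm (fst p - y) \<le> real n * norm (\<phi> (snd p) (fst p) - \<phi> (snd p) y)}" for n :: nat
  have P_iff: "?P x a \<longleftrightarrow> (\<exists>n. (x, a) \<in> K n)" if "x \<in> X" for x a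
  proof
    assume "?P x a"
    then obtain C where C: "\<forall>y\<in>Y. norm (x - y) \<le> C * norm (\<phi> a x - \<phi> a y)" by blast
    obtain n where n: "C \<le> real n" using real_arch_simple by blast
    have "\<forall>y\<in>Y. norm (x - y) \<le> real n * norm (\<phi> a x - \<phi> a y)"
      using C n by (meson mult_right_mono norm_ge_zero order_trans)
    then show "\<exists>n. (x, a) \<in> K n" using that by (auto simp: K_def)
  next
    assume "\<exists>n. (x, a) \<in> K n"
    then obtain n where "\<forall>y\<in>Y. norm (x - y) \<le> real n * norm (\<phi> a x - \<phi> a y)" by (auto simp: K_def)
    then show "?P x a" by (intro exI[of _ "real n"]) simp
  qed
  have clX: "closed (X \<times> (UNIV :: (real ^ 'm) set))"
    using X(1) by (intro closed_Times compact_imp_closed closed_UNIV)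
  have c\<phi>: "continuous_on (X \<times> UNIV) (\<lambda>p. \<phi> (snd p) (fst p))"
    using continuous_on_subset[OF continuous_\<phi>, of "X \<times> UNIV"] X(2) by (auto simp: split_def)
  have cl: "closed {p \<in> X \<times> UNIV. norm (fst p - y) \<le> real n * norm (\<phi> (snd p) (fst p) - \<phi> (snd p) y)}"
    if y: "y \<in> Y" for y n
  proof -
    have "continuous_on (X \<times> UNIV) (\<lambda>p. \<phi> (snd p) y)"
    proof -
      have "(\<lambda>p. (y, snd p)) ` (X \<times> (UNIV :: (real ^ 'm) set)) \<subseteq> M \<times> UNIV" using y Y(2) by auto
      moreover have "continuous_on (X \<times> (UNIV :: (real ^ 'm) set)) (\<lambda>p. (y, snd p))"
        by (intro continuous_intros)
      ultimately show ?thesis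
        using continuous_on_compose2[OF continuous_\<phi>, of "X \<times> UNIV" "\<lambda>p. (y, snd p)"] by simp
    qed
    then have "continuous_on (X \<times> UNIV) (\<lambda>p. real n * norm (\<phi> (snd p) (fst p) - \<phi> (snd p) y) - norm (fst p - y))"
      by (intro continuous_intros c\<phi>)
    from continuous_closed_preimage[OF this clX closed_atLeast[of 0]]
    show ?thesis by (simp add: vimage_def Int_def)
  qed
  have clK: "closed (K n)" for n
  proof -
    have "K n = (X \<times> UNIV) \<inter> (\<Inter>y\<in>Y. {p \<in> X \<times> UNIV. norm (fst p - y) \<le> real n * norm (\<phi> (snd p) (fst p) - \<phi> (snd p) y)})"
      by (auto simp: K_def)
    also have "closed \<dots>" by (intro closed_Int clX closed_INT ballI cl)
    finally show ?thesis .
  qed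
  have fst: "fst \<in> borel_measurable (\<mu> \<Otimes>\<^sub>M (lborel :: (real ^ 'm) measure))"
  proof -
    have "(\<lambda>x. x) \<in> borel_measurable (restrict_space borel X)" by (rule measurable_restrict_space1) simp
    then have "(\<lambda>x. x) \<in> borel_measurable \<mu>" using measurable_cong_sets[OF \<mu> refl] by blast
    from measurable_compose[OF measurable_fst this] show ?thesis .
  qed
  \<comment> \<open>\<open>\<mu>\<close> lives on the trace of the Borel sets on \<open>X\<close>,
    so \<open>K n\<close> is pulled back from the full product space by the identity, written as a
    pair to make its measurability visible.\<close>
  have id: "(\<lambda>p. (fst p, snd p)) \<in> borel_measurable (\<mu> \<Otimes>\<^sub>M (lborel :: (real ^ 'm) measure))"
    using fst by (intro borel_measurable_Pair) auto
  have "K n \<in> sets (\<mu> \<Otimes>\<^sub>M (lborel :: (real ^ 'm) measure))" for n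
  proof -
    have "(\<lambda>p. (fst p, snd p)) -` K n \<inter> space (\<mu> \<Otimes>\<^sub>M (lborel :: (real ^ 'm) measure)) \<in> sets (\<mu> \<Otimes>\<^sub>M (lborel :: (real ^ 'm) measure))"
      by (rule measurable_sets[OF id borel_closed[OF clK]])
    also have "(\<lambda>p. (fst p, snd p)) -` K n \<inter> space (\<mu> \<Otimes>\<^sub>M (lborel :: (real ^ 'm) measure)) = K n"
      by (auto simp: space_pair_measure space K_def)
    finally show ?thesis .
  qed
  moreover have "{p \<in> space (\<mu> \<Otimes>\<^sub>M (lborel :: (real ^ 'm) measure)). ?P (fst p) (snd p)} = (\<Union>n. K n)"
  proof -
    have "p \<in> {p \<in> space (\<mu> \<Otimes>\<^sub>M (lborel :: (real ^ 'm) measure)). ?P (fst p) (snd p)} \<longleftrightarrow> p \<in> (\<Union>n. K n)" for p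
    proof (cases "fst p \<in> X")
      case True
      then show ?thesis using P_iff[OF True, of "snd p"] by (simp add: space_pair_measure space mem_Times_iff)
    qed (auto simp: space_pair_measure space K_def)
    then show ?thesis by blast
  qed
  ultimately have meas: "{p \<in> space (\<mu> \<Otimes>\<^sub>M (lborel :: (real ^ 'm) measure)). ?P (fst p) (snd p)} \<in> sets (\<mu> \<Otimes>\<^sub>M lborel)"
    by simp
  have "AE x in \<mu>. AE a in (lborel :: (real ^ 'm) measure). ?P x a"
    using AE_distinct_orbit[OF X \<mu> Per] AE_space
  proof eventually_elim
    case (elim x)
    then have "x \<in> M" using X(2) space by blast
    from negligible_not_Lipschitz_at[OF this elim(1) d Y]
    have "AE a in lebesgue. ?P x a"
      unfolding negligible_iff_null_sets by (rule AE_I') auto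
    then show ?case by (simp only: AE_completion_iff)
  qed
  then have "AE a in (lborel :: (real ^ 'm) measure). AE x in \<mu>. ?P x a"
    by (subst (asm) P.AE_commute[OF meas])
  then show ?thesis by (rule AE_completion)
qed

end

subsection \<open>Embeddings\<close>

lemma dim_kernel_projection:
  fixes q :: "'a::euclidean_space \<Rightarrow> 'a"
  assumes "linear q" "subspace L" "range q \<subseteq> L" "\<And>v. v \<in> L \<Longrightarrow> q v = v"
  shows "dim {x. q x = 0} + dim L = DIM('a)"
proof -
  have sub: "subspace {x. q x = 0}" using assms(1) by (rule linear_subspace_kernel)
  have "x \<in> {y + z |y z. y \<in> {x. q x = 0} \<and> z \<in> L}" for x
  proof -
    have "q x \<in> L" using assms(3) by blast
    then have "q (x - q x) = 0" using assms(1,4) by (simp add: linear_diff)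
    moreover have "x = (x - q x) + q x" by simp
    ultimately show ?thesis using \<open>q x \<in> L\<close> by blast
  qed
  then have 1: "{y + z |y z. y \<in> {x. q x = 0} \<and> z \<in> L} = UNIV" by blast
  have 2: "{x. q x = 0} \<inter> L = {0}" using assms by (auto simp: subspace_0 linear_0)
  show ?thesis using dim_sums_Int[OF sub assms(2)] unfolding 1 2 by simp
qed

lemma linear_injective_extension:
  fixes A :: "'a::euclidean_space \<Rightarrow> 'a"
  assumes "linear A" "subspace L" "inj_on A L"
  shows "\<exists>\<pi> G. linear \<pi> \<and> linear G \<and> range \<pi> \<subseteq> L \<and> (\<forall>v\<in>L. \<pi> v = v) \<and> inj (\<lambda>v. A (\<pi> v) + G (v - \<pi> v))"
proof -
  obtain g where g: "range g \<subseteq> L" "linear g" "\<forall>v\<in>L. g (A v) = v"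
    using linear_exists_left_inverse_on[OF assms] by blast
  obtain \<pi> where \<pi>: "range \<pi> \<subseteq> L" "linear \<pi>" "\<forall>v\<in>L. \<pi> v = v"
    using linear_exists_left_inverse_on[OF linear_ident assms(2)] by auto
  have AL: "subspace (A ` L)" using assms(1,2) by (rule linear_subspace_image)
  have "dim {x. A (g x) = 0} + dim (A ` L) = DIM('a)"
    by (rule dim_kernel_projection[OF linear_compose[OF g(2) assms(1), unfolded comp_def] AL])
      (use g in auto)
  moreover have "{x. A (g x) = 0} = {x. g x = 0}"
    using assms g(1) by (auto simp: inj_on_def linear_0 subspace_0) (metis assms(1) linear_0 rangeI subsetD subspace_0)
  moreover have "dim (A ` L) = dim L"
    using dim_image_eq[OF assms(1)] assms(2,3) by (simp add: span_eq_iff[THEN iffD2])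
  moreover have "dim {x. \<pi> x = 0} + dim L = DIM('a)"
    by (rule dim_kernel_projection[OF \<pi>(2) assms(2) \<pi>(1)]) (use \<pi>(3) in blast)
  ultimately have "dim {x. \<pi> x = 0} = dim {x. g x = 0}" by simp
  then obtain G where G: "linear G" "G ` {x. \<pi> x = 0} = {x. g x = 0}" "inj_on G {x. \<pi> x = 0}"
    using subspace_isomorphism[OF linear_subspace_kernel[OF \<pi>(2)] linear_subspace_kernel[OF g(2)]] by blast
  have lin: "linear (\<lambda>v. A (\<pi> v) + G (v - \<pi> v))"
    by (intro linear_compose_add linear_compose[OF \<pi>(2) assms(1), unfolded comp_def]
        linear_compose[OF linear_compose_sub[OF linear_ident \<pi>(2)] G(1), unfolded comp_def])
  \<comment> \<open>Applying \<open>g\<close> annihilates the \<open>G\<close> part and returns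
    \<open>\<pi> v\<close>, so \<open>\<pi> v = 0\<close>; injectivity of \<open>G\<close> on
    \<open>ker \<pi>\<close> then gives \<open>v = 0\<close>.\<close>
  have "v = 0" if v: "A (\<pi> v) + G (v - \<pi> v) = 0" for v
  proof -
    have pv: "\<pi> v \<in> L" using \<pi>(1) by blast
    then have k: "\<pi> (v - \<pi> v) = 0" using \<pi>(2,3) by (simp add: linear_diff)
    then have "g (G (v - \<pi> v)) = 0" using G(2) by blast
    moreover have "g (A (\<pi> v)) = \<pi> v" using g(3) pv by blast
    moreover have "g (A (\<pi> v) + G (v - \<pi> v)) = 0" using v g(2) by (simp add: linear_0)
    ultimately have p0: "\<pi> v = 0" using g(2) by (simp add: linear_add)
    then have "G v = G 0" using v assms(1) G(1) by (simp add: linear_0)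
    then show "v = 0" using G(3) p0 \<pi>(2) by (auto simp: inj_on_def linear_0)
  qed
  then have "inj (\<lambda>v. A (\<pi> v) + G (v - \<pi> v))" using linear_injective_0[OF lin] by blast
  then show ?thesis using \<pi> G(1) by blast
qed

text \<open>In a chart \<open>\<zeta>\<close> with model space \<open>L\<close>, identified with \<open>L' \<subseteq> \<real>\<^sup>k\<close> by \<open>J\<close>, the map \<open>\<Psi> s = f (\<zeta> (J (\<pi> s))) + G (s - \<pi> s)\<close>
  thickens \<open>f\<close> to a local diffeomorphism of \<open>\<real>\<^sup>k\<close>, whose inverse straightens \<open>f ` M\<close> to \<open>L'\<close>.\<close>

lemma embedding_if_Lipschitz_inverse_at:
  fixes f :: "real ^ 'n \<Rightarrow> real ^ 'k"
  assumes r: "1 \<le> r" and M: "compact M" "embedded_submanifold r d M" "d \<le> CARD('k)"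
    and f: "C_on r f M" and x: "x \<in> M" and c0: "c \<ge> 0"
    and inv: "\<And>y. y \<in> M \<Longrightarrow> norm (x - y) \<le> c * norm (f x - f y)"
  shows "\<exists>U V. openin (top_of_set M) U \<and> x \<in> U \<and> open V \<and> f x \<in> V \<and>
    embedded_submanifold r d (V \<inter> f ` M) \<and> C_diffeo_on r f U (V \<inter> f ` M)"
proof -
  obtain W W' \<psi> \<zeta> and L :: "(real ^ 'n) set" where xW: "x \<in> W" and chart: "submanifold_chart r d M W W' \<psi> \<zeta> L"
    using embedded_submanifold_chart[OF M(2) x] by blast
  from chart[unfolded submanifold_chart_def] have c: "open W" "open W'" "C_on r \<psi> W" "C_on r \<zeta> W'"
    "subspace L" "dim L = d" "\<psi> ` W \<subseteq> W'" "\<zeta> ` W' \<subseteq> W"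
    "\<forall>y\<in>W. \<zeta> (\<psi> y) = y" "\<forall>z\<in>W'. \<psi> (\<zeta> z) = z"
    "\<forall>y\<in>W. \<psi> y \<in> L \<longleftrightarrow> y \<in> M"
    by blast+
  define z0 where "z0 = \<psi> x"
  have z0: "z0 \<in> W'" "z0 \<in> L" "\<zeta> z0 = x"
    using xW x c(7,9,11) by (auto simp: z0_def)
  have \<zeta>M: "\<zeta> z \<in> M" if "z \<in> W'" "z \<in> L" for z
    using that c(8,10,11) by (metis image_subset_iff)
  have \<zeta>P: "\<zeta> ` (W' \<inter> L) \<subseteq> M" using \<zeta>M by blast
  have C\<zeta>: "C_on r \<zeta> (W' \<inter> L)" using c(4) by (rule C_on_subset) simp
  have z0P: "z0 \<in> W' \<inter> L" using z0 by simp
  obtain Q \<Phi> where Q: "open Q" "z0 \<in> Q" "C_on r \<Phi> Q" "\<forall>z\<in>Q \<inter> (W' \<inter> L). \<Phi> z = f (\<zeta> z)"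
    using C_on_extension[OF C_on_compose[OF C\<zeta> f \<zeta>P] z0P] by blast
  let ?D = "frechet_derivative \<Phi> (at z0)"
  have der: "(\<Phi> has_derivative ?D) (at z0)" by (rule C_on_has_derivative[OF Q(3,1) r Q(2)])
  obtain W2 B2 where W2: "open W2" "x \<in> W2" "B2 \<ge> 0"
    "\<forall>y\<in>W2 \<inter> W. \<forall>z\<in>W2 \<inter> W. norm (\<psi> y - \<psi> z) \<le> B2 * norm (y - z)"
    using C_on_imp_locally_Lipschitz[OF c(3) r xW] by blast
  \<comment> \<open>The Lipschitz inverse of \<open>f\<close> at \<open>x\<close>, followed by the
    Lipschitz chart \<open>\<psi>\<close>, is what bounds the derivative from below on
    \<open>L\<close>.\<close>
  have immersion: "norm u \<le> (B2 * c) * norm (?D u)" if u: "u \<in> L" for u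
  proof (rule has_derivative_lower_bound[OF der c(5) z0(2) _ _ _ _ u])
    show "open (Q \<inter> (W' \<inter> \<zeta> -` W2))"
      by (intro open_Int Q(1) continuous_open_preimage[OF C_on_imp_continuous_on[OF c(4)] c(2) W2(1)])
    show "z0 \<in> Q \<inter> (W' \<inter> \<zeta> -` W2)" using z0 Q(2) W2(2) by simp
    fix z assume z: "z \<in> Q \<inter> (W' \<inter> \<zeta> -` W2)" "z \<in> L"
    have "\<zeta> z \<in> W2 \<inter> W" "x \<in> W2 \<inter> W" using z(1) c(8) W2(2) xW by auto
    then have "norm (\<psi> (\<zeta> z) - \<psi> x) \<le> B2 * norm (\<zeta> z - x)" using W2(4) by blast
    also have "\<dots> \<le> B2 * (c * norm (f x - f (\<zeta> z)))"
      using inv[of "\<zeta> z"] \<zeta>M z W2(3) by (intro mult_left_mono) (auto simp: norm_minus_commute)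
    also have "f (\<zeta> z) = \<Phi> z" using Q(4) z by simp
    also have "f x = \<Phi> z0" using Q(2,4) z0 by simp
    finally show "norm (z - z0) \<le> (B2 * c) * norm (\<Phi> z - \<Phi> z0)"
      using c(10) z(1) by (simp add: z0_def mult.assoc norm_minus_commute)
  qed (use W2(3) c0 in simp)
  have dL: "dim L \<le> CARD('k)" using c(6) M(3) by simp
  obtain L' :: "(real ^ 'k) set" and J J' where J: "subspace L'" "dim L' = dim L" "linear J" "linear J'"
    "J ` L' = L" "J' ` L = L'" "\<forall>t\<in>L'. norm (J t) = norm t" "\<forall>t\<in>L'. J' (J t) = t" "\<forall>z\<in>L. J (J' z) = z"
    using subspace_linear_image[OF c(5) dL] by (elim exE conjE) (rule that; assumption)
  have linD: "linear ?D" by (rule has_derivative_linear[OF der])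
  have linA: "linear (\<lambda>t. ?D (J t))" using linear_compose[OF J(3) linD] by (simp add: comp_def)
  have "inj_on (\<lambda>t. ?D (J t)) L'"
  proof (rule inj_onI)
    fix s t assume st: "s \<in> L'" "t \<in> L'" "?D (J s) = ?D (J t)"
    have "J (s - t) \<in> L" using st(1,2) J(1,5) subspace_diff by blast
    moreover have "?D (J (s - t)) = 0" using st(3) linear_diff[OF linA, of s t] by simp
    ultimately have "J (s - t) = 0" using immersion[of "J (s - t)"] by simp
    moreover have "norm (J (s - t)) = norm (s - t)" using st(1,2) J(1,7) subspace_diff by blast
    ultimately show "s = t" by simp
  qed
  from linear_injective_extension[OF linA J(1) this]
  obtain \<pi> G where \<pi>: "linear \<pi>" "linear G" "range \<pi> \<subseteq> L'" "\<forall>v\<in>L'. \<pi> v = v"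
    and inj: "inj (\<lambda>v. ?D (J (\<pi> v)) + G (v - \<pi> v))" by blast
  define s0 where "s0 = J' z0"
  have s0: "s0 \<in> L'" "J s0 = z0" "\<pi> s0 = s0" using z0(2) J(6,9) \<pi>(4) by (auto simp: s0_def)
  define \<Psi> where "\<Psi> s = \<Phi> (J (\<pi> s)) + G (s - \<pi> s)" for s
  have linJ\<pi>: "linear (\<lambda>s. J (\<pi> s))" using linear_compose[OF \<pi>(1) J(3)] by (simp add: comp_def)
  have linG: "linear (\<lambda>s. G (s - \<pi> s))"
    using linear_compose[OF linear_compose_sub[OF linear_ident \<pi>(1)] \<pi>(2)] by (simp add: comp_def)
  define S where "S = (\<lambda>s. J (\<pi> s)) -` (Q \<inter> W')"
  have oS: "open S"
    unfolding S_def using linJ\<pi> Q(1) c(2)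
    by (intro open_vimage open_Int linear_continuous_on linear_conv_bounded_linear[THEN iffD1])
  have C\<Psi>: "C_on r \<Psi> S"
    unfolding \<Psi>_def
    by (intro C_on_add C_on_compose[OF C_on_bounded_linear Q(3)] C_on_bounded_linear
        linear_conv_bounded_linear[THEN iffD1] linJ\<pi> linG) (auto simp: S_def)
  have s0S: "s0 \<in> S" using s0 z0 Q(2) by (simp add: S_def)
  have "(\<Psi> has_derivative (\<lambda>v. ?D (J (\<pi> v)) + G (v - \<pi> v))) (at s0)"
    unfolding \<Psi>_def
  proof (rule has_derivative_add)
    show "((\<lambda>s. \<Phi> (J (\<pi> s))) has_derivative (\<lambda>v. ?D (J (\<pi> v)))) (at s0)"
      by (rule has_derivative_compose[OF linear_imp_has_derivative[OF linJ\<pi>]]) (use der s0 in simp)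
    show "((\<lambda>s. G (s - \<pi> s)) has_derivative (\<lambda>v. G (v - \<pi> v))) (at s0)"
      by (rule linear_imp_has_derivative[OF linG])
  qed
  then have "frechet_derivative \<Psi> (at s0) = (\<lambda>v. ?D (J (\<pi> v)) + G (v - \<pi> v))"
    by (rule frechet_derivative_at[symmetric])
  then have "inj (frechet_derivative \<Psi> (at s0))" using inj by simp
  from C_on_inverse_function[OF oS s0S r C\<Psi> this]
  obtain S' V0 \<rho> where S': "open S'" "S' \<subseteq> S" "s0 \<in> S'" "open V0" "\<Psi> s0 \<in> V0"
    "homeomorphism S' V0 \<Psi> \<rho>" "C_on r \<rho> V0" by blast
  have \<Psi>\<rho>: "\<rho> (\<Psi> s) = s" "\<Psi> s \<in> V0" if "s \<in> S'" for s
    using S'(6) that by (auto simp: homeomorphism_def)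
  have \<rho>\<Psi>: "\<Psi> (\<rho> q) = q" "\<rho> q \<in> S'" if "q \<in> V0" for q
    using S'(6) that by (auto simp: homeomorphism_def)
  have G0: "G 0 = 0" using \<pi>(2) by (rule linear_0)
  have \<Psi>_L: "\<Psi> t = f (\<zeta> (J t))" "J t \<in> W'" "J t \<in> L" if "t \<in> S'" "t \<in> L'" for t
  proof -
    have "\<pi> t = t" using \<pi>(4) that by blast
    moreover have "t \<in> S" using S'(2) that by blast
    ultimately have "J t \<in> Q" "J t \<in> W'" by (auto simp: S_def)
    moreover show "J t \<in> L" using J(5) that by blast
    ultimately show "\<Psi> t = f (\<zeta> (J t))" "J t \<in> W'" using Q(4) \<open>\<pi> t = t\<close> by (auto simp: \<Psi>_def G0)
  qed
  have fx: "f x = \<Psi> s0" using \<Psi>_L(1)[OF S'(3) s0(1)] s0(2) z0(3) by simp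
  \<comment> \<open>The points whose chart parameter lies in \<open>S'\<close>; for those in
    \<open>M\<close>, \<open>f\<close> agrees with the local diffeomorphism \<open>\<Psi>\<close> at
    a point of \<open>L'\<close>.\<close>
  define N where "N = W \<inter> (\<lambda>y. J' (\<psi> y)) -` S'"
  have oN: "open N"
    unfolding N_def
    by (intro continuous_open_preimage c(1) S'(1) C_on_imp_continuous_on[OF C_on_compose[OF c(3)
          C_on_bounded_linear[OF linear_conv_bounded_linear[THEN iffD1, OF J(4)]] subset_UNIV]])
  have xN: "x \<in> N" using xW S'(3) by (simp add: N_def s0_def z0_def)
  have NM: "J' (\<psi> y) \<in> S'" "J' (\<psi> y) \<in> L'" "J (J' (\<psi> y)) = \<psi> y" "f y = \<Psi> (J' (\<psi> y))"
    if "y \<in> N" "y \<in> M" for y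
  proof -
    have yL: "y \<in> W" "\<psi> y \<in> L" using that c(11) by (auto simp: N_def)
    show 1: "J' (\<psi> y) \<in> S'" "J' (\<psi> y) \<in> L'" "J (J' (\<psi> y)) = \<psi> y"
      using that yL J(6,9) by (auto simp: N_def)
    show "f y = \<Psi> (J' (\<psi> y))" using \<Psi>_L(1)[OF 1(1,2)] 1(3) c(9) yL(1) by simp
  qed
  have param: "\<zeta> (J t) \<in> N" "\<zeta> (J t) \<in> M" "J' (\<psi> (\<zeta> (J t))) = t" if "t \<in> S'" "t \<in> L'" for t
  proof -
    note t = \<Psi>_L[OF that]
    show "\<zeta> (J t) \<in> M" using \<zeta>M t by blast
    have "\<psi> (\<zeta> (J t)) = J t" using c(10) t by blast
    then show "J' (\<psi> (\<zeta> (J t))) = t" using J(8) that by simp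
    then show "\<zeta> (J t) \<in> N" using c(8) t that by (auto simp: N_def)
  qed
  define V where "V = V0 - f ` (M - N)"
  have oV: "open V"
  proof -
    have "compact (f ` (M - N))"
      by (intro compact_continuous_image continuous_on_subset[OF C_on_imp_continuous_on[OF f]] compact_diff M(1) oN) blast
    then show ?thesis unfolding V_def using S'(4) by (intro open_Diff compact_imp_closed)
  qed
  have fxV: "f x \<in> V"
  proof -
    have "f x \<notin> f ` (M - N)"
    proof
      assume "f x \<in> f ` (M - N)"
      then obtain y where "y \<in> M - N" "f x = f y" by blast
      then show False using inv[of y] xN by auto
    qed
    then show ?thesis using S'(5) fx by (simp add: V_def)
  qed
  define U where "U = M \<inter> N \<inter> f -` V"
  have VU: "V \<inter> f ` M = f ` U" by (auto simp: V_def U_def)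
  have xU: "x \<in> U" using x xN fxV by (simp add: U_def)
  have oU: "openin (top_of_set M) U"
  proof -
    have "openin (top_of_set M) (M \<inter> f -` V)"
      by (rule continuous_openin_preimage_gen[OF C_on_imp_continuous_on[OF f] oV])
    moreover have "openin (top_of_set M) (M \<inter> N)" using oN by (rule openin_open_Int)
    ultimately have "openin (top_of_set M) ((M \<inter> N) \<inter> (M \<inter> f -` V))" by (rule openin_Int[rotated])
    moreover have "(M \<inter> N) \<inter> (M \<inter> f -` V) = U" by (auto simp: U_def)
    ultimately show ?thesis by simp
  qed
  have V0: "V \<subseteq> V0" by (auto simp: V_def)
  have \<rho>f: "\<rho> (f y) = J' (\<psi> y)" if "y \<in> U" for y
    using NM(1,4)[of y] \<Psi>\<rho>(1) that by (auto simp: U_def)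
  have sub: "embedded_submanifold r d (V \<inter> f ` M)"
    unfolding embedded_submanifold_def
  proof
    fix q assume q: "q \<in> V \<inter> f ` M"
    have eqV: "\<rho> ` V = S' \<inter> \<Psi> -` V"
    proof (intro equalityI subsetI)
      fix s assume "s \<in> S' \<inter> \<Psi> -` V"
      then show "s \<in> \<rho> ` V" using \<Psi>\<rho>(1) by (intro image_eqI[of _ _ "\<Psi> s"]) auto
    qed (use \<rho>\<Psi> V0 in auto)
    have C\<Psi>': "C_on r \<Psi> S'" using C\<Psi> S'(2) by (rule C_on_subset)
    have o: "open (\<rho> ` V)"
      unfolding eqV by (rule continuous_open_preimage[OF C_on_imp_continuous_on[OF C\<Psi>'] S'(1) oV])
    have inj\<rho>: "inj_on \<rho> V" using \<rho>\<Psi>(1) V0 by (intro inj_on_inverseI[of _ \<Psi>]) auto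
    have "C_on r (the_inv_into V \<rho>) (\<rho> ` V)"
    proof (rule C_on_cong_subset[OF C\<Psi>'])
      show "\<rho> ` V \<subseteq> S'" using eqV by blast
      show "\<Psi> s = the_inv_into V \<rho> s" if "s \<in> \<rho> ` V" for s
        using that the_inv_into_f_f[OF inj\<rho>] \<rho>\<Psi>(1) V0 by auto
    qed
    then have diff: "C_diffeo_on r \<rho> V (\<rho> ` V)"
      unfolding C_diffeo_on_def using inj\<rho> C_on_subset[OF S'(7) V0] by (simp add: bij_betw_def)
    \<comment> \<open>\<open>V \<inter> f\<close>
      M\<open>is the image of\<close>U\<open>, and on it\<close>\<rho> (f y) = J' (\<psi>
      y)\<open>lies in\<close>L'\<open>. Conversely, a parameter in\<close>S' \<inter>
      L'\<open>is mapped by\<close>\<Psi>\<open>into\<close>f \<open>M\<close>.\<close>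
    have im: "\<rho> ` (V \<inter> (V \<inter> f ` M)) = \<rho> ` V \<inter> L'"
    proof (intro equalityI subsetI)
      fix s assume "s \<in> \<rho> ` (V \<inter> (V \<inter> f ` M))"
      then obtain p where p: "p \<in> V" "p \<in> f ` U" "s = \<rho> p" using VU by blast
      then obtain y where y: "y \<in> U" "p = f y" by blast
      have "s \<in> \<rho> ` V" using p(1,3) by blast
      moreover have "s \<in> L'" using p(3) y(2) \<rho>f[OF y(1)] NM(2)[of y] y(1) by (simp add: U_def)
      ultimately show "s \<in> \<rho> ` V \<inter> L'" by blast
    next
      fix s assume s: "s \<in> \<rho> ` V \<inter> L'"
      then obtain p where p: "p \<in> V" "s = \<rho> p" by blast
      have "s \<in> S'" using s eqV by blast
      then have "\<Psi> s = f (\<zeta> (J s))" "\<zeta> (J s) \<in> M" using \<Psi>_L(1) param(2) s by blast+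
      moreover have "\<Psi> s = p" using p \<rho>\<Psi>(1) V0 by blast
      ultimately show "s \<in> \<rho> ` (V \<inter> (V \<inter> f ` M))" using p by blast
    qed
    show "\<exists>W (W' :: (real ^ 'k) set) \<psi> L. open W \<and> q \<in> W \<and> open W' \<and> C_diffeo_on r \<psi> W W' \<and> subspace L \<and> dim L = d \<and>
        \<psi> ` (W \<inter> (V \<inter> f ` M)) = W' \<inter> L"
      by (rule exI[of _ V], rule exI[of _ "\<rho> ` V"], rule exI[of _ \<rho>], rule exI[of _ L'])
        (use q J(1,2) c(6) oV o diff im in simp)
  qed
  have injU: "inj_on f U"
  proof (rule inj_on_inverseI[of _ "\<lambda>q. \<zeta> (J (\<rho> q))"])
    fix y assume y: "y \<in> U"
    then have "y \<in> N" "y \<in> M" "y \<in> W" by (auto simp: U_def N_def)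
    then show "\<zeta> (J (\<rho> (f y))) = y" using \<rho>f[OF y] NM(3) c(9) by simp
  qed
  \<comment> \<open>The inverse of \<open>f\<close> on \<open>U\<close> reads off the parameter by
    \<open>\<rho>\<close> and returns to \<open>M\<close> through the chart.\<close>
  have Cinv: "C_on r (\<lambda>q. \<zeta> (J (\<rho> q))) (f ` U)"
  proof (rule C_on_compose[OF C_on_compose[OF _ C_on_bounded_linear[OF linear_conv_bounded_linear[THEN iffD1, OF J(3)]] subset_UNIV] c(4)])
    show "C_on r \<rho> (f ` U)" using S'(7) by (rule C_on_subset) (use VU V0 in blast)
    show "(\<lambda>q. J (\<rho> q)) ` f ` U \<subseteq> W'"
    proof clarify
      fix y assume y: "y \<in> U"
      then have "y \<in> N" "y \<in> M" "y \<in> W" by (auto simp: U_def N_def)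
      then show "J (\<rho> (f y)) \<in> W'" using \<rho>f[OF y] NM(3) c(7) by auto
    qed
  qed
  have "C_on r (the_inv_into U f) (f ` U)"
  proof (rule C_on_cong_subset[OF Cinv order_refl])
    fix q assume "q \<in> f ` U"
    then obtain y where y: "y \<in> U" "q = f y" by blast
    then have "y \<in> N" "y \<in> M" "y \<in> W" by (auto simp: U_def N_def)
    then show "\<zeta> (J (\<rho> q)) = the_inv_into U f q"
      using \<rho>f[OF y(1)] NM(3) c(9) y the_inv_into_f_f[OF injU y(1)] by simp
  qed
  moreover have "C_on r f U" using f by (rule C_on_subset) (auto simp: U_def)
  ultimately have "C_diffeo_on r f U (V \<inter> f ` M)"
    unfolding C_diffeo_on_def VU using injU by (simp add: bij_betw_def)
  then show ?thesis using oU xU oV fxV sub by blast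
qed

subsection \<open>The embedding theorem\<close>

theorem theorem4p1:
  fixes r :: enat and d k :: nat
    and M X :: "(real ^ 'n) set"
    and T :: "real ^ 'n \<Rightarrow> real ^ 'n"
    and \<mu> :: "(real ^ 'n) measure"
    and idx :: "'k::finite \<Rightarrow> nat"
    and hs :: "'m::finite \<Rightarrow> real ^ 'n \<Rightarrow> real"
    and h :: "real ^ 'n \<Rightarrow> real"
  assumes "1 \<le> r"
    and "compact M" and "embedded_submanifold r d M"
    and "C_diffeo_on r T M M"
    and "compact X" and "X \<subseteq> M"
    and "prob_space \<mu>" and "sets \<mu> = sets (restrict_space borel X)"
    and "k = CARD('k)" and "bij_betw idx UNIV {..<k}"
    and "emeasure \<mu> (X \<inter> (\<Union>j\<in>{1..k - 1}. Per M T j)) = 0"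
    and "is_function_basis hs (polys_degree_le (2 * k - 1))"
    and "C_on r h M"
  shows "AE \<alpha> in lebesgue. let \<phi> = delay_map idx T (perturbed_observable h hs \<alpha>) in
     (hausdorff_measure k X = 0 \<and> k \<ge> d \<longrightarrow>
        (AE x in \<mu>. \<exists>C\<ge>0. \<forall>y\<in>X. norm (x - y) \<le> C * norm (\<phi> x - \<phi> y))) \<and>
     (k > d \<longrightarrow>
        (AE x in \<mu>. \<exists>U V. openin (top_of_set M) U \<and> x \<in> U \<and> open V \<and> \<phi> x \<in> V \<and>
           embedded_submanifold r d (V \<inter> \<phi> ` M) \<and>
           C_diffeo_on r \<phi> U (V \<inter> \<phi> ` M)))"
proof -
  interpret delay_system r d M T idx hs h
    using assms by unfold_locales auto
  interpret \<mu>: prob_space \<mu> by fact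
  have space: "space \<mu> = X"
    using sets_eq_imp_space_eq[OF assms(8)] by (simp add: space_restrict_space)
  have Per: "emeasure \<mu> (X \<inter> (\<Union>j\<in>{1..CARD('k) - 1}. Per M T j)) = 0"
    using assms(9,11) by simp
  have 1: "AE \<alpha> in lebesgue. hausdorff_measure k X = 0 \<and> k \<ge> d \<longrightarrow>
    (AE x in \<mu>. \<exists>C\<ge>0. \<forall>y\<in>X. norm (x - y) \<le> C * norm (\<phi> \<alpha> x - \<phi> \<alpha> y))"
  \<comment> \<open>The premise of the claim does not depend on \<open>\<alpha>\<close>, so it is
    decided before the quantifier over almost every \<open>\<alpha>\<close>.\<close>
  proof (cases "hausdorff_measure k X = 0 \<and> k \<ge> d")
    case True
    then have "hausdorff_measure CARD('k) X = 0" "d \<le> CARD('k)" using assms(9) by simp_all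
    from AE_Lipschitz_inverse[OF assms(5,6,7,8) Per this(2) assms(5,6)
        lipschitz_negligible_if_hausdorff_measure_0[OF this(1)]]
    show ?thesis by simp
  next
    case False
    show ?thesis by (intro AE_I2 impI) (use False in blast)
  qed
  have 2: "AE \<alpha> in lebesgue. k > d \<longrightarrow> (AE x in \<mu>. \<exists>U V. openin (top_of_set M) U \<and> x \<in> U \<and>
    open V \<and> \<phi> \<alpha> x \<in> V \<and> embedded_submanifold r d (V \<inter> \<phi> \<alpha> ` M) \<and>
    C_diffeo_on r (\<phi> \<alpha>) U (V \<inter> \<phi> \<alpha> ` M))"
  proof (cases "k > d")
    case True
    then have d: "d < CARD('k)" "d \<le> CARD('k)" using assms(9) by simp_all
    from AE_Lipschitz_inverse[OF assms(5,6,7,8) Per d(2) compact_M order_refl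
        lipschitz_negligible_submanifold[OF submanifold_M r d(1)]]
    show ?thesis
    proof eventually_elim
      case (elim \<alpha>)
      then have "AE x in \<mu>. \<exists>U V. openin (top_of_set M) U \<and> x \<in> U \<and>
        open V \<and> \<phi> \<alpha> x \<in> V \<and> embedded_submanifold r d (V \<inter> \<phi> \<alpha> ` M) \<and>
        C_diffeo_on r (\<phi> \<alpha>) U (V \<inter> \<phi> \<alpha> ` M)"
        using AE_space
      proof eventually_elim
        case (elim x)
        then have "x \<in> M" using assms(6) space by blast
        moreover obtain C where "C \<ge> 0" "\<forall>y\<in>M. norm (x - y) \<le> C * norm (\<phi> \<alpha> x - \<phi> \<alpha> y)"
          using elim(1) by blast
        ultimately show ?case
          by (intro embedding_if_Lipschitz_inverse_at[OF r compact_M submanifold_M d(2) C_\<phi>]) auto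
      qed
      then show ?case by blast
    qed
  next
    case False
    then show ?thesis by simp
  qed
  from 1 2 show ?thesis
    unfolding Let_def \<phi>_def by (rule AE_conjI)
qed

end
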